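(* Let $\Omega\subseteq\mathbb{R}^N$ be an open set (possibly unbounded or of infinite measure) with finite torsional rigidity, $P(\Omega)<+\infty$. Then the resolvent operator of the Dirichlet Laplacian on $\Omega$, that is, the operator $\mathcal{R}_\Omega:L^2(\Omega)\to L^2(\Omega)$ which associates to $f\in L^2(\Omega)$ the solution $u\in H^1_0(\Omega)$ of $-\Delta u+u=f$ in $\Omega$, is compact.
   Context: The torsional rigidity of $\Omega$ is $P(\Omega)=\int_\Omega u\,dx$, where $u\in H^1_0(\Omega)$ solves $-\Delta u=1$ in $\mathcal{D}'(\Omega)$. The hypothesis $P(\Omega)<+\infty$ means that such a function $u\in H^1_0(\Omega)$ exists and $\int_\Omega u\,dx<+\infty$. *)

theory Defs
  imports "HOL-Analysis.Analysis"
begin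

section \<open>Test functions\<close>

definition partial_deriv :: "'a::euclidean_space \<Rightarrow> ('a \<Rightarrow> real) \<Rightarrow> 'a \<Rightarrow> real"
  where "partial_deriv b \<phi> x = frechet_derivative \<phi> (at x) b"

definition gradient :: "('a::euclidean_space \<Rightarrow> real) \<Rightarrow> 'a \<Rightarrow> 'a"
  where "gradient \<phi> x = (\<Sum>b\<in>Basis. partial_deriv b \<phi> x *\<^sub>R b)"

definition laplacian :: "('a::euclidean_space \<Rightarrow> real) \<Rightarrow> 'a \<Rightarrow> real"
  where "laplacian \<phi> x = (\<Sum>b\<in>Basis. partial_deriv b (partial_deriv b \<phi>) x)"

primrec C_k :: "nat \<Rightarrow> ('a::euclidean_space \<Rightarrow> real) \<Rightarrow> bool" where
  "C_k 0 \<phi> \<longleftrightarrow> continuous_on UNIV \<phi>"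
| "C_k (Suc k) \<phi> \<longleftrightarrow>
     (\<forall>x. \<phi> differentiable (at x)) \<and> (\<forall>b\<in>Basis. C_k k (partial_deriv b \<phi>))"

definition test_functions :: "'a::euclidean_space set \<Rightarrow> ('a \<Rightarrow> real) set"
  where "test_functions \<Omega> =
    {\<phi>. (\<forall>k. C_k k \<phi>) \<and> compact (closure {x. \<phi> x \<noteq> 0}) \<and> closure {x. \<phi> x \<noteq> 0} \<subseteq> \<Omega>}"


section \<open>Lebesgue and Sobolev spaces\<close>

text \<open>Elements of the function spaces on \<open>\<Omega>\<close> are represented by functions on the whole space
  whose values outside \<open>\<Omega>\<close> are irrelevant. Functions that agree a.e. on \<open>\<Omega>\<close> are not identified,
  so \<open>L2_norm \<Omega>\<close> is a seminorm whose kernel consists of the functions vanishing a.e. on \<open>\<Omega>\<close>.\<close>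

definition L2 :: "'a::euclidean_space set \<Rightarrow> ('a \<Rightarrow> 'b::euclidean_space) set"
  where "L2 \<Omega> = {f \<in> borel_measurable (lebesgue_on \<Omega>).
    integrable (lebesgue_on \<Omega>) (\<lambda>x. (norm (f x))\<^sup>2)}"

definition L2_norm :: "'a::euclidean_space set \<Rightarrow> ('a \<Rightarrow> 'b::euclidean_space) \<Rightarrow> real"
  where "L2_norm \<Omega> f = sqrt (LINT x|lebesgue_on \<Omega>. (norm (f x))\<^sup>2)"

definition is_weak_gradient ::
    "'a::euclidean_space set \<Rightarrow> ('a \<Rightarrow> real) \<Rightarrow> ('a \<Rightarrow> 'a) \<Rightarrow> bool"
  where "is_weak_gradient \<Omega> u g \<longleftrightarrow>
    (\<forall>\<phi>\<in>test_functions \<Omega>. \<forall>b\<in>Basis.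
      (LINT x|lebesgue_on \<Omega>. u x * partial_deriv b \<phi> x)
        = - (LINT x|lebesgue_on \<Omega>. (g x \<bullet> b) * \<phi> x))"

text \<open>The closure of the test functions in \<open>H\<^sup>1(\<Omega>)\<close>, the norm of \<open>H\<^sup>1(\<Omega>)\<close> being
  that of \<open>u\<close> and of its weak gradient in \<open>L\<^sup>2(\<Omega>)\<close>.\<close>

definition H10 :: "'a::euclidean_space set \<Rightarrow> ('a \<Rightarrow> real) set"
  where "H10 \<Omega> = {u \<in> L2 \<Omega>. \<exists>g\<in>L2 \<Omega>. is_weak_gradient \<Omega> u g \<and>
    (\<exists>\<phi>. (\<forall>n::nat. \<phi> n \<in> test_functions \<Omega>) \<and>
      (\<lambda>n. L2_norm \<Omega> (\<lambda>x. \<phi> n x - u x)) \<longlonglongrightarrow> 0 \<and>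
      (\<lambda>n. L2_norm \<Omega> (\<lambda>x. gradient (\<phi> n) x - g x)) \<longlonglongrightarrow> 0)}"


section \<open>Torsional rigidity and the resolvent of the Dirichlet Laplacian\<close>

text \<open>\<open>-\<Delta>u + c u = f\<close> in the sense of distributions on \<open>\<Omega>\<close>, for locally integrable \<open>u\<close>, \<open>f\<close>.\<close>

definition solves_distr ::
    "'a::euclidean_space set \<Rightarrow> real \<Rightarrow> ('a \<Rightarrow> real) \<Rightarrow> ('a \<Rightarrow> real) \<Rightarrow> bool"
  where "solves_distr \<Omega> c f u \<longleftrightarrow>
    (\<forall>\<phi>\<in>test_functions \<Omega>.
      (LINT x|lebesgue_on \<Omega>. u x * (- laplacian \<phi> x + c * \<phi> x))
        = (LINT x|lebesgue_on \<Omega>. f x * \<phi> x))"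

definition torsion_function :: "'a::euclidean_space set \<Rightarrow> ('a \<Rightarrow> real) \<Rightarrow> bool"
  where "torsion_function \<Omega> u \<longleftrightarrow> u \<in> H10 \<Omega> \<and> solves_distr \<Omega> 0 (\<lambda>x. 1) u"

text \<open>A torsion function is unique up to null sets, so the choice of representative is immaterial,
  and it is nonnegative a.e. by the maximum principle, so \<open>ennreal\<close> cuts nothing off.\<close>

definition torsional_rigidity :: "'a::euclidean_space set \<Rightarrow> ennreal"
  where "torsional_rigidity \<Omega> =
    (if \<exists>u. torsion_function \<Omega> u
     then \<integral>\<^sup>+ x. ennreal ((SOME u. torsion_function \<Omega> u) x) \<partial>lebesgue_on \<Omega>
     else \<infinity>)"

text \<open>For open \<open>\<Omega>\<close> and \<open>f\<close> in \<open>L\<^sup>2(\<Omega>)\<close> the solution exists and is unique up to null sets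
  (Lax--Milgram); the choice operator only picks a representative.\<close>

definition dirichlet_resolvent :: "'a::euclidean_space set \<Rightarrow> ('a \<Rightarrow> real) \<Rightarrow> 'a \<Rightarrow> real"
  where "dirichlet_resolvent \<Omega> f = (SOME u. u \<in> H10 \<Omega> \<and> solves_distr \<Omega> 1 f u)"


section \<open>Compact operators on the space of square integrable functions\<close>

text \<open>A linear operator on a.e.-classes that maps bounded sequences to sequences
  with a convergent subsequence.\<close>

definition compact_operator_L2 ::
    "'a::euclidean_space set \<Rightarrow> (('a \<Rightarrow> real) \<Rightarrow> 'a \<Rightarrow> real) \<Rightarrow> bool"
  where "compact_operator_L2 \<Omega> T \<longleftrightarrow>
    (\<forall>f\<in>L2 \<Omega>. T f \<in> L2 \<Omega>) \<and>
    (\<forall>f\<in>L2 \<Omega>. \<forall>g\<in>L2 \<Omega>. (AE x in lebesgue_on \<Omega>. f x = g x) \<longrightarrow>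
      (AE x in lebesgue_on \<Omega>. T f x = T g x)) \<and>
    (\<forall>f\<in>L2 \<Omega>. \<forall>g\<in>L2 \<Omega>. \<forall>a b. AE x in lebesgue_on \<Omega>.
      T (\<lambda>y. a * f y + b * g y) x = a * T f x + b * T g x) \<and>
    (\<forall>F. (\<forall>n::nat. F n \<in> L2 \<Omega>) \<and> (\<exists>C. \<forall>n. L2_norm \<Omega> (F n) \<le> C) \<longrightarrow>
      (\<exists>g\<in>L2 \<Omega>. \<exists>r. strict_mono r \<and>
        (\<lambda>n. L2_norm \<Omega> (\<lambda>x. T (F (r n)) x - g x)) \<longlonglongrightarrow> 0))"

end

theory Submission
  imports Defs "HOL-Complex_Analysis.Great_Picard"
begin

text \<open>A torsion function \<open>w\<close> enters only through the inequality
  \<open>\<bar>\<integral>\<phi>\<bar> = \<bar>\<integral>\<nabla>w \<bullet> \<nabla>\<phi>\<bar> \<le> K \<parallel>\<nabla>\<phi>\<parallel>\<close> for test functions \<open>\<phi>\<close>, with \<open>K = \<parallel>\<nabla>w\<parallel>\<close>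
  (\<open>torsion_function_bound\<close>; all norms without index are \<open>L\<^sup>2\<close> norms). Applied to smooth
  approximations of \<open>\<bar>\<phi>\<bar>\<close>, whose gradients are no larger, it gives
  \<open>\<parallel>\<phi>\<parallel>\<^sub>1 \<le> K \<parallel>\<nabla>\<phi>\<parallel>\<close> (\<open>L1_bound\<close>).

  This inequality forbids mass from escaping to infinity (\<open>tightness\<close>). For \<open>\<lambda> > 0\<close> the functional
  \<open>F v = \<parallel>v\<parallel>\<^sub>1 - \<lambda> \<parallel>\<nabla>v\<parallel>\<^sup>2\<close> is bounded above. Let \<open>v\<close> be a test function with \<open>F v\<close>
  close to the supremum. If \<open>\<phi>\<close> is another test function, then passing from \<open>v\<close> to
  \<open>v + \<phi>\<close> and \<open>v - \<phi>\<close> changes the average of \<open>\<parallel>\<nabla>v\<parallel>\<^sup>2\<close> by exactly \<open>\<parallel>\<nabla>\<phi>\<parallel>\<^sup>2\<close>, while the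
  average of the \<open>L\<^sup>1\<close> norms grows by at least the integral of \<open>\<bar>\<phi>\<bar>\<close> off the support of \<open>v\<close>.
  Near-maximality therefore bounds that integral by \<open>\<lambda> \<parallel>\<nabla>\<phi>\<parallel>\<^sup>2\<close> plus a small number,
  uniformly in \<open>\<phi>\<close>.

  To pass from \<open>L\<^sup>1\<close> to \<open>L\<^sup>2\<close>, functions are replaced by their averages over the cells of a grid of
  mesh \<open>h\<close>. The \<open>L\<^sup>2\<close> error is at most a constant times \<open>h \<parallel>\<nabla>u\<parallel>\<close> (\<open>cell_avg_approx\<close>), and the averages
  are bounded uniformly by \<open>\<parallel>u\<parallel>\<close> divided by the root of the cell volume (\<open>cell_avg_bound\<close>). Since
  they are bounded, their \<open>L\<^sup>2\<close> mass far out is controlled by their \<open>L\<^sup>1\<close> mass far out, which is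
  uniformly small by tightness; on a ball there is dominated convergence, because countably many
  cells occur and a diagonal subsequence makes all averages converge. Hence every sequence of test
  functions that is bounded together with its gradients has an \<open>L\<^sup>2\<close> Cauchy subsequence
  (\<open>compactness_test_functions\<close>).

  The resolvent itself is an orthogonal projection: \<open>u\<close> solves \<open>-\<Delta>u + u = f\<close> in \<open>H\<^sub>0\<^sup>1\<close> exactly
  when \<open>(u, \<nabla>u)\<close> is the projection of \<open>(f, 0)\<close> onto the closure of the pairs \<open>(\<phi>, \<nabla>\<phi>)\<close>. This gives
  existence and the energy bound \<open>\<parallel>(u, \<nabla>u)\<parallel> \<le> \<parallel>f\<parallel>\<close>, whence uniqueness and linearity; approximating
  the solutions by test functions then transfers the compactness.\<close>

section \<open>The Hilbert space of square integrable functions\<close>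

definition sq_integrable :: "'x measure \<Rightarrow> ('x \<Rightarrow> 'b::euclidean_space) set"
  where "sq_integrable M = {f \<in> borel_measurable M. integrable M (\<lambda>x. (norm (f x))\<^sup>2)}"

definition sq_inner :: "'x measure \<Rightarrow> ('x \<Rightarrow> 'b::euclidean_space) \<Rightarrow> ('x \<Rightarrow> 'b) \<Rightarrow> real"
  where "sq_inner M f g = (LINT x|M. f x \<bullet> g x)"

definition sq_norm :: "'x measure \<Rightarrow> ('x \<Rightarrow> 'b::euclidean_space) \<Rightarrow> real"
  where "sq_norm M f = sqrt (LINT x|M. (norm (f x))\<^sup>2)"

lemma sq_integrableI:
  "f \<in> borel_measurable M \<Longrightarrow> integrable M (\<lambda>x. (norm (f x))\<^sup>2) \<Longrightarrow> f \<in> sq_integrable M"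
  by (simp add: sq_integrable_def)

lemma sq_integrable_measurable: "f \<in> sq_integrable M \<Longrightarrow> f \<in> borel_measurable M"
  by (simp add: sq_integrable_def)

lemma sq_integrable_norm2: "f \<in> sq_integrable M \<Longrightarrow> integrable M (\<lambda>x. (norm (f x))\<^sup>2)"
  by (simp add: sq_integrable_def)

lemma sq_integrable_dominated:
  assumes "f \<in> sq_integrable M" "g \<in> borel_measurable M" "\<And>x. norm (g x) \<le> C * norm (f x)"
  shows "g \<in> sq_integrable M"
proof (rule sq_integrableI)
  have "(norm (g x))\<^sup>2 \<le> C\<^sup>2 * (norm (f x))\<^sup>2" for x
    unfolding power_mult_distrib[symmetric] by (rule power_mono) (auto intro: assms(3))
  then have "AE x in M. norm ((norm (g x))\<^sup>2) \<le> norm (C\<^sup>2 * (norm (f x))\<^sup>2)"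
    by (intro AE_I2) (simp only: real_norm_def abs_of_nonneg mult_nonneg_nonneg zero_le_power2)
  moreover have "integrable M (\<lambda>x. C\<^sup>2 * (norm (f x))\<^sup>2)"
    using sq_integrable_norm2[OF assms(1)] by simp
  moreover have "(\<lambda>x. (norm (g x))\<^sup>2) \<in> borel_measurable M"
    using assms(2) by measurable
  ultimately show "integrable M (\<lambda>x. (norm (g x))\<^sup>2)"
    by (rule Bochner_Integration.integrable_bound[rotated 2])
qed (use assms in auto)

lemma sq_integrable_inner:
  assumes "f \<in> sq_integrable M" "g \<in> sq_integrable M"
  shows "integrable M (\<lambda>x. f x \<bullet> g x)"
proof (rule Bochner_Integration.integrable_bound)
  show "integrable M (\<lambda>x. (norm (f x))\<^sup>2 + (norm (g x))\<^sup>2)"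
    using assms by (auto simp: sq_integrable_def)
  have "\<bar>f x \<bullet> g x\<bar> \<le> (norm (f x))\<^sup>2 + (norm (g x))\<^sup>2" for x
  proof -
    have "\<bar>f x \<bullet> g x\<bar> \<le> norm (f x) * norm (g x)"
      by (rule Cauchy_Schwarz_ineq2)
    moreover have "2 * (norm (f x) * norm (g x)) \<le> (norm (f x))\<^sup>2 + (norm (g x))\<^sup>2"
      using sum_squares_bound[of "norm (f x)" "norm (g x)"] by (simp add: mult.assoc)
    ultimately show ?thesis
      by (smt (verit) mult_nonneg_nonneg norm_ge_zero)
  qed
  then show "AE x in M. norm (f x \<bullet> g x) \<le> norm ((norm (f x))\<^sup>2 + (norm (g x))\<^sup>2)"
    by simp
qed (use assms in \<open>auto simp: sq_integrable_def\<close>)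

lemma sq_integrable_add:
  assumes "f \<in> sq_integrable M" "g \<in> sq_integrable M"
  shows "(\<lambda>x. f x + g x) \<in> sq_integrable M"
proof (rule sq_integrableI)
  have "(norm (f x + g x))\<^sup>2 = (norm (f x))\<^sup>2 + 2 * (f x \<bullet> g x) + (norm (g x))\<^sup>2" for x
    unfolding power2_norm_eq_inner by (simp add: inner_add_left inner_add_right inner_commute)
  then show "integrable M (\<lambda>x. (norm (f x + g x))\<^sup>2)"
    using assms sq_integrable_inner[OF assms] by (auto simp: sq_integrable_def)
qed (use assms in \<open>auto simp: sq_integrable_def\<close>)

lemma sq_integrable_scale: "f \<in> sq_integrable M \<Longrightarrow> (\<lambda>x. a *\<^sub>R f x) \<in> sq_integrable M"
  by (auto simp: sq_integrable_def power_mult_distrib)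

lemma sq_integrable_diff:
  assumes "f \<in> sq_integrable M" "g \<in> sq_integrable M"
  shows "(\<lambda>x. f x - g x) \<in> sq_integrable M"
  using sq_integrable_add[OF assms(1) sq_integrable_scale[OF assms(2), of "-1"]] by simp

lemma sq_integrable_zero: "(\<lambda>x. 0) \<in> sq_integrable M"
  by (auto simp: sq_integrable_def)

lemma sq_norm_nonneg: "0 \<le> sq_norm M f"
  by (simp add: sq_norm_def)

lemma sq_norm_power2: "(sq_norm M f)\<^sup>2 = (LINT x|M. (norm (f x))\<^sup>2)"
  by (simp add: sq_norm_def)

lemma sq_norm_eq_sq_inner: "(sq_norm M f)\<^sup>2 = sq_inner M f f"
  by (simp add: sq_norm_power2 sq_inner_def power2_norm_eq_inner)

lemma sq_inner_commute: "sq_inner M f g = sq_inner M g f"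
  by (simp add: sq_inner_def inner_commute)

lemma sq_inner_add_left:
  "f \<in> sq_integrable M \<Longrightarrow> g \<in> sq_integrable M \<Longrightarrow> h \<in> sq_integrable M \<Longrightarrow>
    sq_inner M (\<lambda>x. f x + g x) h = sq_inner M f h + sq_inner M g h"
  by (simp add: sq_inner_def inner_add_left sq_integrable_inner)

lemma sq_inner_diff_left:
  "f \<in> sq_integrable M \<Longrightarrow> g \<in> sq_integrable M \<Longrightarrow> h \<in> sq_integrable M \<Longrightarrow>
    sq_inner M (\<lambda>x. f x - g x) h = sq_inner M f h - sq_inner M g h"
  by (simp add: sq_inner_def inner_diff_left sq_integrable_inner)

lemma sq_inner_scale_left: "sq_inner M (\<lambda>x. a *\<^sub>R f x) h = a * sq_inner M f h"
  by (simp add: sq_inner_def)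

lemma sq_norm_scale: "sq_norm M (\<lambda>x. a *\<^sub>R f x) = \<bar>a\<bar> * sq_norm M f"
  by (simp add: sq_norm_def power_mult_distrib real_sqrt_mult)

lemma sq_norm_expand:
  assumes "f \<in> sq_integrable M" "g \<in> sq_integrable M"
  shows "(sq_norm M (\<lambda>x. f x + a *\<^sub>R g x))\<^sup>2
    = (sq_norm M f)\<^sup>2 + 2 * a * sq_inner M f g + a\<^sup>2 * (sq_norm M g)\<^sup>2"
proof -
  have "(norm (f x + a *\<^sub>R g x))\<^sup>2 = (norm (f x))\<^sup>2 + 2 * a * (f x \<bullet> g x) + a\<^sup>2 * (norm (g x))\<^sup>2"
    for x
    unfolding power2_norm_eq_inner
    by (simp add: inner_add_left inner_add_right inner_commute power2_eq_square algebra_simps)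
  then show ?thesis
    using assms sq_integrable_inner[OF assms]
    by (simp add: sq_norm_power2 sq_inner_def sq_integrable_norm2)
qed

lemma sq_inner_Cauchy_Schwarz:
  assumes "f \<in> sq_integrable M" "g \<in> sq_integrable M"
  shows "\<bar>sq_inner M f g\<bar> \<le> sq_norm M f * sq_norm M g"
proof -
  have pos: "0 \<le> (sq_norm M f)\<^sup>2 + 2 * a * sq_inner M f g + a\<^sup>2 * (sq_norm M g)\<^sup>2" for a
    unfolding sq_norm_expand[OF assms, symmetric] by simp
  define A G c where "A = (sq_norm M f)\<^sup>2" and "G = (sq_norm M g)\<^sup>2" and "c = sq_inner M f g"
  have pos': "0 \<le> A + 2 * a * c + a\<^sup>2 * G" for a
    using pos by (simp add: A_def G_def c_def)
  have "c\<^sup>2 \<le> A * G"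
  proof (cases "G = 0")
    case True
    have "c = 0"
    proof (rule ccontr)
      assume ne: "c \<noteq> 0"
      define a where "a = - (A + 1) / (2 * c)"
      have "2 * a * c = - (A + 1)" using ne by (simp add: a_def)
      then show False using pos'[of a] True by simp
    qed
    then show ?thesis using True by simp
  next
    case False
    then have G: "0 < G" by (simp add: G_def)
    define a where "a = - c / G"
    have aG: "a * G = - c" using G by (simp add: a_def)
    have "a\<^sup>2 * G = - (a * c)" unfolding power2_eq_square mult.assoc aG by simp
    then have "0 \<le> A + a * c" using pos'[of a] by simp
    then have "0 \<le> (A + a * c) * G" using G by simp
    also have "(A + a * c) * G = A * G + (a * G) * c" by algebra
    finally show ?thesis unfolding aG by (simp add: power2_eq_square)
  qed
  then have "(sq_inner M f g)\<^sup>2 \<le> (sq_norm M f)\<^sup>2 * (sq_norm M g)\<^sup>2"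
    by (simp add: A_def G_def c_def)
  then have "\<bar>sq_inner M f g\<bar>\<^sup>2 \<le> (sq_norm M f * sq_norm M g)\<^sup>2"
    by (simp add: power_mult_distrib)
  then show ?thesis
    by (rule power2_le_imp_le) (simp add: sq_norm_nonneg)
qed

lemma sq_norm_triangle:
  assumes "f \<in> sq_integrable M" "g \<in> sq_integrable M"
  shows "sq_norm M (\<lambda>x. f x + g x) \<le> sq_norm M f + sq_norm M g"
proof (rule power2_le_imp_le)
  have "(sq_norm M (\<lambda>x. f x + g x))\<^sup>2 = (sq_norm M f)\<^sup>2 + 2 * sq_inner M f g + (sq_norm M g)\<^sup>2"
    using sq_norm_expand[OF assms, of 1] by simp
  also have "\<dots> \<le> (sq_norm M f + sq_norm M g)\<^sup>2"
    using sq_inner_Cauchy_Schwarz[OF assms] by (simp add: power2_sum)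
  finally show "(sq_norm M (\<lambda>x. f x + g x))\<^sup>2 \<le> (sq_norm M f + sq_norm M g)\<^sup>2" .
qed (simp add: sq_norm_nonneg)

lemma sq_norm_triangle_diff:
  assumes "f \<in> sq_integrable M" "g \<in> sq_integrable M" "h \<in> sq_integrable M"
  shows "sq_norm M (\<lambda>x. f x - h x) \<le> sq_norm M (\<lambda>x. f x - g x) + sq_norm M (\<lambda>x. g x - h x)"
  using sq_norm_triangle[OF sq_integrable_diff[OF assms(1,2)] sq_integrable_diff[OF assms(2,3)]] by simp

lemma sq_norm_minus_commute: "sq_norm M (\<lambda>x. f x - g x) = sq_norm M (\<lambda>x. g x - f x)"
  by (simp add: sq_norm_def norm_minus_commute)

lemma sq_norm_eq_0_AE:
  assumes "f \<in> sq_integrable M" "sq_norm M f = 0"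
  shows "AE x in M. f x = 0"
proof -
  have "(LINT x|M. (norm (f x))\<^sup>2) = 0"
    using assms(2) by (simp add: sq_norm_def)
  then have "AE x in M. (norm (f x))\<^sup>2 = 0"
    using integral_nonneg_eq_0_iff_AE[OF sq_integrable_norm2[OF assms(1)]] by simp
  then show ?thesis by simp
qed

lemma sq_norm_cong_AE:
  assumes "f \<in> borel_measurable M" "g \<in> borel_measurable M" "AE x in M. f x = g x"
  shows "sq_norm M f = sq_norm M g"
  unfolding sq_norm_def using assms by (intro arg_cong[of _ _ sqrt] integral_cong_AE) auto

lemma sq_inner_tendsto:
  assumes "\<And>n. f n \<in> sq_integrable M" "F \<in> sq_integrable M" "h \<in> sq_integrable M"
    and "(\<lambda>n. sq_norm M (\<lambda>x. f n x - F x)) \<longlonglongrightarrow> 0"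
  shows "(\<lambda>n. sq_inner M (f n) h) \<longlonglongrightarrow> sq_inner M F h"
proof -
  have "(\<lambda>n. sq_inner M (f n) h - sq_inner M F h) \<longlonglongrightarrow> 0"
  proof (rule Lim_null_comparison)
    show "\<forall>\<^sub>F n in sequentially. norm (sq_inner M (f n) h - sq_inner M F h)
        \<le> sq_norm M (\<lambda>x. f n x - F x) * sq_norm M h"
      using sq_inner_Cauchy_Schwarz[OF sq_integrable_diff[OF assms(1,2)] assms(3)] assms
      by (intro always_eventually) (auto simp: sq_inner_diff_left)
    show "(\<lambda>n. sq_norm M (\<lambda>x. f n x - F x) * sq_norm M h) \<longlonglongrightarrow> 0"
      using tendsto_mult_left_zero[OF assms(4)] by simp
  qed
  then show ?thesis by (simp add: LIM_zero_iff)
qed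

lemma sq_norm_tendsto:
  assumes "\<And>n. f n \<in> sq_integrable M" "F \<in> sq_integrable M"
    and "(\<lambda>n. sq_norm M (\<lambda>x. f n x - F x)) \<longlonglongrightarrow> 0"
  shows "(\<lambda>n. sq_norm M (f n)) \<longlonglongrightarrow> sq_norm M F"
proof -
  have "(\<lambda>n. sq_norm M (f n) - sq_norm M F) \<longlonglongrightarrow> 0"
  proof (rule Lim_null_comparison[OF always_eventually assms(3)], intro allI)
    fix n
    have "sq_norm M (f n) \<le> sq_norm M (\<lambda>x. f n x - F x) + sq_norm M F"
      using sq_norm_triangle[OF sq_integrable_diff[OF assms(1)[of n] assms(2)] assms(2)] by simp
    moreover have "sq_norm M F \<le> sq_norm M (\<lambda>x. f n x - F x) + sq_norm M (f n)"
      using sq_norm_triangle[OF sq_integrable_diff[OF assms(2) assms(1)[of n]] assms(1)[of n]]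
      by (simp add: sq_norm_minus_commute)
    ultimately show "norm (sq_norm M (f n) - sq_norm M F) \<le> sq_norm M (\<lambda>x. f n x - F x)"
      by simp
  qed
  then show ?thesis by (simp add: LIM_zero_iff)
qed

definition sq_Cauchy :: "'x measure \<Rightarrow> (nat \<Rightarrow> 'x \<Rightarrow> 'b::euclidean_space) \<Rightarrow> bool"
  where "sq_Cauchy M f \<longleftrightarrow>
    (\<forall>e>0. \<exists>N. \<forall>m\<ge>N. \<forall>n\<ge>N. sq_norm M (\<lambda>x. f m x - f n x) < e)"

lemma nn_integral_sq_norm:
  assumes "f \<in> sq_integrable M"
  shows "(\<integral>\<^sup>+x. ennreal ((norm (f x))\<^sup>2) \<partial>M) = ennreal ((sq_norm M f)\<^sup>2)"
  using assms unfolding sq_norm_power2 by (intro nn_integral_eq_integral) (auto simp: sq_integrable_def)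

text \<open>If \<open>2\<^sup>k a\<^sub>k\<^sup>2\<close> is bounded by \<open>C\<close>, then \<open>a\<^sub>k\<close> is dominated by the geometric sequence
  \<open>\<surd>C / \<surd>2\<^sup>k\<close>. For norms of functions the weighted squares have the advantage that
  their integrals are controlled by \<open>L\<^sup>2\<close> norms.\<close>

lemma summable_of_weighted_squares:
  fixes a :: "nat \<Rightarrow> real"
  assumes "\<And>k. 0 \<le> a k" "summable (\<lambda>k. 2^k * (a k)\<^sup>2)"
  shows "summable a"
proof -
  obtain C where C: "\<And>k. 2^k * (a k)\<^sup>2 \<le> C"
    using summable_imp_Bseq[OF assms(2)] by (auto simp: Bseq_def intro: order_trans[OF abs_ge_self])
  have *: "a k \<le> sqrt C * (1 / sqrt 2)^k" for k
  proof -
    have "(sqrt 2 ^ k * a k)\<^sup>2 \<le> C"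
    proof -
      have "(sqrt 2 ^ k)\<^sup>2 = (2 ^ k :: real)"
        by (metis power_mult mult.commute real_sqrt_pow2 zero_le_numeral)
      then show ?thesis using C[of k] by (simp add: power_mult_distrib)
    qed
    then have "sqrt 2 ^ k * a k \<le> sqrt C"
      using real_le_rsqrt by blast
    then show ?thesis by (simp add: power_divide pos_le_divide_eq mult.commute)
  qed
  have "summable (\<lambda>k. sqrt C * (1 / sqrt 2)^k)"
    by (intro summable_mult summable_geometric) simp
  then show ?thesis
    by (rule summable_comparison_test'[where N=0]) (use * assms(1) in auto)
qed

text \<open>Riesz--Fischer. Along a subsequence with \<open>\<parallel>f\<^sub>k\<^sub>+\<^sub>1 - f\<^sub>k\<parallel> < 2\<^sup>-\<^sup>k\<close> the sum of
  \<open>2\<^sup>k \<bar>f\<^sub>k\<^sub>+\<^sub>1 - f\<^sub>k\<bar>\<^sup>2\<close> has finite integral, so the subsequence converges almost everywhere;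
  Fatou's lemma turns the pointwise limit into a limit in norm.\<close>

lemma sq_norm_complete:
  assumes f: "\<And>n. f n \<in> sq_integrable M" and C: "sq_Cauchy M f"
  obtains F where "F \<in> sq_integrable M" "(\<lambda>n. sq_norm M (\<lambda>x. f n x - F x)) \<longlonglongrightarrow> 0"
proof -
  have "\<exists>N. \<forall>m\<ge>N. \<forall>n\<ge>N. sq_norm M (\<lambda>x. f m x - f n x) < (1/2)^k" for k
    using C by (simp add: sq_Cauchy_def)
  then obtain N where N: "\<And>k m n. m \<ge> N k \<Longrightarrow> n \<ge> N k \<Longrightarrow> sq_norm M (\<lambda>x. f m x - f n x) < (1/2)^k"
    by metis
  define r where "r k = (\<Sum>i\<le>k. N i) + k" for k
  have rN: "N k \<le> r k" for k
    unfolding r_def by (metis atMost_iff finite_atMost le_add1 le_trans member_le_sum order_refl zero_le)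
  have rS: "r k \<le> r (Suc k)" for k unfolding r_def by simp
  define d where "d k x = norm (f (r (Suc k)) x - f (r k) x)" for k x
  have fm: "f n \<in> borel_measurable M" for n using f by (simp add: sq_integrable_measurable)
  have dm: "d k \<in> borel_measurable M" for k unfolding d_def using fm by measurable
  have "(\<integral>\<^sup>+x. (\<Sum>k. ennreal (2^k * (d k x)\<^sup>2)) \<partial>M) = (\<Sum>k. \<integral>\<^sup>+x. ennreal (2^k * (d k x)\<^sup>2) \<partial>M)"
    using dm by (intro nn_integral_suminf) measurable
  also have "\<dots> \<le> (\<Sum>k. ennreal ((1/2)^k))"
  proof (intro suminf_le summableI)
    fix k
    have "(\<integral>\<^sup>+x. ennreal (2^k * (d k x)\<^sup>2) \<partial>M) = ennreal (2^k) * (\<integral>\<^sup>+x. ennreal ((d k x)\<^sup>2) \<partial>M)"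
      using dm by (subst nn_integral_cmult[symmetric]) (auto simp: ennreal_mult)
    also have "\<dots> = ennreal (2^k * (sq_norm M (\<lambda>x. f (r (Suc k)) x - f (r k) x))\<^sup>2)"
      unfolding d_def by (subst nn_integral_sq_norm) (auto intro: sq_integrable_diff f simp: ennreal_mult)
    also have "\<dots> \<le> ennreal (2^k * ((1/2)^k)\<^sup>2)"
    proof (intro ennreal_leI mult_left_mono power_mono)
      show "sq_norm M (\<lambda>x. f (r (Suc k)) x - f (r k) x) \<le> (1/2)^k"
        using N[of k "r (Suc k)" "r k"] rN[of k] rS[of k] by fastforce
    qed (auto simp: sq_norm_nonneg)
    also have "2^k * ((1/2)^k)\<^sup>2 = ((1/2)^k :: real)"
    proof -
      have "2^k * (1/2)^k = (1 :: real)"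
        by (simp flip: power_mult_distrib)
      then show ?thesis by (simp add: power2_eq_square flip: mult.assoc)
    qed
    finally show "(\<integral>\<^sup>+x. ennreal (2^k * (d k x)\<^sup>2) \<partial>M) \<le> ennreal ((1/2)^k)" .
  qed
  also have "\<dots> = ennreal (\<Sum>k. (1/2)^k)"
    by (rule suminf_ennreal2) (auto simp: summable_geometric)
  also have "\<dots> < \<infinity>" by simp
  finally have "AE x in M. (\<Sum>k. ennreal (2^k * (d k x)\<^sup>2)) \<noteq> \<infinity>"
    using dm by (intro nn_integral_PInf_AE) (auto simp: less_top[symmetric])
  then have conv: "AE x in M. convergent (\<lambda>k. f (r k) x)"
  proof eventually_elim
    case (elim x)
    have "summable (\<lambda>k. 2^k * (d k x)\<^sup>2)"
      using elim by (intro summable_suminf_not_top) auto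
    then have "summable (\<lambda>k. d k x)"
      by (rule summable_of_weighted_squares[rotated]) (simp add: d_def)
    then have "summable (\<lambda>k. f (r (Suc k)) x - f (r k) x)"
      unfolding d_def by (rule summable_norm_cancel)
    then have "convergent (\<lambda>n. f (r 0) x + (\<Sum>k<n. f (r (Suc k)) x - f (r k) x))"
      unfolding summable_iff_convergent by (intro convergent_add convergent_const)
    moreover have "f (r 0) x + (\<Sum>k<n. f (r (Suc k)) x - f (r k) x) = f (r n) x" for n
      using sum_lessThan_telescope[of "\<lambda>k. f (r k) x" n] by simp
    ultimately show ?case by simp
  qed
  define F where "F x = lim (\<lambda>k. f (r k) x)" for x
  have Fm: "F \<in> borel_measurable M"
    unfolding F_def using fm by measurable
  have Flim: "AE x in M. (\<lambda>k. f (r k) x) \<longlonglongrightarrow> F x"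
    using conv unfolding F_def by eventually_elim (simp add: convergent_LIMSEQ_iff)
  have key: "(\<integral>\<^sup>+x. ennreal ((norm (f n x - F x))\<^sup>2) \<partial>M) \<le> ennreal (e\<^sup>2)"
    if e: "0 < e" and n: "\<And>k. k \<ge> K \<Longrightarrow> sq_norm M (\<lambda>x. f n x - f (r k) x) \<le> e" for n e K
  proof -
    have "AE x in M. ennreal ((norm (f n x - F x))\<^sup>2)
        = liminf (\<lambda>k. ennreal ((norm (f n x - f (r k) x))\<^sup>2))"
      using Flim
    proof eventually_elim
      case (elim x)
      have "(\<lambda>k. ennreal ((norm (f n x - f (r k) x))\<^sup>2)) \<longlonglongrightarrow> ennreal ((norm (f n x - F x))\<^sup>2)"
        by (intro tendsto_intros elim)
      then show ?case
        by (rule lim_imp_Liminf[OF trivial_limit_sequentially, symmetric])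
    qed
    then have "(\<integral>\<^sup>+x. ennreal ((norm (f n x - F x))\<^sup>2) \<partial>M)
        = (\<integral>\<^sup>+x. liminf (\<lambda>k. ennreal ((norm (f n x - f (r k) x))\<^sup>2)) \<partial>M)"
      by (rule nn_integral_cong_AE)
    also have "\<dots> \<le> liminf (\<lambda>k. \<integral>\<^sup>+x. ennreal ((norm (f n x - f (r k) x))\<^sup>2) \<partial>M)"
      using fm by (intro nn_integral_liminf) measurable
    also have "\<dots> \<le> ennreal (e\<^sup>2)"
    proof (rule Liminf_le)
      show "\<forall>\<^sub>F k in sequentially. (\<integral>\<^sup>+x. ennreal ((norm (f n x - f (r k) x))\<^sup>2) \<partial>M) \<le> ennreal (e\<^sup>2)"
        using eventually_ge_at_top[of K]
      proof eventually_elim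
        case (elim k)
        then show ?case
          using n[of k] e by (subst nn_integral_sq_norm)
            (auto intro!: sq_integrable_diff f ennreal_leI power_mono simp: sq_norm_nonneg)
      qed
    qed simp
    finally show ?thesis .
  qed
  have close: "\<exists>n0. \<forall>n\<ge>n0. f n \<in> sq_integrable M \<and> (\<lambda>x. f n x - F x) \<in> sq_integrable M \<and> sq_norm M (\<lambda>x. f n x - F x) \<le> e"
    if e: "0 < e" for e
  proof -
    obtain n0 where n0: "\<And>m n. m \<ge> n0 \<Longrightarrow> n \<ge> n0 \<Longrightarrow> sq_norm M (\<lambda>x. f m x - f n x) < e"
      using C e unfolding sq_Cauchy_def by blast
    have "(\<lambda>x. f n x - F x) \<in> sq_integrable M \<and> sq_norm M (\<lambda>x. f n x - F x) \<le> e" if "n \<ge> n0" for n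
    proof -
      have le: "(\<integral>\<^sup>+x. ennreal ((norm (f n x - F x))\<^sup>2) \<partial>M) \<le> ennreal (e\<^sup>2)"
      proof (rule key[OF e, of n0])
        fix k assume "k \<ge> n0"
        then have "r k \<ge> n0" by (simp add: r_def)
        then show "sq_norm M (\<lambda>x. f n x - f (r k) x) \<le> e" using n0 that by fastforce
      qed
      have sq: "(\<lambda>x. f n x - F x) \<in> sq_integrable M"
      proof (rule sq_integrableI)
        show "integrable M (\<lambda>x. (norm (f n x - F x))\<^sup>2)"
          using le fm Fm by (intro integrableI_bounded)
            (auto simp: less_top[symmetric] top_unique)
      qed (use fm Fm in measurable)
      moreover have "(sq_norm M (\<lambda>x. f n x - F x))\<^sup>2 \<le> e\<^sup>2"
        using le unfolding nn_integral_sq_norm[OF sq] by simp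
      then have "sq_norm M (\<lambda>x. f n x - F x) \<le> e"
        by (rule power2_le_imp_le) (use e in simp)
      ultimately show ?thesis by blast
    qed
    then show ?thesis using f by blast
  qed
  have "F \<in> sq_integrable M"
  proof -
    obtain n where "(\<lambda>x. f n x - F x) \<in> sq_integrable M" using close[of 1] by auto
    then show ?thesis using sq_integrable_diff[OF f[of n]] by fastforce
  qed
  moreover have "(\<lambda>n. sq_norm M (\<lambda>x. f n x - F x)) \<longlonglongrightarrow> 0"
  proof (rule LIMSEQ_I)
    fix e :: real assume "0 < e"
    then obtain n0 where n0: "\<And>n. n \<ge> n0 \<Longrightarrow> sq_norm M (\<lambda>x. f n x - F x) \<le> e / 2"
      using close[of "e/2"] by auto
    have "norm (sq_norm M (\<lambda>x. f n x - F x) - 0) < e" if "n \<ge> n0" for n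
      using n0[OF that] \<open>0 < e\<close> sq_norm_nonneg[of M "\<lambda>x. f n x - F x"] by simp
    then show "\<exists>n0. \<forall>n\<ge>n0. norm (sq_norm M (\<lambda>x. f n x - F x) - 0) < e" by blast
  qed
  ultimately show ?thesis by (rule that)
qed

text \<open>Existence of the orthogonal projection onto the closure of a subspace: a minimizing sequence
  for the distance is Cauchy by the parallelogram law, and the first variation at its limit
  vanishes.\<close>

lemma sq_norm_projection:
  fixes S :: "('x \<Rightarrow> 'b::euclidean_space) set"
  assumes S: "S \<subseteq> sq_integrable M" "S \<noteq> {}"
    and lin: "\<And>s t a. s \<in> S \<Longrightarrow> t \<in> S \<Longrightarrow> (\<lambda>x. s x + a *\<^sub>R t x) \<in> S"
    and F: "F \<in> sq_integrable M"
  obtains P s where "P \<in> sq_integrable M" "\<And>n::nat. s n \<in> S" "(\<lambda>n. sq_norm M (\<lambda>x. s n x - P x)) \<longlonglongrightarrow> 0"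
    "\<And>t. t \<in> S \<Longrightarrow> sq_inner M (\<lambda>x. F x - P x) t = 0"
proof -
  define D where "D = (\<lambda>s. (sq_norm M (\<lambda>x. F x - s x))\<^sup>2) ` S"
  define d where "d = Inf D"
  have Dne: "D \<noteq> {}" using S by (auto simp: D_def)
  have bdd: "bdd_below D" by (intro bdd_belowI[of _ 0]) (auto simp: D_def)
  have lower: "d \<le> (sq_norm M (\<lambda>x. F x - s x))\<^sup>2" if "s \<in> S" for s
    unfolding d_def using that by (intro cInf_lower bdd) (auto simp: D_def)
  have "\<exists>s\<in>S. (sq_norm M (\<lambda>x. F x - s x))\<^sup>2 < d + 1 / real (Suc n)" for n
    using cInf_lessD[OF Dne, of "d + 1 / real (Suc n)"] unfolding d_def[symmetric]
    by (auto simp: D_def)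
  then obtain s where sS: "\<And>n. s n \<in> S"
    and s: "\<And>n. (sq_norm M (\<lambda>x. F x - s n x))\<^sup>2 < d + 1 / real (Suc n)"
    by metis
  have sM: "s n \<in> sq_integrable M" for n using sS S by auto
  have Fs: "(\<lambda>x. F x - s n x) \<in> sq_integrable M" for n using sq_integrable_diff[OF F sM] .
  have scaleS: "(\<lambda>x. a *\<^sub>R t x) \<in> S" if "t \<in> S" for t a
    using lin[OF that that, of "a - 1"] by (simp add: algebra_simps)
  \<comment> \<open>The midpoint of two members of the subspace is again a member, so it is no closer than \<open>d\<close>.\<close>
  have par: "(sq_norm M (\<lambda>x. s m x - s n x))\<^sup>2 \<le> 2 / real (Suc n) + 2 / real (Suc m)" for m n
  proof -
    let ?a = "\<lambda>x. F x - s n x" and ?b = "\<lambda>x. F x - s m x"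
    have 1: "(sq_norm M (\<lambda>x. s m x - s n x))\<^sup>2 = (sq_norm M ?a)\<^sup>2 - 2 * sq_inner M ?a ?b + (sq_norm M ?b)\<^sup>2"
      using sq_norm_expand[OF Fs[of n] Fs[of m], of "-1"] by simp
    have 2: "(sq_norm M (\<lambda>x. ?a x + ?b x))\<^sup>2 = (sq_norm M ?a)\<^sup>2 + 2 * sq_inner M ?a ?b + (sq_norm M ?b)\<^sup>2"
      using sq_norm_expand[OF Fs[of n] Fs[of m], of "1"] by simp
    have "(\<lambda>x. (1/2) *\<^sub>R s n x + (1/2) *\<^sub>R s m x) \<in> S"
      using lin[OF scaleS[OF sS[of n], of "1/2"] sS[of m]] .
    then have "d \<le> (sq_norm M (\<lambda>x. F x - ((1/2) *\<^sub>R s n x + (1/2) *\<^sub>R s m x)))\<^sup>2"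
      by (rule lower)
    also have "(\<lambda>x. F x - ((1/2) *\<^sub>R s n x + (1/2) *\<^sub>R s m x)) = (\<lambda>x. (1/2) *\<^sub>R (?a x + ?b x))"
      by (auto simp: algebra_simps simp flip: scaleR_add_left)
    also have "(sq_norm M \<dots>)\<^sup>2 = (sq_norm M (\<lambda>x. ?a x + ?b x))\<^sup>2 / 4"
      unfolding sq_norm_scale by (simp add: power2_eq_square)
    finally show ?thesis using 1 2 s[of n] s[of m] by simp
  qed
  have "sq_Cauchy M s"
    unfolding sq_Cauchy_def
  proof (intro allI impI)
    fix e :: real assume e: "0 < e"
    obtain N where N: "4 / e\<^sup>2 < real N" using reals_Archimedean2 by blast
    have "sq_norm M (\<lambda>x. s m x - s n x) < e" if "m \<ge> N" "n \<ge> N" for m n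
    proof (rule power2_less_imp_less)
      have N0: "0 < real N" using N e by (smt (verit) divide_pos_pos zero_less_power)
      have "2 / real (Suc n) \<le> 2 / real N" "2 / real (Suc m) \<le> 2 / real N"
        using that N0 by (auto intro!: divide_left_mono)
      then have "(sq_norm M (\<lambda>x. s m x - s n x))\<^sup>2 \<le> 4 / real N"
        using par[of m n] by simp
      also have "\<dots> < e\<^sup>2" using N e N0 by (simp add: field_simps)
      finally show "(sq_norm M (\<lambda>x. s m x - s n x))\<^sup>2 < e\<^sup>2" .
    qed (use e in simp)
    then show "\<exists>N. \<forall>m\<ge>N. \<forall>n\<ge>N. sq_norm M (\<lambda>x. s m x - s n x) < e" by blast
  qed
  then obtain P where P: "P \<in> sq_integrable M" "(\<lambda>n. sq_norm M (\<lambda>x. s n x - P x)) \<longlonglongrightarrow> 0"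
    by (rule sq_norm_complete[where f=s, OF sM])
  have "sq_inner M (\<lambda>x. F x - P x) t = 0" if t: "t \<in> S" for t
  proof -
    have tM: "t \<in> sq_integrable M" using t S by auto
    have lim: "(\<lambda>n. sq_inner M (\<lambda>x. F x - s n x) t) \<longlonglongrightarrow> sq_inner M (\<lambda>x. F x - P x) t"
      unfolding sq_inner_diff_left[OF F sM tM] sq_inner_diff_left[OF F P(1) tM]
      by (intro tendsto_diff tendsto_const sq_inner_tendsto sM P tM)
    have pos: "0 \<le> 2 * a * sq_inner M (\<lambda>x. F x - P x) t + a\<^sup>2 * (sq_norm M t)\<^sup>2" for a
    proof (rule tendsto_lowerbound)
      show "(\<lambda>n. 1 / real (Suc n) + 2 * a * sq_inner M (\<lambda>x. F x - s n x) t + a\<^sup>2 * (sq_norm M t)\<^sup>2)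
          \<longlonglongrightarrow> 2 * a * sq_inner M (\<lambda>x. F x - P x) t + a\<^sup>2 * (sq_norm M t)\<^sup>2"
        using tendsto_add[OF tendsto_add[OF LIMSEQ_Suc[OF lim_1_over_n] tendsto_mult[OF tendsto_const lim]] tendsto_const]
        by simp
      have "0 \<le> 1 / real (Suc n) + 2 * a * sq_inner M (\<lambda>x. F x - s n x) t + a\<^sup>2 * (sq_norm M t)\<^sup>2" for n
      proof -
        have "d \<le> (sq_norm M (\<lambda>x. F x - (s n x + (-a) *\<^sub>R t x)))\<^sup>2"
          by (intro lower lin sS t)
        also have "(\<lambda>x. F x - (s n x + (-a) *\<^sub>R t x)) = (\<lambda>x. (F x - s n x) + a *\<^sub>R t x)"
          by (simp add: algebra_simps)
        finally show ?thesis using sq_norm_expand[OF Fs[of n] tM, of a] s[of n] by simp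
      qed
      then show "\<forall>\<^sub>F n in sequentially.
          0 \<le> 1 / real (Suc n) + 2 * a * sq_inner M (\<lambda>x. F x - s n x) t + a\<^sup>2 * (sq_norm M t)\<^sup>2" by simp
    qed simp
    show ?thesis
    proof (rule ccontr)
      \<comment> \<open>The quadratic in \<open>a\<close> is negative at \<open>- c / q\<close>; the summand \<open>1\<close> in \<open>q\<close> covers \<open>t\<close> of norm zero.\<close>
      define c where "c = sq_inner M (\<lambda>x. F x - P x) t"
      assume "sq_inner M (\<lambda>x. F x - P x) t \<noteq> 0"
      then have c: "c \<noteq> 0" by (simp add: c_def)
      define q where "q = (sq_norm M t)\<^sup>2 + 1"
      have q: "q > 0" "(sq_norm M t)\<^sup>2 < q" by (auto simp: q_def add_nonneg_pos)
      have "0 \<le> 2 * (- c / q) * c + (- c / q)\<^sup>2 * (sq_norm M t)\<^sup>2"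
        using pos[of "- c / q"] by (simp add: c_def)
      also have "\<dots> \<le> 2 * (- c / q) * c + (- c / q)\<^sup>2 * q"
        using q by (intro add_left_mono mult_left_mono) auto
      also have "\<dots> = - c\<^sup>2 / q"
        using q by (simp add: power2_eq_square field_simps)
      also have "\<dots> < 0" using c q by simp
      finally show False by simp
    qed
  qed
  then show ?thesis using that P sS by blast
qed

section \<open>Calculus of test functions\<close>

lemma partial_deriv_eq:
  "(\<phi> has_derivative D) (at x) \<Longrightarrow> partial_deriv b \<phi> x = D b"
  by (simp add: partial_deriv_def frechet_derivative_at[symmetric])

lemma has_derivative_partial_deriv:
  "\<phi> differentiable (at x) \<Longrightarrow> (\<phi> has_derivative (\<lambda>h. partial_deriv h \<phi> x)) (at x)"
  by (simp add: partial_deriv_def frechet_derivative_works[symmetric])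

lemma partial_deriv_add:
  assumes "\<phi> differentiable (at x)" "\<psi> differentiable (at x)"
  shows "partial_deriv b (\<lambda>x. \<phi> x + \<psi> x) x = partial_deriv b \<phi> x + partial_deriv b \<psi> x"
  by (rule partial_deriv_eq[OF has_derivative_add[OF assms[THEN has_derivative_partial_deriv]]])

lemma partial_deriv_mult:
  assumes "\<phi> differentiable (at x)" "\<psi> differentiable (at x)"
  shows "partial_deriv b (\<lambda>x. \<phi> x * \<psi> x) x = \<phi> x * partial_deriv b \<psi> x + partial_deriv b \<phi> x * \<psi> x"
  by (rule partial_deriv_eq[OF has_derivative_mult[OF assms[THEN has_derivative_partial_deriv]]])

lemma partial_deriv_const: "partial_deriv b (\<lambda>x. c) = (\<lambda>x. 0)"
  by (simp add: partial_deriv_def fun_eq_iff)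

lemma C_k_const: "C_k k (\<lambda>x. c)"
  by (induction k arbitrary: c) (auto simp: partial_deriv_const)

lemma C_k_Suc_imp: "C_k (Suc k) \<phi> \<Longrightarrow> C_k k \<phi>"
proof (induction k arbitrary: \<phi>)
  case 0
  then show ?case
    by (simp add: continuous_at_imp_continuous_on differentiable_imp_continuous_within)
next
  case (Suc k)
  have "(\<forall>x. \<phi> differentiable (at x)) \<and> (\<forall>b\<in>Basis. C_k (Suc k) (partial_deriv b \<phi>))"
    by (rule C_k.simps(2)[THEN iffD1, OF Suc.prems])
  then show ?case
    by (subst C_k.simps(2)) (use Suc.IH in blast)
qed

lemma C_k_add: "C_k k \<phi> \<Longrightarrow> C_k k \<psi> \<Longrightarrow> C_k k (\<lambda>x. \<phi> x + \<psi> x)"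
proof (induction k arbitrary: \<phi> \<psi>)
  case 0
  then show ?case by (auto intro: continuous_on_add)
next
  case (Suc k)
  then have d: "\<And>x. \<phi> differentiable (at x)" "\<And>x. \<psi> differentiable (at x)" by auto
  have "partial_deriv b (\<lambda>x. \<phi> x + \<psi> x) = (\<lambda>x. partial_deriv b \<phi> x + partial_deriv b \<psi> x)" for b
    using d by (auto simp: partial_deriv_add)
  then show ?case using Suc d by auto
qed

lemma C_k_mult: "C_k k \<phi> \<Longrightarrow> C_k k \<psi> \<Longrightarrow> C_k k (\<lambda>x. \<phi> x * \<psi> x)"
proof (induction k arbitrary: \<phi> \<psi>)
  case 0
  then show ?case by (auto intro: continuous_on_mult)
next
  case (Suc k)
  then have d: "\<And>x. \<phi> differentiable (at x)" "\<And>x. \<psi> differentiable (at x)" by auto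
  have eq: "partial_deriv b (\<lambda>x. \<phi> x * \<psi> x)
      = (\<lambda>x. \<phi> x * partial_deriv b \<psi> x + partial_deriv b \<phi> x * \<psi> x)" for b
    using d by (auto simp: partial_deriv_mult)
  have "C_k k (\<lambda>x. \<phi> x * partial_deriv b \<psi> x + partial_deriv b \<phi> x * \<psi> x)" if "b \<in> Basis" for b
    using Suc.prems that by (intro C_k_add Suc.IH) (auto intro: C_k_Suc_imp simp del: C_k.simps(1) simp: C_k_Suc_imp)
  then show ?case using d by (simp add: eq)
qed

text \<open>The derivative of \<open>q\<^sup>a\<close> is a multiple of \<open>q\<^sup>a\<^sup>-\<^sup>1\<close>, hence the induction on the order of
  differentiability has to run over all exponents simultaneously. Real powers are the form in
  which the square root is seen to be smooth.\<close>

lemma C_k_powr: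
  assumes "\<And>k. C_k k q" "\<And>x. 0 < q x"
  shows "C_k k (\<lambda>x. q x powr a)"
proof (induction k arbitrary: a)
  case 0
  have "continuous_on UNIV q" using assms(1)[of 0] by simp
  moreover have "q x \<noteq> 0" for x using assms(2)[of x] by simp
  ultimately show ?case by (auto intro!: continuous_on_powr continuous_on_const)
next
  case (Suc k)
  have d: "q differentiable (at x)" for x using assms(1)[of 1] by simp
  have der: "((\<lambda>x. q x powr a) has_derivative
      (\<lambda>h. a * q x powr (a - 1) * partial_deriv h q x)) (at x)" for x
  proof -
    have "((\<lambda>x. q x powr a) has_derivative
        (\<lambda>h. q x powr a * (0 * ln (q x) + partial_deriv h q x * a / q x))) (at x)"
      by (rule has_derivative_powr[OF has_derivative_partial_deriv[OF d] has_derivative_const])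
         (use assms(2) in auto)
    moreover have "q x powr a * (0 * ln (q x) + partial_deriv h q x * a / q x)
        = a * q x powr (a - 1) * partial_deriv h q x" for h
      using assms(2)[of x] by (simp add: powr_diff)
    ultimately show ?thesis by simp
  qed
  have eq: "partial_deriv b (\<lambda>x. q x powr a) = (\<lambda>x. a * q x powr (a - 1) * partial_deriv b q x)" for b
    by (rule ext) (rule partial_deriv_eq[OF der])
  have "C_k k (partial_deriv b q)" if "b \<in> Basis" for b
    using assms(1)[of "Suc k"] that by simp
  then have "C_k k (partial_deriv b (\<lambda>x. q x powr a))" if "b \<in> Basis" for b
    unfolding eq using that by (intro C_k_mult C_k_const Suc.IH) auto
  then show ?case using der by (auto simp: differentiable_def)
qed

lemma test_functionsI:
  assumes "\<And>k. C_k k \<phi>" "compact K" "K \<subseteq> \<Omega>" "\<And>x. x \<notin> K \<Longrightarrow> \<phi> x = 0"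
  shows "\<phi> \<in> test_functions \<Omega>"
proof -
  have "closure {x. \<phi> x \<noteq> 0} \<subseteq> K"
    using assms by (intro closure_minimal compact_imp_closed) auto
  then show ?thesis
    using assms compact_Int_closed[OF assms(2) closed_closure, of "{x. \<phi> x \<noteq> 0}"]
    by (auto simp: test_functions_def Int_absorb1)
qed

lemma test_functionsE:
  assumes "\<phi> \<in> test_functions \<Omega>"
  obtains K where "compact K" "K \<subseteq> \<Omega>" "\<And>x. x \<notin> K \<Longrightarrow> \<phi> x = 0"
    "\<And>x b. x \<notin> K \<Longrightarrow> partial_deriv b \<phi> x = 0"
proof (rule that[of "closure {x. \<phi> x \<noteq> 0}"])
  show "compact (closure {x. \<phi> x \<noteq> 0})" "closure {x. \<phi> x \<noteq> 0} \<subseteq> \<Omega>"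
    using assms by (auto simp: test_functions_def)
  show "\<phi> x = 0" if "x \<notin> closure {x. \<phi> x \<noteq> 0}" for x
    using that closure_subset[of "{x. \<phi> x \<noteq> 0}"] by auto
  show "partial_deriv b \<phi> x = 0" if x: "x \<notin> closure {x. \<phi> x \<noteq> 0}" for x b
  proof -
    have "((\<lambda>_. 0) has_derivative (\<lambda>_. 0)) (at x)" by simp
    then have "(\<phi> has_derivative (\<lambda>_. 0)) (at x)"
    proof (rule has_derivative_transform_within_open)
      show "open (- closure {x. \<phi> x \<noteq> 0})" by (intro open_Compl closed_closure)
      show "0 = \<phi> y" if "y \<in> - closure {x. \<phi> x \<noteq> 0}" for y
        using that closure_subset[of "{x. \<phi> x \<noteq> 0}"] by auto
    qed (use x in auto)
    then show ?thesis by (rule partial_deriv_eq)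
  qed
qed

lemma test_C_k: "\<phi> \<in> test_functions \<Omega> \<Longrightarrow> C_k k \<phi>"
  by (simp add: test_functions_def)

lemma test_differentiable: "\<phi> \<in> test_functions \<Omega> \<Longrightarrow> \<phi> differentiable (at x)"
  using test_C_k[of \<phi> \<Omega> 1] by simp

lemma test_continuous: "\<phi> \<in> test_functions \<Omega> \<Longrightarrow> continuous_on UNIV \<phi>"
  using test_C_k[of \<phi> \<Omega> 0] by simp

lemma test_partial_deriv:
  assumes "\<phi> \<in> test_functions \<Omega>" "b \<in> Basis"
  shows "partial_deriv b \<phi> \<in> test_functions \<Omega>"
proof -
  obtain K where "compact K" "K \<subseteq> \<Omega>" "\<And>x. x \<notin> K \<Longrightarrow> partial_deriv b \<phi> x = 0"
    using test_functionsE[OF assms(1)] by metis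
  moreover have "C_k k (partial_deriv b \<phi>)" for k
    using test_C_k[OF assms(1), of "Suc k"] assms(2) by simp
  ultimately show ?thesis by (intro test_functionsI)
qed

lemma test_add_scale:
  assumes "\<phi> \<in> test_functions \<Omega>" "\<psi> \<in> test_functions \<Omega>"
  shows "(\<lambda>x. \<phi> x + a * \<psi> x) \<in> test_functions \<Omega>"
proof -
  obtain K where K: "compact K" "K \<subseteq> \<Omega>" "\<And>x. x \<notin> K \<Longrightarrow> \<phi> x = 0"
    using test_functionsE[OF assms(1)] by metis
  obtain L where L: "compact L" "L \<subseteq> \<Omega>" "\<And>x. x \<notin> L \<Longrightarrow> \<psi> x = 0"
    using test_functionsE[OF assms(2)] by metis
  have "C_k k (\<lambda>x. \<phi> x + a * \<psi> x)" for k
    by (intro C_k_add C_k_mult C_k_const assms[THEN test_C_k])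
  then show ?thesis
    by (rule test_functionsI[of _ "K \<union> L"]) (use K L in \<open>auto intro: compact_Un\<close>)
qed

lemma test_mult:
  assumes "\<phi> \<in> test_functions \<Omega>" "\<psi> \<in> test_functions \<Omega>"
  shows "(\<lambda>x. \<phi> x * \<psi> x) \<in> test_functions \<Omega>"
proof -
  obtain K where K: "compact K" "K \<subseteq> \<Omega>" "\<And>x. x \<notin> K \<Longrightarrow> \<phi> x = 0"
    using test_functionsE[OF assms(1)] by metis
  have "C_k k (\<lambda>x. \<phi> x * \<psi> x)" for k
    by (intro C_k_mult assms[THEN test_C_k])
  then show ?thesis
    by (rule test_functionsI[of _ K]) (use K in auto)
qed

lemma test_zero: "(\<lambda>x. 0) \<in> test_functions \<Omega>"
  by (rule test_functionsI[of _ "{}"]) (auto intro: C_k_const)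

lemma gradient_inner:
  assumes "\<phi> differentiable (at x)"
  shows "gradient \<phi> x \<bullet> h = partial_deriv h \<phi> x"
proof -
  have lin: "linear (\<lambda>h. partial_deriv h \<phi> x)"
    using has_derivative_partial_deriv[OF assms] has_derivative_linear by blast
  have "partial_deriv h \<phi> x = partial_deriv (\<Sum>b\<in>Basis. (h \<bullet> b) *\<^sub>R b) \<phi> x"
    by (simp add: euclidean_representation)
  also have "\<dots> = (\<Sum>b\<in>Basis. (h \<bullet> b) * partial_deriv b \<phi> x)"
    using linear_sum[OF lin, of "\<lambda>b. (h \<bullet> b) *\<^sub>R b" Basis] linear_scale[OF lin] by simp
  also have "\<dots> = gradient \<phi> x \<bullet> h"
    by (simp add: gradient_def inner_sum_left inner_commute[of h] mult.commute)
  finally show ?thesis by simp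
qed

lemma gradient_add_scale:
  assumes "\<phi> differentiable (at x)" "\<psi> differentiable (at x)"
  shows "gradient (\<lambda>x. \<phi> x + a * \<psi> x) x = gradient \<phi> x + a *\<^sub>R gradient \<psi> x"
proof -
  have "partial_deriv b (\<lambda>x. \<phi> x + a * \<psi> x) x = partial_deriv b \<phi> x + a * partial_deriv b \<psi> x" for b
    using assms partial_deriv_eq[OF has_derivative_add[OF has_derivative_partial_deriv[OF assms(1)]
        has_derivative_mult_right[OF has_derivative_partial_deriv[OF assms(2)]]]]
    by simp
  then show ?thesis
    by (simp add: gradient_def scaleR_left_distrib sum.distrib scaleR_sum_right)
qed

lemma inner_gradient:
  "g \<bullet> gradient \<phi> x = (\<Sum>b\<in>Basis. (g \<bullet> b) * partial_deriv b \<phi> x)"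
  by (simp add: gradient_def inner_sum_right mult.commute)

lemma test_gradient_continuous: "\<phi> \<in> test_functions \<Omega> \<Longrightarrow> continuous_on UNIV (gradient \<phi>)"
  unfolding gradient_def
  by (intro continuous_intros test_continuous[OF test_partial_deriv])

lemma test_gradient_support:
  assumes "\<phi> \<in> test_functions \<Omega>"
  obtains K where "compact K" "K \<subseteq> \<Omega>" "\<And>x. x \<notin> K \<Longrightarrow> \<phi> x = 0 \<and> gradient \<phi> x = 0"
  using test_functionsE[OF assms] by (metis (no_types, lifting) gradient_def scaleR_eq_0_iff sum.neutral)

section \<open>Integrals of continuous functions with compact support\<close>

lemma compact_support_integrable:
  fixes f :: "'a::euclidean_space \<Rightarrow> real"
  assumes "continuous_on UNIV f" "compact K" "\<And>x. x \<notin> K \<Longrightarrow> f x = 0"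
  shows "integrable lborel f"
proof -
  have "integrable lborel (\<lambda>x. indicator K x *\<^sub>R f x)"
    using assms by (intro borel_integrable_compact) (auto intro: continuous_on_subset)
  moreover have "(\<lambda>x. indicator K x *\<^sub>R f x) = f"
    using assms(3) by (auto simp: indicator_def fun_eq_iff)
  ultimately show ?thesis by simp
qed

lemma compact_support_integral_on:
  fixes f :: "'a::euclidean_space \<Rightarrow> real"
  assumes "open \<Omega>" "continuous_on UNIV f" "compact K" "K \<subseteq> \<Omega>" "\<And>x. x \<notin> K \<Longrightarrow> f x = 0"
  shows "integrable (lebesgue_on \<Omega>) f" "(LINT x|lebesgue_on \<Omega>. f x) = (LINT x|lborel. f x)"
proof -
  have f: "f \<in> borel_measurable borel" using assms(2) by (rule borel_measurable_continuous_onI)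
  have \<Omega>: "\<Omega> \<in> sets lebesgue" using assms(1) by auto
  have eq: "(\<lambda>x. indicator \<Omega> x *\<^sub>R f x) = f"
    using assms(4,5) by (auto simp: indicator_def fun_eq_iff)
  have int: "integrable lborel f" using compact_support_integrable assms by blast
  have "integrable lebesgue f"
    using int f by (simp add: integrable_completion)
  then show "integrable (lebesgue_on \<Omega>) f"
    using \<Omega> eq by (simp add: integrable_restrict_space)
  show "(LINT x|lebesgue_on \<Omega>. f x) = (LINT x|lborel. f x)"
    using \<Omega> f eq by (simp add: integral_restrict_space integral_completion)
qed

lemma continuous_measurable_on:
  fixes f :: "'a::euclidean_space \<Rightarrow> 'b::euclidean_space"
  assumes "continuous_on UNIV f"
  shows "f \<in> borel_measurable (lebesgue_on \<Omega>)"
  using borel_measurable_continuous_onI[OF assms]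
  by (intro measurable_restrict_space1 measurable_completion) simp

lemma compact_support_sq_integrable:
  fixes f :: "'a::euclidean_space \<Rightarrow> 'b::euclidean_space"
  assumes "open \<Omega>" "continuous_on UNIV f" "compact K" "K \<subseteq> \<Omega>" "\<And>x. x \<notin> K \<Longrightarrow> f x = 0"
  shows "f \<in> sq_integrable (lebesgue_on \<Omega>)" "f \<in> sq_integrable lborel" "sq_norm (lebesgue_on \<Omega>) f = sq_norm lborel f"
proof -
  have c: "continuous_on UNIV (\<lambda>x. (norm (f x))\<^sup>2)"
    by (intro continuous_intros assms)
  note on = compact_support_integral_on[OF assms(1) c assms(3,4)]
  have "integrable lborel (\<lambda>x. (norm (f x))\<^sup>2)"
    using compact_support_integrable[OF c assms(3)] assms(5) by simp
  then show "f \<in> sq_integrable lborel"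
    using borel_measurable_continuous_onI[OF assms(2)] by (intro sq_integrableI) auto
  show "f \<in> sq_integrable (lebesgue_on \<Omega>)"
    using on(1) assms(5) continuous_measurable_on[OF assms(2)] by (intro sq_integrableI) auto
  show "sq_norm (lebesgue_on \<Omega>) f = sq_norm lborel f"
    using on(2) assms(5) by (simp add: sq_norm_def)
qed

lemma lborel_integral_shift:
  fixes f :: "'a::euclidean_space \<Rightarrow> real"
  assumes "f \<in> borel_measurable borel"
  shows "(LINT x|lborel. f (c + x)) = (LINT x|lborel. f x)"
proof -
  have "(LINT x|lborel. f x) = (LINT x|distr lborel borel ((+) c). f x)"
    by (simp add: lborel_distr_plus)
  also have "\<dots> = (LINT x|lborel. f (c + x))"
    using assms by (subst integral_distr) auto
  finally show ?thesis ..
qed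

lemma lborel_nn_integral_shift:
  fixes f :: "'a::euclidean_space \<Rightarrow> ennreal"
  assumes "f \<in> borel_measurable borel"
  shows "(\<integral>\<^sup>+x. f (c + x) \<partial>lborel) = (\<integral>\<^sup>+x. f x \<partial>lborel)"
proof -
  have "(\<integral>\<^sup>+x. f x \<partial>lborel) = (\<integral>\<^sup>+x. f x \<partial>distr lborel borel ((+) c))"
    by (simp add: lborel_distr_plus)
  also have "\<dots> = (\<integral>\<^sup>+x. f (c + x) \<partial>lborel)"
    using assms by (subst nn_integral_distr) auto
  finally show ?thesis ..
qed

lemma line_derivative:
  assumes "\<phi> differentiable (at (x + t *\<^sub>R z))"
  shows "((\<lambda>t. \<phi> (x + t *\<^sub>R z)) has_real_derivative partial_deriv z \<phi> (x + t *\<^sub>R z)) (at t)"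
proof -
  have "((\<lambda>t. x + t *\<^sub>R z) has_derivative (\<lambda>h. h *\<^sub>R z)) (at t)"
    by (auto intro!: derivative_eq_intros)
  note der = has_derivative_compose[OF this has_derivative_partial_deriv[OF assms]]
  have "partial_deriv (h *\<^sub>R z) \<phi> (x + t *\<^sub>R z) = h * partial_deriv z \<phi> (x + t *\<^sub>R z)" for h
    using gradient_inner[OF assms] by (metis inner_scaleR_right)
  then have "(\<lambda>h. partial_deriv (h *\<^sub>R z) \<phi> (x + t *\<^sub>R z)) = (*) (partial_deriv z \<phi> (x + t *\<^sub>R z))"
    by (simp add: fun_eq_iff mult.commute)
  with der show ?thesis
    by (simp add: has_field_derivative_def)
qed

text \<open>The integral of a difference quotient vanishes by translation invariance, and the difference
  quotients converge boundedly on a fixed ball.\<close>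

lemma integral_partial_deriv:
  fixes v :: "'a::euclidean_space \<Rightarrow> real"
  assumes v: "v \<in> test_functions \<Omega>" and b: "b \<in> Basis"
  shows "(LINT x|lborel. partial_deriv b v x) = 0"
proof -
  obtain K where K: "compact K" "\<And>x. x \<notin> K \<Longrightarrow> v x = 0"
    using test_functionsE[OF v] by metis
  define g where "g = partial_deriv b v"
  have gT: "g \<in> test_functions \<Omega>" unfolding g_def by (rule test_partial_deriv[OF v b])
  obtain L where L: "compact L" "\<And>x. x \<notin> L \<Longrightarrow> g x = 0"
    using test_functionsE[OF gT] by metis
  have gc: "continuous_on UNIV g" and vc: "continuous_on UNIV v"
    using gT v by (auto intro: test_continuous)
  have vm: "v \<in> borel_measurable borel" using vc by (rule borel_measurable_continuous_onI)
  have vi: "integrable lborel v" using compact_support_integrable[OF vc K] .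
  have "bounded (g ` L)"
    using compact_continuous_image[OF continuous_on_subset[OF gc] L(1)] compact_imp_bounded by blast
  then obtain B where "\<And>x. x \<in> L \<Longrightarrow> \<bar>g x\<bar> \<le> B" "0 < B"
    by (auto simp: bounded_pos)
  then have B: "\<bar>g x\<bar> \<le> B" for x using L(2)[of x] by (cases "x \<in> L") auto
  define t where "t n = 1 / real (Suc n)" for n
  have t: "0 < t n" "t n \<le> 1" for n by (auto simp: t_def)
  define D where "D n x = (v (t n *\<^sub>R b + x) - v x) / t n" for n x
  obtain R where R: "\<And>x. x \<in> K \<Longrightarrow> norm x \<le> R"
    using compact_imp_bounded[OF K(1)] by (auto simp: bounded_iff)
  define C where "C = cball (0::'a) (R + 1)"
  have Dbound: "\<bar>D n x\<bar> \<le> B * indicator C x" for n x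
  proof (cases "x \<in> C")
    case True
    have "\<exists>z>0. z < t n \<and> v (x + t n *\<^sub>R b) - v (x + 0 *\<^sub>R b) = (t n - 0) * g (x + z *\<^sub>R b)"
      unfolding g_def by (rule MVT2[OF t(1)]) (rule line_derivative[OF test_differentiable[OF v]])
    then obtain z where "v (x + t n *\<^sub>R b) - v x = t n * g (x + z *\<^sub>R b)" by auto
    then have "D n x = g (x + z *\<^sub>R b)" using t(1)[of n] by (simp add: D_def add.commute)
    then show ?thesis using B True by simp
  next
    case False
    then have n: "R + 1 < norm x" by (simp add: C_def)
    then have "x \<notin> K" using R by fastforce
    moreover have "t n *\<^sub>R b + x \<notin> K"
    proof
      assume "t n *\<^sub>R b + x \<in> K"
      then have "norm (t n *\<^sub>R b + x) \<le> R" by (rule R)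
      moreover have "norm (t n *\<^sub>R b) \<le> 1" using t[of n] b by simp
      ultimately show False using n norm_triangle_ineq4[of "t n *\<^sub>R b + x" "t n *\<^sub>R b"] by simp
    qed
    ultimately show ?thesis using K(2) False by (simp add: D_def)
  qed
  have "(\<lambda>n. LINT x|lborel. D n x) \<longlonglongrightarrow> (LINT x|lborel. g x)"
  proof (rule integral_dominated_convergence[where w="\<lambda>x. B * indicator C x"])
    show "g \<in> borel_measurable lborel"
      using borel_measurable_continuous_onI[OF gc] by simp
    show "D n \<in> borel_measurable lborel" for n
      unfolding D_def using vm by measurable
    show "integrable lborel (\<lambda>x. B * indicator C x)"
    proof (intro integrable_mult_right integrable_real_indicator)
      show "emeasure lborel C < \<infinity>"
        unfolding C_def by (rule emeasure_bounded_finite) simp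
    qed (simp add: C_def)
    show "AE x in lborel. norm (D n x) \<le> B * indicator C x" for n
      using Dbound by simp
    have "(\<lambda>n. D n x) \<longlonglongrightarrow> g x" for x
    proof -
      have "((\<lambda>h. (v (x + h *\<^sub>R b) - v (x + 0 *\<^sub>R b)) / h) \<longlongrightarrow> g (x + 0 *\<^sub>R b)) (at 0)"
        using line_derivative[where \<phi>=v and x=x and t=0 and z=b, OF test_differentiable[OF v]] unfolding g_def
        by (simp add: DERIV_def)
      moreover have "filterlim t (at 0) sequentially"
        unfolding filterlim_at
      proof
        show "t \<longlonglongrightarrow> 0" unfolding t_def by (rule LIMSEQ_Suc[OF lim_1_over_n])
        show "\<forall>\<^sub>F n in sequentially. t n \<in> UNIV \<and> t n \<noteq> 0"
          using t(1) by (simp add: less_imp_neq[symmetric])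
      qed
      ultimately have "(\<lambda>n. (v (x + t n *\<^sub>R b) - v (x + 0 *\<^sub>R b)) / t n) \<longlonglongrightarrow> g (x + 0 *\<^sub>R b)"
        by (rule filterlim_compose)
      then show ?thesis by (simp add: D_def add.commute)
    qed
    then show "AE x in lborel. (\<lambda>n. D n x) \<longlonglongrightarrow> g x" by simp
  qed
  moreover have "(LINT x|lborel. D n x) = 0" for n
  proof -
    have "integrable lborel (\<lambda>x. v (t n *\<^sub>R b + x))"
    proof (rule compact_support_integrable)
      show "continuous_on UNIV (\<lambda>x. v (t n *\<^sub>R b + x))"
        by (rule continuous_on_compose2[OF vc]) (auto intro!: continuous_intros)
      show "compact ((+) (- (t n *\<^sub>R b)) ` K)" using K(1) by (rule compact_translation)
      show "v (t n *\<^sub>R b + x) = 0" if "x \<notin> (+) (- (t n *\<^sub>R b)) ` K" for x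
        using that by (intro K(2)) (force simp: image_iff)
    qed
    then show ?thesis
      using vi lborel_integral_shift[OF vm, of "t n *\<^sub>R b"] by (simp add: D_def)
  qed
  ultimately show ?thesis unfolding g_def by (simp add: LIMSEQ_const_iff)
qed

lemma test_integration_by_parts:
  assumes \<Omega>: "open \<Omega>" and \<phi>: "\<phi> \<in> test_functions \<Omega>" and \<psi>: "\<psi> \<in> test_functions \<Omega>" and b: "b \<in> Basis"
  shows "(LINT x|lebesgue_on \<Omega>. \<phi> x * partial_deriv b \<psi> x)
    = - (LINT x|lebesgue_on \<Omega>. partial_deriv b \<phi> x * \<psi> x)"
proof -
  have p: "(\<lambda>x. \<phi> x * \<psi> x) \<in> test_functions \<Omega>" by (rule test_mult[OF \<phi> \<psi>])
  have eq: "partial_deriv b (\<lambda>x. \<phi> x * \<psi> x)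
      = (\<lambda>x. \<phi> x * partial_deriv b \<psi> x + partial_deriv b \<phi> x * \<psi> x)"
    using \<phi> \<psi> by (auto simp: partial_deriv_mult test_differentiable)
  have int: "integrable (lebesgue_on \<Omega>) f \<and> (LINT x|lebesgue_on \<Omega>. f x) = (LINT x|lborel. f x)"
    if f: "f \<in> test_functions \<Omega>" for f
  proof -
    obtain K where "compact K" "K \<subseteq> \<Omega>" "\<And>x. x \<notin> K \<Longrightarrow> f x = 0"
      using test_functionsE[OF f] by metis
    then show ?thesis using compact_support_integral_on[OF \<Omega> test_continuous[OF f]] by blast
  qed
  have "0 = (LINT x|lebesgue_on \<Omega>. partial_deriv b (\<lambda>x. \<phi> x * \<psi> x) x)"
    using integral_partial_deriv[OF p b] int[OF test_partial_deriv[OF p b]] by simp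
  also have "\<dots> = (LINT x|lebesgue_on \<Omega>. \<phi> x * partial_deriv b \<psi> x)
      + (LINT x|lebesgue_on \<Omega>. partial_deriv b \<phi> x * \<psi> x)"
    unfolding eq using \<phi> \<psi> b
    by (intro Bochner_Integration.integral_add) (auto intro!: int[THEN conjunct1] test_mult test_partial_deriv)
  finally show ?thesis by simp
qed

section \<open>The Dirichlet resolvent\<close>

lemma L2_eq_sq_integrable: "L2 \<Omega> = sq_integrable (lebesgue_on \<Omega>)"
  by (simp add: L2_def sq_integrable_def)

lemma L2_norm_eq_sq_norm: "L2_norm \<Omega> = sq_norm (lebesgue_on \<Omega>)"
  by (simp add: L2_norm_def sq_norm_def fun_eq_iff)

text \<open>Pairing a function with its gradient turns the inner product of \<open>H\<^sup>1\<close> into that of \<open>L\<^sup>2\<close>, so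
  that the facts about square integrable functions apply to \<open>H\<^sup>1\<close> verbatim.\<close>

definition jet :: "('a::euclidean_space \<Rightarrow> real) \<Rightarrow> 'a \<Rightarrow> real \<times> 'a"
  where "jet \<phi> x = (\<phi> x, gradient \<phi> x)"

lemma sq_integrable_Pair:
  assumes "u \<in> sq_integrable M" "g \<in> sq_integrable M"
  shows "(\<lambda>x. (u x, g x)) \<in> sq_integrable M"
proof (rule sq_integrableI)
  show "(\<lambda>x. (u x, g x)) \<in> borel_measurable M"
    using assms[THEN sq_integrable_measurable] by (rule borel_measurable_Pair)
  show "integrable M (\<lambda>x. (norm (u x, g x))\<^sup>2)"
    using assms by (simp add: norm_Pair sq_integrable_norm2)
qed

lemma sq_norm_Pair:
  assumes "u \<in> sq_integrable M" "g \<in> sq_integrable M"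
  shows "(sq_norm M (\<lambda>x. (u x, g x)))\<^sup>2 = (sq_norm M u)\<^sup>2 + (sq_norm M g)\<^sup>2"
  using assms by (simp add: sq_norm_power2 norm_Pair sq_integrable_norm2)

lemma sq_integrable_fst_snd:
  fixes U :: "'x \<Rightarrow> 'b::euclidean_space \<times> 'c::euclidean_space"
  assumes "U \<in> sq_integrable M"
  shows "(\<lambda>x. fst (U x)) \<in> sq_integrable M" "(\<lambda>x. snd (U x)) \<in> sq_integrable M"
proof -
  have "fst \<in> borel_measurable (borel :: ('b \<times> 'c) measure)"
    "snd \<in> borel_measurable (borel :: ('b \<times> 'c) measure)"
    by (auto intro!: borel_measurable_continuous_onI continuous_intros)
  note m = this[THEN measurable_compose[OF sq_integrable_measurable[OF assms]]]
  show "(\<lambda>x. fst (U x)) \<in> sq_integrable M" "(\<lambda>x. snd (U x)) \<in> sq_integrable M"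
    using sq_integrable_dominated[OF assms m(1), of 1] sq_integrable_dominated[OF assms m(2), of 1]
      norm_fst_le[of "fst (U x)" "snd (U x)" for x] norm_snd_le[of "snd (U x)" "fst (U x)" for x]
    by simp_all
qed

lemma sq_norm_fst_snd_le:
  assumes "U \<in> sq_integrable M"
  shows "sq_norm M (\<lambda>x. fst (U x)) \<le> sq_norm M U" "sq_norm M (\<lambda>x. snd (U x)) \<le> sq_norm M U"
proof -
  have eq: "(sq_norm M U)\<^sup>2 = (sq_norm M (\<lambda>x. fst (U x)))\<^sup>2 + (sq_norm M (\<lambda>x. snd (U x)))\<^sup>2"
    using sq_norm_Pair[OF sq_integrable_fst_snd[OF assms]] by simp
  show "sq_norm M (\<lambda>x. fst (U x)) \<le> sq_norm M U"
    by (rule power2_le_imp_le) (simp_all add: eq sq_norm_nonneg)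
  show "sq_norm M (\<lambda>x. snd (U x)) \<le> sq_norm M U"
    by (rule power2_le_imp_le) (simp_all add: eq sq_norm_nonneg)
qed

lemma sq_integrable_scaleR_Basis:
  assumes "u \<in> sq_integrable M" "b \<in> Basis"
  shows "(\<lambda>x. u x *\<^sub>R b) \<in> sq_integrable M"
proof (rule sq_integrable_dominated[OF assms(1), of _ 1])
  show "(\<lambda>x. u x *\<^sub>R b) \<in> borel_measurable M"
    using sq_integrable_measurable[OF assms(1)] by measurable
qed (simp add: assms(2))

lemma sq_inner_Pair:
  assumes "u \<in> sq_integrable M" "g \<in> sq_integrable M" "v \<in> sq_integrable M" "h \<in> sq_integrable M"
  shows "sq_inner M (\<lambda>x. (u x, g x)) (\<lambda>x. (v x, h x)) = sq_inner M u v + sq_inner M g h"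
  using assms by (simp add: sq_inner_def sq_integrable_inner)

context
  fixes \<Omega> :: "'a::euclidean_space set"
  assumes \<Omega>: "open \<Omega>"
begin

lemma test_sq_integrable:
  assumes "\<phi> \<in> test_functions \<Omega>"
  shows "\<phi> \<in> sq_integrable (lebesgue_on \<Omega>)" "\<phi> \<in> sq_integrable lborel" "sq_norm (lebesgue_on \<Omega>) \<phi> = sq_norm lborel \<phi>"
    "gradient \<phi> \<in> sq_integrable (lebesgue_on \<Omega>)" "gradient \<phi> \<in> sq_integrable lborel"
    "sq_norm (lebesgue_on \<Omega>) (gradient \<phi>) = sq_norm lborel (gradient \<phi>)"
proof -
  obtain K where K: "compact K" "K \<subseteq> \<Omega>" "\<And>x. x \<notin> K \<Longrightarrow> \<phi> x = 0 \<and> gradient \<phi> x = 0"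
    using test_gradient_support[OF assms] by metis
  note * = compact_support_sq_integrable[OF \<Omega> _ K(1,2)]
  show "\<phi> \<in> sq_integrable (lebesgue_on \<Omega>)" "\<phi> \<in> sq_integrable lborel" "sq_norm (lebesgue_on \<Omega>) \<phi> = sq_norm lborel \<phi>"
    "gradient \<phi> \<in> sq_integrable (lebesgue_on \<Omega>)" "gradient \<phi> \<in> sq_integrable lborel"
    "sq_norm (lebesgue_on \<Omega>) (gradient \<phi>) = sq_norm lborel (gradient \<phi>)"
    using K(3) by (auto intro!: * test_continuous[OF assms] test_gradient_continuous[OF assms])
qed

lemma jet_sq_integrable: "\<phi> \<in> test_functions \<Omega> \<Longrightarrow> jet \<phi> \<in> sq_integrable (lebesgue_on \<Omega>)"
  unfolding jet_def[abs_def] by (intro sq_integrable_Pair test_sq_integrable)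

lemma jet_add_scale:
  assumes "\<phi> \<in> test_functions \<Omega>" "\<psi> \<in> test_functions \<Omega>"
  shows "jet (\<lambda>x. \<phi> x + a * \<psi> x) = (\<lambda>x. jet \<phi> x + a *\<^sub>R jet \<psi> x)"
  using assms by (simp add: jet_def fun_eq_iff gradient_add_scale test_differentiable)

lemma weak_gradient_limit:
  assumes \<phi>: "\<And>n. \<phi> n \<in> test_functions \<Omega>" and U: "U \<in> sq_integrable (lebesgue_on \<Omega>)"
    and lim: "(\<lambda>n. sq_norm (lebesgue_on \<Omega>) (\<lambda>x. jet (\<phi> n) x - U x)) \<longlonglongrightarrow> 0"
  shows "is_weak_gradient \<Omega> (\<lambda>x. fst (U x)) (\<lambda>x. snd (U x))"
  unfolding is_weak_gradient_def
proof (intro ballI)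
  fix \<psi> and b :: 'a assume \<psi>: "\<psi> \<in> test_functions \<Omega>" and b: "b \<in> Basis"
  let ?M = "lebesgue_on \<Omega>"
  let ?h = "\<lambda>x. (partial_deriv b \<psi> x, \<psi> x *\<^sub>R b)"
  have h1: "(\<lambda>x. \<psi> x *\<^sub>R b) \<in> sq_integrable ?M"
    by (rule sq_integrable_scaleR_Basis[OF test_sq_integrable(1)[OF \<psi>] b])
  have h2: "partial_deriv b \<psi> \<in> sq_integrable ?M"
    by (rule test_sq_integrable(1)[OF test_partial_deriv[OF \<psi> b]])
  have h: "?h \<in> sq_integrable ?M" by (rule sq_integrable_Pair[OF h2 h1])
  have "sq_inner ?M (jet (\<phi> n)) ?h = 0" for n
  proof -
    have "sq_inner ?M (jet (\<phi> n)) ?h = sq_inner ?M (\<phi> n) (partial_deriv b \<psi>) + sq_inner ?M (gradient (\<phi> n)) (\<lambda>x. \<psi> x *\<^sub>R b)"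
      unfolding jet_def[abs_def] by (intro sq_inner_Pair test_sq_integrable \<phi> h1 h2)
    also have "\<dots> = 0"
      using test_integration_by_parts[OF \<Omega> \<phi>[of n] \<psi> b]
      by (simp add: sq_inner_def gradient_inner[OF test_differentiable[OF \<phi>]] mult.commute)
    finally show ?thesis .
  qed
  then have "(\<lambda>n. 0) \<longlonglongrightarrow> sq_inner ?M U ?h"
    using sq_inner_tendsto[OF jet_sq_integrable[OF \<phi>] U h lim] by simp
  then have "sq_inner ?M U ?h = 0" by (simp add: LIMSEQ_const_iff)
  moreover have "sq_inner ?M U ?h = sq_inner ?M (\<lambda>x. fst (U x)) (partial_deriv b \<psi>) + sq_inner ?M (\<lambda>x. snd (U x)) (\<lambda>x. \<psi> x *\<^sub>R b)"
    using sq_inner_Pair[OF sq_integrable_fst_snd(1)[OF U] sq_integrable_fst_snd(2)[OF U] h2 h1] by simp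
  ultimately show "(LINT x|?M. fst (U x) * partial_deriv b \<psi> x) = - (LINT x|?M. (snd (U x) \<bullet> b) * \<psi> x)"
    by (simp add: sq_inner_def mult.commute)
qed

text \<open>The closure of the jets of test functions. Its elements carry a weak gradient as their second
  component; \<open>H\<^sub>0\<^sup>1\<close> is the projection to the first component.\<close>

definition jet_closure :: "('a \<Rightarrow> real \<times> 'a) set"
  where "jet_closure = {U \<in> sq_integrable (lebesgue_on \<Omega>). \<exists>\<phi>. (\<forall>n::nat. \<phi> n \<in> test_functions \<Omega>) \<and>
    (\<lambda>n. sq_norm (lebesgue_on \<Omega>) (\<lambda>x. jet (\<phi> n) x - U x)) \<longlonglongrightarrow> 0}"

lemma H10_iff: "u \<in> H10 \<Omega> \<longleftrightarrow> (\<exists>U\<in>jet_closure. u = (\<lambda>x. fst (U x)))"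
proof
  let ?M = "lebesgue_on \<Omega>"
  assume "u \<in> H10 \<Omega>"
  then obtain g \<phi> where u: "u \<in> sq_integrable ?M" and g: "g \<in> sq_integrable ?M" and \<phi>: "\<And>n. \<phi> n \<in> test_functions \<Omega>"
    and lim: "(\<lambda>n. sq_norm ?M (\<lambda>x. \<phi> n x - u x)) \<longlonglongrightarrow> 0" "(\<lambda>n. sq_norm ?M (\<lambda>x. gradient (\<phi> n) x - g x)) \<longlonglongrightarrow> 0"
    unfolding H10_def L2_eq_sq_integrable L2_norm_eq_sq_norm by blast
  let ?U = "\<lambda>x. (u x, g x)"
  have eq: "sq_norm ?M (\<lambda>x. jet (\<phi> n) x - ?U x)
      = sqrt ((sq_norm ?M (\<lambda>x. \<phi> n x - u x))\<^sup>2 + (sq_norm ?M (\<lambda>x. gradient (\<phi> n) x - g x))\<^sup>2)" for n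
  proof -
    have "(sq_norm ?M (\<lambda>x. jet (\<phi> n) x - ?U x))\<^sup>2
      = (sq_norm ?M (\<lambda>x. \<phi> n x - u x))\<^sup>2 + (sq_norm ?M (\<lambda>x. gradient (\<phi> n) x - g x))\<^sup>2"
      unfolding jet_def diff_Pair by (intro sq_norm_Pair sq_integrable_diff test_sq_integrable \<phi> u g)
    then show ?thesis by (rule real_sqrt_unique[symmetric]) (rule sq_norm_nonneg)
  qed
  have "(\<lambda>n. sqrt ((sq_norm ?M (\<lambda>x. \<phi> n x - u x))\<^sup>2 + (sq_norm ?M (\<lambda>x. gradient (\<phi> n) x - g x))\<^sup>2))
      \<longlonglongrightarrow> sqrt (0\<^sup>2 + 0\<^sup>2)"
    by (intro tendsto_intros lim)
  then have "(\<lambda>n. sq_norm ?M (\<lambda>x. jet (\<phi> n) x - ?U x)) \<longlonglongrightarrow> 0"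
    unfolding eq by simp
  then have "?U \<in> jet_closure"
    unfolding jet_closure_def using sq_integrable_Pair[OF u g] \<phi> by blast
  then show "\<exists>U\<in>jet_closure. u = (\<lambda>x. fst (U x))"
    by (intro bexI[of _ ?U]) auto
next
  let ?M = "lebesgue_on \<Omega>"
  assume "\<exists>U\<in>jet_closure. u = (\<lambda>x. fst (U x))"
  then obtain U \<phi> where u: "u = (\<lambda>x. fst (U x))" and U: "U \<in> sq_integrable ?M"
    and \<phi>: "\<And>n::nat. \<phi> n \<in> test_functions \<Omega>"
    and lim: "(\<lambda>n. sq_norm ?M (\<lambda>x. jet (\<phi> n) x - U x)) \<longlonglongrightarrow> 0"
    unfolding jet_closure_def by blast
  have d: "(\<lambda>x. jet (\<phi> n) x - U x) \<in> sq_integrable ?M" for n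
    by (intro sq_integrable_diff jet_sq_integrable \<phi> U)
  have "(\<lambda>n. sq_norm ?M (\<lambda>x. \<phi> n x - fst (U x))) \<longlonglongrightarrow> 0"
    using sq_norm_fst_snd_le(1)[OF d]
    by (intro tendsto_sandwich[OF _ _ tendsto_const lim] always_eventually) (auto simp: sq_norm_nonneg jet_def)
  moreover have "(\<lambda>n. sq_norm ?M (\<lambda>x. gradient (\<phi> n) x - snd (U x))) \<longlonglongrightarrow> 0"
    using sq_norm_fst_snd_le(2)[OF d]
    by (intro tendsto_sandwich[OF _ _ tendsto_const lim] always_eventually) (auto simp: sq_norm_nonneg jet_def)
  ultimately show "u \<in> H10 \<Omega>"
    unfolding H10_def L2_eq_sq_integrable L2_norm_eq_sq_norm u
    using sq_integrable_fst_snd[OF U] weak_gradient_limit[OF \<phi> U lim] \<phi> by blast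
qed

lemma jet_closure_sq_integrable: "U \<in> jet_closure \<Longrightarrow> U \<in> sq_integrable (lebesgue_on \<Omega>)"
  by (simp add: jet_closure_def)

lemma jet_closureE:
  assumes "U \<in> jet_closure"
  obtains \<phi> where "\<And>n::nat. \<phi> n \<in> test_functions \<Omega>"
    "(\<lambda>n. sq_norm (lebesgue_on \<Omega>) (\<lambda>x. jet (\<phi> n) x - U x)) \<longlonglongrightarrow> 0"
  using assms unfolding jet_closure_def by blast

lemma jet_closure_add_scale:
  assumes "U \<in> jet_closure" "V \<in> jet_closure"
  shows "(\<lambda>x. U x + a *\<^sub>R V x) \<in> jet_closure"
proof -
  let ?M = "lebesgue_on \<Omega>"
  obtain \<phi> where \<phi>: "\<And>n::nat. \<phi> n \<in> test_functions \<Omega>" "(\<lambda>n. sq_norm ?M (\<lambda>x. jet (\<phi> n) x - U x)) \<longlonglongrightarrow> 0"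
    by (rule jet_closureE[OF assms(1)]) blast
  obtain \<psi> where \<psi>: "\<And>n::nat. \<psi> n \<in> test_functions \<Omega>" "(\<lambda>n. sq_norm ?M (\<lambda>x. jet (\<psi> n) x - V x)) \<longlonglongrightarrow> 0"
    by (rule jet_closureE[OF assms(2)]) blast
  note U = assms[THEN jet_closure_sq_integrable]
  have le: "sq_norm ?M (\<lambda>x. jet (\<lambda>x. \<phi> n x + a * \<psi> n x) x - (U x + a *\<^sub>R V x))
      \<le> sq_norm ?M (\<lambda>x. jet (\<phi> n) x - U x) + \<bar>a\<bar> * sq_norm ?M (\<lambda>x. jet (\<psi> n) x - V x)" for n
  proof -
    have "sq_norm ?M (\<lambda>x. (jet (\<phi> n) x - U x) + a *\<^sub>R (jet (\<psi> n) x - V x))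
        \<le> sq_norm ?M (\<lambda>x. jet (\<phi> n) x - U x) + sq_norm ?M (\<lambda>x. a *\<^sub>R (jet (\<psi> n) x - V x))"
      by (intro sq_norm_triangle sq_integrable_scale sq_integrable_diff jet_sq_integrable \<phi> \<psi> U)
    then show ?thesis
      unfolding jet_add_scale[OF \<phi>(1) \<psi>(1)] sq_norm_scale by (simp add: algebra_simps)
  qed
  have "(\<lambda>n. sq_norm ?M (\<lambda>x. jet (\<phi> n) x - U x) + \<bar>a\<bar> * sq_norm ?M (\<lambda>x. jet (\<psi> n) x - V x)) \<longlonglongrightarrow> 0 + \<bar>a\<bar> * 0"
    by (intro tendsto_intros \<phi> \<psi>)
  then have lim: "(\<lambda>n. sq_norm ?M (\<lambda>x. jet (\<phi> n) x - U x) + \<bar>a\<bar> * sq_norm ?M (\<lambda>x. jet (\<psi> n) x - V x)) \<longlonglongrightarrow> 0"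
    by simp
  have "(\<lambda>n. sq_norm ?M (\<lambda>x. jet (\<lambda>x. \<phi> n x + a * \<psi> n x) x - (U x + a *\<^sub>R V x))) \<longlonglongrightarrow> 0"
    by (rule Lim_null_comparison[OF always_eventually lim]) (use le in \<open>simp add: sq_norm_nonneg\<close>)
  moreover have "(\<lambda>x. U x + a *\<^sub>R V x) \<in> sq_integrable ?M"
    by (intro sq_integrable_add sq_integrable_scale U)
  ultimately show ?thesis
    unfolding jet_closure_def
    by (intro CollectI conjI exI[of _ "\<lambda>n x. \<phi> n x + a * \<psi> n x"] allI test_add_scale \<phi>(1) \<psi>(1))
qed

text \<open>One integration by parts moves a derivative from the test function to the weak gradient,
  because partial derivatives of test functions are test functions.\<close>

lemma solves_distr_iff:
  assumes U: "U \<in> jet_closure"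
  shows "solves_distr \<Omega> c f (\<lambda>x. fst (U x)) \<longleftrightarrow>
    (\<forall>\<psi>\<in>test_functions \<Omega>. sq_inner (lebesgue_on \<Omega>) (\<lambda>x. snd (U x)) (gradient \<psi>)
      + c * sq_inner (lebesgue_on \<Omega>) (\<lambda>x. fst (U x)) \<psi> = sq_inner (lebesgue_on \<Omega>) f \<psi>)"
proof -
  let ?M = "lebesgue_on \<Omega>"
  let ?u = "\<lambda>x. fst (U x)" and ?g = "\<lambda>x. snd (U x)"
  note UM = jet_closure_sq_integrable[OF U]
  note ug = sq_integrable_fst_snd[OF UM]
  have wg: "is_weak_gradient \<Omega> ?u ?g"
    by (rule jet_closureE[OF U]) (rule weak_gradient_limit[OF _ UM])
  have "(LINT x|?M. ?u x * (- laplacian \<psi> x + c * \<psi> x)) = sq_inner ?M ?g (gradient \<psi>) + c * sq_inner ?M ?u \<psi>"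
    if \<psi>: "\<psi> \<in> test_functions \<Omega>" for \<psi>
  proof -
    have i1: "integrable ?M (\<lambda>x. ?u x * partial_deriv b (partial_deriv b \<psi>) x)" if "b \<in> Basis" for b
      using sq_integrable_inner[OF ug(1) test_sq_integrable(1)[OF test_partial_deriv[OF test_partial_deriv[OF \<psi> that] that]]]
      by simp
    have i2: "integrable ?M (\<lambda>x. ?u x * \<psi> x)"
      using sq_integrable_inner[OF ug(1) test_sq_integrable(1)[OF \<psi>]] by simp
    have i3: "integrable ?M (\<lambda>x. (?g x \<bullet> b) * partial_deriv b \<psi> x)" if b: "b \<in> Basis" for b
    proof -
      have "(\<lambda>x. partial_deriv b \<psi> x *\<^sub>R b) \<in> sq_integrable ?M"
        by (rule sq_integrable_scaleR_Basis[OF test_sq_integrable(1)[OF test_partial_deriv[OF \<psi> b]] b])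
      from sq_integrable_inner[OF ug(2) this] show ?thesis by (simp add: mult.commute)
    qed
    have eq1: "?u x * (- laplacian \<psi> x + c * \<psi> x)
        = c * (?u x * \<psi> x) - (\<Sum>b\<in>Basis. ?u x * partial_deriv b (partial_deriv b \<psi>) x)" for x
      unfolding laplacian_def sum_distrib_left[symmetric] by (simp add: algebra_simps)
    have "(LINT x|?M. ?u x * (- laplacian \<psi> x + c * \<psi> x))
        = c * (LINT x|?M. ?u x * \<psi> x)
          - (\<Sum>b\<in>Basis. LINT x|?M. ?u x * partial_deriv b (partial_deriv b \<psi>) x)"
      unfolding eq1 using i1 i2 by simp
    also have "(\<Sum>b\<in>Basis. LINT x|?M. ?u x * partial_deriv b (partial_deriv b \<psi>) x)
        = (\<Sum>b\<in>Basis. - (LINT x|?M. (?g x \<bullet> b) * partial_deriv b \<psi> x))"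
      using wg test_partial_deriv[OF \<psi>] unfolding is_weak_gradient_def by (intro sum.cong) auto
    also have "\<dots> = - sq_inner ?M ?g (gradient \<psi>)"
      unfolding sq_inner_def inner_gradient
      using i3 by (simp add: sum_negf)
    finally show ?thesis by (simp add: sq_inner_def)
  qed
  then show ?thesis unfolding solves_distr_def by (simp add: sq_inner_def)
qed

definition weak_solution :: "('a \<Rightarrow> real) \<Rightarrow> ('a \<Rightarrow> real \<times> 'a) \<Rightarrow> bool"
  where "weak_solution f U \<longleftrightarrow> U \<in> jet_closure \<and>
    (\<forall>\<psi>\<in>test_functions \<Omega>. sq_inner (lebesgue_on \<Omega>) U (jet \<psi>) = sq_inner (lebesgue_on \<Omega>) f \<psi>)"

lemma weak_solution_iff:
  "U \<in> jet_closure \<Longrightarrow> solves_distr \<Omega> 1 f (\<lambda>x. fst (U x)) \<longleftrightarrow> weak_solution f U"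
proof -
  assume U: "U \<in> jet_closure"
  let ?M = "lebesgue_on \<Omega>"
  have "sq_inner ?M U (jet \<psi>) = sq_inner ?M (\<lambda>x. fst (U x)) \<psi> + sq_inner ?M (\<lambda>x. snd (U x)) (gradient \<psi>)"
    if "\<psi> \<in> test_functions \<Omega>" for \<psi>
    using sq_inner_Pair[OF sq_integrable_fst_snd(1,2)[OF jet_closure_sq_integrable[OF U]] test_sq_integrable(1,4)[OF that]]
    by (simp add: jet_def[abs_def])
  then show ?thesis
    unfolding solves_distr_iff[OF U] weak_solution_def using U by (simp add: add.commute)
qed

text \<open>The solution may be inserted as a test function after passing to the limit along
  approximating test functions, which gives \<open>\<parallel>U\<parallel>\<^sup>2 = \<langle>f, u\<rangle> \<le> \<parallel>f\<parallel> \<parallel>U\<parallel>\<close>.\<close>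

lemma weak_solution_bound:
  assumes f: "f \<in> sq_integrable (lebesgue_on \<Omega>)" and U: "weak_solution f U"
  shows "sq_norm (lebesgue_on \<Omega>) U \<le> sq_norm (lebesgue_on \<Omega>) f"
proof -
  let ?M = "lebesgue_on \<Omega>"
  have Uc: "U \<in> jet_closure" and eq: "\<And>\<psi>. \<psi> \<in> test_functions \<Omega> \<Longrightarrow> sq_inner ?M U (jet \<psi>) = sq_inner ?M f \<psi>"
    using U by (auto simp: weak_solution_def)
  note UM = jet_closure_sq_integrable[OF Uc]
  obtain \<phi> where \<phi>: "\<And>n::nat. \<phi> n \<in> test_functions \<Omega>" "(\<lambda>n. sq_norm ?M (\<lambda>x. jet (\<phi> n) x - U x)) \<longlonglongrightarrow> 0"
    by (rule jet_closureE[OF Uc]) blast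
  have l1: "(\<lambda>n. sq_inner ?M (jet (\<phi> n)) U) \<longlonglongrightarrow> sq_inner ?M U U"
    by (intro sq_inner_tendsto jet_sq_integrable \<phi> UM)
  have l2: "(\<lambda>n. sq_norm ?M f * sq_norm ?M (jet (\<phi> n))) \<longlonglongrightarrow> sq_norm ?M f * sq_norm ?M U"
    by (intro tendsto_intros sq_norm_tendsto jet_sq_integrable \<phi> UM)
  have "sq_inner ?M (jet (\<phi> n)) U \<le> sq_norm ?M f * sq_norm ?M (jet (\<phi> n))" for n
  proof -
    have "sq_inner ?M (jet (\<phi> n)) U = sq_inner ?M f (\<phi> n)"
      unfolding eq[OF \<phi>(1), symmetric] by (rule sq_inner_commute)
    also have "\<dots> \<le> sq_norm ?M f * sq_norm ?M (\<phi> n)"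
      using sq_inner_Cauchy_Schwarz[OF f test_sq_integrable(1)[OF \<phi>(1)[of n]]] by simp
    also have "\<dots> \<le> sq_norm ?M f * sq_norm ?M (jet (\<phi> n))"
      using sq_norm_fst_snd_le(1)[OF jet_sq_integrable[OF \<phi>(1)[of n]]]
      by (intro mult_left_mono) (auto simp: jet_def sq_norm_nonneg)
    finally show ?thesis .
  qed
  then have "sq_inner ?M U U \<le> sq_norm ?M f * sq_norm ?M U"
    by (intro LIMSEQ_le[OF l1 l2]) auto
  then have "sq_norm ?M U * sq_norm ?M U \<le> sq_norm ?M f * sq_norm ?M U"
    unfolding sq_norm_eq_sq_inner[symmetric] power2_eq_square .
  then show ?thesis
    using sq_norm_nonneg[of ?M U] sq_norm_nonneg[of ?M f] mult_right_le_imp_le[of "sq_norm ?M U" "sq_norm ?M U" "sq_norm ?M f"]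
    by fastforce
qed

lemma weak_solution_add_scale:
  assumes "f \<in> sq_integrable (lebesgue_on \<Omega>)" "g \<in> sq_integrable (lebesgue_on \<Omega>)"
    and "weak_solution f U" "weak_solution g V"
  shows "weak_solution (\<lambda>x. f x + a * g x) (\<lambda>x. U x + a *\<^sub>R V x)"
proof -
  have U: "U \<in> jet_closure" "V \<in> jet_closure" using assms by (auto simp: weak_solution_def)
  show ?thesis
    unfolding weak_solution_def
  proof (intro conjI ballI jet_closure_add_scale U)
    fix \<psi> assume \<psi>: "\<psi> \<in> test_functions \<Omega>"
    note UM = U[THEN jet_closure_sq_integrable]
    have "sq_inner (lebesgue_on \<Omega>) (\<lambda>x. U x + a *\<^sub>R V x) (jet \<psi>)
        = sq_inner (lebesgue_on \<Omega>) U (jet \<psi>) + a * sq_inner (lebesgue_on \<Omega>) V (jet \<psi>)"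
      by (simp add: sq_inner_add_left UM sq_integrable_scale jet_sq_integrable[OF \<psi>] sq_inner_scale_left)
    also have "\<dots> = sq_inner (lebesgue_on \<Omega>) f \<psi> + a * sq_inner (lebesgue_on \<Omega>) g \<psi>"
      using assms \<psi> by (simp add: weak_solution_def)
    also have "\<dots> = sq_inner (lebesgue_on \<Omega>) (\<lambda>x. f x + a *\<^sub>R g x) \<psi>"
      unfolding sq_inner_scale_left[symmetric]
      by (intro sq_inner_add_left[symmetric] assms sq_integrable_scale test_sq_integrable \<psi>)
    finally show "sq_inner (lebesgue_on \<Omega>) (\<lambda>x. U x + a *\<^sub>R V x) (jet \<psi>)
        = sq_inner (lebesgue_on \<Omega>) (\<lambda>x. f x + a * g x) \<psi>" by simp
  qed
qed

lemma weak_solution_unique: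
  assumes f: "f \<in> sq_integrable (lebesgue_on \<Omega>)" and g: "g \<in> sq_integrable (lebesgue_on \<Omega>)"
    and "weak_solution f U" "weak_solution g V"
    and ae: "AE x in lebesgue_on \<Omega>. f x = g x"
  shows "AE x in lebesgue_on \<Omega>. U x = V x"
proof -
  let ?M = "lebesgue_on \<Omega>"
  have fg: "(\<lambda>x. f x + (-1) * g x) \<in> sq_integrable ?M"
    using sq_integrable_diff[OF f g] by simp
  have sol: "weak_solution (\<lambda>x. f x + (-1) * g x) (\<lambda>x. U x + (-1) *\<^sub>R V x)"
    by (intro weak_solution_add_scale assms)
  have "sq_norm ?M (\<lambda>x. f x + (-1) * g x) = sq_norm ?M (\<lambda>x. 0::real)"
    using ae by (intro sq_norm_cong_AE sq_integrable_measurable[OF fg]) auto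
  also have "\<dots> = 0" by (simp add: sq_norm_def)
  finally have "sq_norm ?M (\<lambda>x. U x + (-1) *\<^sub>R V x) = 0"
    using weak_solution_bound[OF fg sol] sq_norm_nonneg[of ?M "\<lambda>x. U x + (-1) *\<^sub>R V x"] by simp
  moreover have "(\<lambda>x. U x + (-1) *\<^sub>R V x) \<in> sq_integrable ?M"
    using sol by (auto simp: weak_solution_def jet_closure_sq_integrable)
  ultimately have "AE x in ?M. U x + (-1) *\<^sub>R V x = 0"
    by (intro sq_norm_eq_0_AE)
  then show ?thesis by simp
qed

text \<open>The weak equation says that \<open>(f, 0) - U\<close> is orthogonal to all jets of test functions, that is,
  \<open>U\<close> is the projection of \<open>(f, 0)\<close> onto their closure.\<close>

lemma weak_solution_exists:
  assumes f: "f \<in> sq_integrable (lebesgue_on \<Omega>)"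
  obtains U where "weak_solution f U"
proof -
  let ?M = "lebesgue_on \<Omega>"
  let ?S = "jet ` test_functions \<Omega>"
  let ?F = "\<lambda>x. (f x, 0 :: 'a)"
  have F: "?F \<in> sq_integrable ?M" by (intro sq_integrable_Pair f sq_integrable_zero)
  have S: "?S \<subseteq> sq_integrable ?M" "?S \<noteq> {}" using jet_sq_integrable test_zero by auto
  have lin: "(\<lambda>x. s x + a *\<^sub>R t x) \<in> ?S" if "s \<in> ?S" "t \<in> ?S" for s t a
  proof -
    obtain \<phi> where \<phi>: "\<phi> \<in> test_functions \<Omega>" "s = jet \<phi>" using \<open>s \<in> ?S\<close> by blast
    obtain \<psi> where \<psi>: "\<psi> \<in> test_functions \<Omega>" "t = jet \<psi>" using \<open>t \<in> ?S\<close> by blast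
    show ?thesis
      unfolding \<phi>(2) \<psi>(2) jet_add_scale[OF \<phi>(1) \<psi>(1), symmetric]
      by (intro imageI test_add_scale \<phi> \<psi>)
  qed
  obtain P s where P: "P \<in> sq_integrable ?M" "\<And>n::nat. s n \<in> ?S" "(\<lambda>n. sq_norm ?M (\<lambda>x. s n x - P x)) \<longlonglongrightarrow> 0"
    "\<And>t. t \<in> ?S \<Longrightarrow> sq_inner ?M (\<lambda>x. ?F x - P x) t = 0"
    by (rule sq_norm_projection[OF S _ F], rule lin, assumption, assumption, rule that)
  from P(2) have "\<forall>n. \<exists>\<phi>\<in>test_functions \<Omega>. s n = jet \<phi>" by blast
  then obtain \<phi> where \<phi>: "\<And>n. \<phi> n \<in> test_functions \<Omega> \<and> s n = jet (\<phi> n)"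
    unfolding Bex_def choice_iff by blast
  have "P \<in> jet_closure"
    unfolding jet_closure_def using P(1,3) \<phi> by auto
  moreover have "sq_inner ?M P (jet \<psi>) = sq_inner ?M f \<psi>" if \<psi>: "\<psi> \<in> test_functions \<Omega>" for \<psi>
  proof -
    have "0 = sq_inner ?M ?F (jet \<psi>) - sq_inner ?M P (jet \<psi>)"
      using P(4)[of "jet \<psi>"] \<psi> sq_inner_diff_left[OF F P(1) jet_sq_integrable[OF \<psi>]] by simp
    also have "sq_inner ?M ?F (jet \<psi>) = sq_inner ?M f \<psi>"
      by (simp add: sq_inner_def jet_def)
    finally show ?thesis by simp
  qed
  ultimately show ?thesis using that unfolding weak_solution_def by blast
qed

lemma dirichlet_resolvent_weak_solution:
  assumes "f \<in> sq_integrable (lebesgue_on \<Omega>)"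
  obtains U where "weak_solution f U" "dirichlet_resolvent \<Omega> f = (\<lambda>x. fst (U x))"
proof -
  obtain V where V: "weak_solution f V" using weak_solution_exists[OF assms] .
  then have "V \<in> jet_closure" by (simp add: weak_solution_def)
  then have "(\<lambda>x. fst (V x)) \<in> H10 \<Omega> \<and> solves_distr \<Omega> 1 f (\<lambda>x. fst (V x))"
    using V weak_solution_iff H10_iff by blast
  then have "dirichlet_resolvent \<Omega> f \<in> H10 \<Omega> \<and> solves_distr \<Omega> 1 f (dirichlet_resolvent \<Omega> f)"
    unfolding dirichlet_resolvent_def
    by (rule someI[where P="\<lambda>u. u \<in> H10 \<Omega> \<and> solves_distr \<Omega> 1 f u"])
  then obtain U where U: "U \<in> jet_closure" "dirichlet_resolvent \<Omega> f = (\<lambda>x. fst (U x))"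
    and "solves_distr \<Omega> 1 f (\<lambda>x. fst (U x))"
    using H10_iff by auto
  then show ?thesis using that[OF _ U(2)] weak_solution_iff[OF U(1)] by simp
qed

text \<open>Testing the torsion equation with \<open>\<psi>\<close> expresses the integral of \<open>\<psi>\<close> as the inner product of the
  two gradients; \<open>K\<close> is the norm of the gradient of \<open>w\<close>.\<close>

lemma torsion_function_bound:
  assumes "torsion_function \<Omega> w"
  obtains K where "0 \<le> K"
    "\<And>\<psi>. \<psi> \<in> test_functions \<Omega> \<Longrightarrow> \<bar>LINT x|lborel. \<psi> x\<bar> \<le> K * sq_norm lborel (gradient \<psi>)"
proof -
  let ?M = "lebesgue_on \<Omega>"
  have "w \<in> H10 \<Omega>" using assms by (simp add: torsion_function_def)
  then obtain U where U: "U \<in> jet_closure" "w = (\<lambda>x. fst (U x))" using H10_iff by blast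
  have sol: "solves_distr \<Omega> 0 (\<lambda>x. 1) (\<lambda>x. fst (U x))"
    using assms U(2) by (simp add: torsion_function_def)
  have "\<bar>LINT x|lborel. \<psi> x\<bar> \<le> sq_norm ?M (\<lambda>x. snd (U x)) * sq_norm lborel (gradient \<psi>)"
    if \<psi>: "\<psi> \<in> test_functions \<Omega>" for \<psi>
  proof -
    obtain K where K: "compact K" "K \<subseteq> \<Omega>" "\<And>x. x \<notin> K \<Longrightarrow> \<psi> x = 0"
      using test_functionsE[OF \<psi>] by metis
    have "(LINT x|lborel. \<psi> x) = sq_inner ?M (\<lambda>x. 1) \<psi>"
      using compact_support_integral_on(2)[OF \<Omega> test_continuous[OF \<psi>] K] by (simp add: sq_inner_def)
    also have "\<dots> = sq_inner ?M (\<lambda>x. snd (U x)) (gradient \<psi>)"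
      using sol \<psi> unfolding solves_distr_iff[OF U(1)] by simp
    finally show ?thesis
      using sq_inner_Cauchy_Schwarz[OF sq_integrable_fst_snd(2)[OF jet_closure_sq_integrable[OF U(1)]] test_sq_integrable(4)[OF \<psi>]]
      by (simp add: test_sq_integrable(6)[OF \<psi>])
  qed
  then show ?thesis using that[OF sq_norm_nonneg] by blast
qed

end

section \<open>The torsion bound in \<open>L\<^sup>1\<close> and tightness\<close>

text \<open>A smooth replacement for the absolute value which vanishes where \<open>\<phi>\<close> does, so that it keeps
  the compact support.\<close>

definition smooth_abs :: "real \<Rightarrow> ('a \<Rightarrow> real) \<Rightarrow> 'a \<Rightarrow> real"
  where "smooth_abs \<delta> \<phi> x = sqrt (\<phi> x * \<phi> x + \<delta> * \<delta>) - \<delta>"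

lemma smooth_abs_ge: "\<bar>\<phi> x\<bar> - \<delta> \<le> smooth_abs \<delta> \<phi> x"
proof -
  have "sqrt (\<phi> x * \<phi> x) \<le> sqrt (\<phi> x * \<phi> x + \<delta> * \<delta>)"
    by (intro real_sqrt_le_mono) simp
  then show ?thesis by (simp add: smooth_abs_def)
qed

lemma smooth_abs_test:
  assumes \<phi>: "\<phi> \<in> test_functions \<Omega>" and \<delta>: "0 < \<delta>"
  shows "smooth_abs \<delta> \<phi> \<in> test_functions \<Omega>"
proof -
  obtain K where K: "compact K" "K \<subseteq> \<Omega>" "\<And>x. x \<notin> K \<Longrightarrow> \<phi> x = 0"
    using test_functionsE[OF \<phi>] by metis
  have pos: "0 < \<phi> x * \<phi> x + \<delta> * \<delta>" for x
    using \<delta> by (intro add_nonneg_pos) auto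
  have "C_k k (\<lambda>x. \<phi> x * \<phi> x + \<delta> * \<delta>)" for k
    by (intro C_k_add C_k_mult C_k_const test_C_k[OF \<phi>])
  then have "C_k k (\<lambda>x. (\<phi> x * \<phi> x + \<delta> * \<delta>) powr (1/2) + (- \<delta>))" for k
    by (rule C_k_add[OF C_k_powr[OF _ pos] C_k_const])
  moreover have "(\<lambda>x. (\<phi> x * \<phi> x + \<delta> * \<delta>) powr (1/2) + (- \<delta>)) = smooth_abs \<delta> \<phi>"
    using pos by (simp add: smooth_abs_def fun_eq_iff powr_half_sqrt less_imp_le)
  ultimately have "C_k k (smooth_abs \<delta> \<phi>)" for k by simp
  then show ?thesis
    by (rule test_functionsI[OF _ K(1,2)]) (use \<delta> K(3) in \<open>simp add: smooth_abs_def\<close>)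
qed

lemma norm_gradient_smooth_abs:
  assumes \<phi>: "\<phi> \<in> test_functions \<Omega>" and \<delta>: "0 < \<delta>"
  shows "norm (gradient (smooth_abs \<delta> \<phi>) x) \<le> norm (gradient \<phi> x)"
proof -
  define s where "s = sqrt (\<phi> x * \<phi> x + \<delta> * \<delta>)"
  have pos: "0 < \<phi> x * \<phi> x + \<delta> * \<delta>"
    using \<delta> by (intro add_nonneg_pos) auto
  have s: "0 < s" "\<bar>\<phi> x\<bar> \<le> s"
    using pos smooth_abs_ge[of \<phi> x \<delta>] by (auto simp: s_def smooth_abs_def)
  note d = has_derivative_partial_deriv[OF test_differentiable[OF \<phi>, of x]]
  have "((\<lambda>x. \<phi> x * \<phi> x + \<delta> * \<delta>) has_derivative
      (\<lambda>h. (\<phi> x * partial_deriv h \<phi> x + partial_deriv h \<phi> x * \<phi> x) + 0)) (at x)"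
    by (intro has_derivative_add has_derivative_mult d has_derivative_const)
  from has_derivative_diff[OF has_derivative_real_sqrt[OF pos this] has_derivative_const[of \<delta>]]
  have "(smooth_abs \<delta> \<phi> has_derivative (\<lambda>h. (\<phi> x / s) * partial_deriv h \<phi> x)) (at x)"
    unfolding smooth_abs_def[abs_def] s_def by (simp add: field_simps)
  then have "partial_deriv b (smooth_abs \<delta> \<phi>) x = (\<phi> x / s) * partial_deriv b \<phi> x" for b
    by (rule partial_deriv_eq)
  then have "gradient (smooth_abs \<delta> \<phi>) x = (\<phi> x / s) *\<^sub>R gradient \<phi> x"
    by (simp add: gradient_def scaleR_sum_right)
  then have "norm (gradient (smooth_abs \<delta> \<phi>) x) = \<bar>\<phi> x\<bar> / s * norm (gradient \<phi> x)"
    using s by (simp add: abs_divide)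
  also have "\<dots> \<le> 1 * norm (gradient \<phi> x)"
    using s by (intro mult_right_mono) auto
  finally show ?thesis by simp
qed

lemma test_integrable: "\<phi> \<in> test_functions \<Omega> \<Longrightarrow> integrable lborel \<phi>"
  by (rule test_functionsE, assumption) (rule compact_support_integrable[OF test_continuous])

text \<open>The bound on integrals is applied to \<open>smooth_abs \<delta> \<phi>\<close>, whose gradient is dominated by that of
  \<open>\<phi>\<close>. The error is at most \<open>\<delta>\<close> times the measure of the support of \<open>\<phi>\<close>, and \<open>\<delta>\<close> is arbitrary.\<close>

lemma L1_bound:
  assumes \<Omega>: "open \<Omega>" and "0 \<le> K"
    and K: "\<And>\<psi>. \<psi> \<in> test_functions \<Omega> \<Longrightarrow> \<bar>LINT x|lborel. \<psi> x\<bar> \<le> K * sq_norm lborel (gradient \<psi>)"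
    and \<phi>: "\<phi> \<in> test_functions \<Omega>"
  shows "(LINT x|lborel. \<bar>\<phi> x\<bar>) \<le> K * sq_norm lborel (gradient \<phi>)"
proof (rule field_le_epsilon)
  fix e :: real assume e: "0 < e"
  obtain S where S: "compact S" "\<And>x. x \<notin> S \<Longrightarrow> \<phi> x = 0"
    using test_functionsE[OF \<phi>] by metis
  define m where "m = measure lborel S"
  define \<delta> where "\<delta> = e / (m + 1)"
  have m: "0 \<le> m" by (simp add: m_def)
  then have \<delta>: "0 < \<delta>" using e by (simp add: \<delta>_def)
  have \<delta>m: "\<delta> * m \<le> e" using e m by (simp add: \<delta>_def field_simps)
  have Si: "integrable lborel (\<lambda>x. indicator S x :: real)"
    using S(1) emeasure_bounded_finite[OF compact_imp_bounded[OF S(1)]]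
    by (intro integrable_real_indicator) (auto simp: borel_compact)
  note \<psi> = smooth_abs_test[OF \<phi> \<delta>]
  have "(LINT x|lborel. \<bar>\<phi> x\<bar>) \<le> (LINT x|lborel. smooth_abs \<delta> \<phi> x + \<delta> * indicator S x)"
  proof (rule integral_mono)
    fix x show "\<bar>\<phi> x\<bar> \<le> smooth_abs \<delta> \<phi> x + \<delta> * indicator S x"
    proof (cases "x \<in> S")
      case True then show ?thesis using smooth_abs_ge[of \<phi> x \<delta>] by simp
    next
      case False then show ?thesis using S(2)[of x] \<delta> by (simp add: smooth_abs_def)
    qed
  qed (use test_integrable[OF \<phi>] test_integrable[OF \<psi>] Si in auto)
  also have "\<dots> = (LINT x|lborel. smooth_abs \<delta> \<phi> x) + \<delta> * m"
    using test_integrable[OF \<psi>] Si by (simp add: m_def)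
  also have "\<dots> \<le> K * sq_norm lborel (gradient (smooth_abs \<delta> \<phi>)) + e"
    using K[OF \<psi>] \<delta>m by linarith
  also have "sq_norm lborel (gradient (smooth_abs \<delta> \<phi>)) \<le> sq_norm lborel (gradient \<phi>)"
    unfolding sq_norm_def
    by (intro real_sqrt_le_mono integral_mono power_mono norm_gradient_smooth_abs[OF \<phi> \<delta>]
        sq_integrable_norm2 test_sq_integrable(5)[OF \<Omega>] \<phi> \<psi>) simp
  finally show "(LINT x|lborel. \<bar>\<phi> x\<bar>) \<le> K * sq_norm lborel (gradient \<phi>) + e"
    using \<open>0 \<le> K\<close> by (simp add: mult_left_mono)
qed

text \<open>Let \<open>v\<close> nearly maximize \<open>F\<close> and let \<open>R\<close> be such that \<open>v\<close> vanishes outside the ball of radius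
  \<open>R\<close>. Comparing \<open>F v\<close> with the average of \<open>F (v + \<phi>)\<close> and \<open>F (v - \<phi>)\<close>, the parallelogram law
  computes the gradient terms exactly, and \<open>\<bar>a + b\<bar> + \<bar>a - b\<bar> \<ge> 2 \<bar>a\<bar>\<close> (with value \<open>2 \<bar>b\<bar>\<close> for
  \<open>a = 0\<close>) shows that the \<open>L\<^sup>1\<close> terms gain the mass of \<open>\<phi>\<close> outside the ball. The supremum leaves
  no room for a gain larger than the gradient term \<open>l \<parallel>\<nabla>\<phi>\<parallel>\<^sup>2\<close> and the defect of \<open>v\<close>.\<close>

lemma tightness:
  assumes \<Omega>: "open \<Omega>"
    and K: "\<And>\<phi>. \<phi> \<in> test_functions \<Omega> \<Longrightarrow> (LINT x|lborel. \<bar>\<phi> x\<bar>) \<le> K * sq_norm lborel (gradient \<phi>)"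
    and "0 < \<epsilon>"
  obtains R where "\<And>\<phi>. \<phi> \<in> test_functions \<Omega> \<Longrightarrow> sq_norm lborel (gradient \<phi>) \<le> C \<Longrightarrow>
    (LINT x|lborel. indicator (- cball 0 R) x * \<bar>\<phi> x\<bar>) \<le> \<epsilon>"
proof -
  define G where "G \<phi> = sq_norm lborel (gradient \<phi>)" for \<phi> :: "'a \<Rightarrow> real"
  define l where "l = \<epsilon> / (2 * (C\<^sup>2 + 1))"
  have C1: "0 < C\<^sup>2 + 1" by (simp add: add_nonneg_pos)
  have l: "0 < l" using \<open>0 < \<epsilon>\<close> C1 by (simp add: l_def)
  have "l * (C\<^sup>2 + 1) = \<epsilon> / 2" using C1 unfolding l_def by (simp del: distrib_left_numeral)
  then have lC: "l * C\<^sup>2 \<le> \<epsilon> / 2" using l by (simp add: distrib_left)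
  define F where "F \<phi> = (LINT x|lborel. \<bar>\<phi> x\<bar>) - l * (G \<phi>)\<^sup>2" for \<phi>
  have Fle: "F \<phi> \<le> K\<^sup>2 / (4 * l)" if "\<phi> \<in> test_functions \<Omega>" for \<phi>
  proof -
    \<comment> \<open>Completing the square in \<open>K g - l g\<^sup>2\<close>.\<close>
    have "0 \<le> (K - 2 * l * G \<phi>)\<^sup>2 / (4 * l)" using l by simp
    also have "(K - 2 * l * G \<phi>)\<^sup>2 / (4 * l) = K\<^sup>2 / (4 * l) - K * G \<phi> + l * (G \<phi>)\<^sup>2"
      using l by (simp add: power2_eq_square field_simps)
    finally show ?thesis using K[OF that] by (simp add: F_def G_def)
  qed
  define s where "s = Sup (F ` test_functions \<Omega>)"
  have bdd: "bdd_above (F ` test_functions \<Omega>)"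
    using Fle by (intro bdd_aboveI2)
  have Fs: "F \<phi> \<le> s" if "\<phi> \<in> test_functions \<Omega>" for \<phi>
    unfolding s_def by (intro cSup_upper imageI that bdd)
  have "\<exists>v\<in>test_functions \<Omega>. s - \<epsilon> / 2 < F v"
  proof -
    have "s - \<epsilon> / 2 < Sup (F ` test_functions \<Omega>)" using \<open>0 < \<epsilon>\<close> by (simp add: s_def)
    from less_cSupD[OF _ this] show ?thesis using test_zero by blast
  qed
  then obtain v where v: "v \<in> test_functions \<Omega>" "s - \<epsilon> / 2 < F v" by blast
  obtain S where S: "compact S" "\<And>x. x \<notin> S \<Longrightarrow> v x = 0"
    using test_functionsE[OF v(1)] by metis
  obtain R where R: "\<And>x. x \<in> S \<Longrightarrow> norm x \<le> R"
    using compact_imp_bounded[OF S(1)] by (auto simp: bounded_iff)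
  have vR: "v x = 0" if "x \<notin> cball 0 R" for x
    using that R[of x] S(2)[of x] by (cases "x \<in> S") auto
  have out: "(LINT x|lborel. indicator (- cball 0 R) x * \<bar>\<phi> x\<bar>) \<le> \<epsilon>"
    if \<phi>: "\<phi> \<in> test_functions \<Omega>" and GC: "sq_norm lborel (gradient \<phi>) \<le> C" for \<phi>
  proof -
    let ?o = "\<lambda>x. indicator (- cball 0 R) x * \<bar>\<phi> x\<bar>"
    define p where "p = (\<lambda>x. v x + 1 * \<phi> x)"
    define q where "q = (\<lambda>x. v x + (-1) * \<phi> x)"
    have pT: "p \<in> test_functions \<Omega>" unfolding p_def by (rule test_add_scale[OF v(1) \<phi>])
    have qT: "q \<in> test_functions \<Omega>" unfolding q_def by (rule test_add_scale[OF v(1) \<phi>])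
    have Ga: "(G (\<lambda>x. v x + a * \<phi> x))\<^sup>2 = (G v)\<^sup>2 + 2 * a * sq_inner lborel (gradient v) (gradient \<phi>) + a\<^sup>2 * (G \<phi>)\<^sup>2" for a
    proof -
      have "gradient (\<lambda>x. v x + a * \<phi> x) = (\<lambda>x. gradient v x + a *\<^sub>R gradient \<phi> x)"
        by (rule ext) (intro gradient_add_scale test_differentiable[OF v(1)] test_differentiable[OF \<phi>])
      then show ?thesis
        using sq_norm_expand[OF test_sq_integrable(5)[OF \<Omega> v(1)] test_sq_integrable(5)[OF \<Omega> \<phi>]] by (simp add: G_def)
    qed
    \<comment> \<open>The mixed terms cancel in the sum.\<close>
    have GG: "(G p)\<^sup>2 + (G q)\<^sup>2 = 2 * (G v)\<^sup>2 + 2 * (G \<phi>)\<^sup>2"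
      using Ga[of 1] Ga[of "-1"] by (simp add: p_def q_def)
    have iv: "integrable lborel (\<lambda>x. \<bar>v x\<bar>)" and ip: "integrable lborel (\<lambda>x. \<bar>p x\<bar>)"
      and iq: "integrable lborel (\<lambda>x. \<bar>q x\<bar>)" and i\<phi>: "integrable lborel (\<lambda>x. \<bar>\<phi> x\<bar>)"
      using test_integrable v(1) \<phi> pT qT by (auto intro!: integrable_abs)
    have io: "integrable lborel ?o"
      using integrable_mult_indicator[OF _ i\<phi>, of "- cball 0 R"] by simp
    have "2 * (LINT x|lborel. \<bar>v x\<bar>) + 2 * (LINT x|lborel. ?o x) = (LINT x|lborel. 2 * \<bar>v x\<bar> + 2 * ?o x)"
      using iv io by simp
    also have "\<dots> \<le> (LINT x|lborel. \<bar>p x\<bar> + \<bar>q x\<bar>)"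
    proof (rule integral_mono)
      fix x show "2 * \<bar>v x\<bar> + 2 * ?o x \<le> \<bar>p x\<bar> + \<bar>q x\<bar>"
      proof (cases "x \<in> cball 0 R")
        case True
        then have "?o x = 0" by simp
        then show ?thesis unfolding p_def q_def by linarith
      next
        case False
        then show ?thesis using vR[OF False] by (simp add: p_def q_def)
      qed
    qed (use iv io ip iq in auto)
    also have "\<dots> = (LINT x|lborel. \<bar>p x\<bar>) + (LINT x|lborel. \<bar>q x\<bar>)"
      using ip iq by simp
    also have "\<dots> = F p + F q + l * ((G p)\<^sup>2 + (G q)\<^sup>2)"
      by (simp add: F_def distrib_left)
    also have "\<dots> \<le> 2 * s + l * (2 * (G v)\<^sup>2 + 2 * (G \<phi>)\<^sup>2)"
      using Fs[OF pT] Fs[OF qT] unfolding GG by simp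
    also have "\<dots> \<le> 2 * F v + \<epsilon> + 2 * l * (G v)\<^sup>2 + 2 * (l * (G \<phi>)\<^sup>2)"
      using v(2) by (simp add: distrib_left)
    also have "2 * F v + \<epsilon> + 2 * l * (G v)\<^sup>2 = 2 * (LINT x|lborel. \<bar>v x\<bar>) + \<epsilon>"
      by (simp add: F_def)
    finally have "(LINT x|lborel. ?o x) \<le> \<epsilon> / 2 + l * (G \<phi>)\<^sup>2" by simp
    moreover have "l * (G \<phi>)\<^sup>2 \<le> l * C\<^sup>2"
      using l GC by (intro mult_left_mono power_mono) (auto simp: G_def sq_norm_nonneg)
    ultimately show ?thesis using lC by simp
  qed
  show ?thesis by (rule that[of R]) (rule out)
qed

section \<open>Translations\<close>

text \<open>The Cauchy--Schwarz inequality on the unit interval, obtained from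
  \<open>\<integral> (f - m)\<^sup>2 \<ge> 0\<close> with \<open>m\<close> the mean of \<open>f\<close>.\<close>

lemma square_increment_le:
  fixes F f :: "real \<Rightarrow> real"
  assumes der: "\<And>t. (F has_real_derivative f t) (at t)" and cont: "continuous_on UNIV f"
  shows "ennreal ((F 1 - F 0)\<^sup>2) \<le> (\<integral>\<^sup>+t. ennreal ((f t)\<^sup>2) * indicator {0..1} t \<partial>lborel)"
proof -
  define m where "m = F 1 - F 0"
  let ?I = "\<lambda>t::real. indicator {0..1} t :: real"
  have "has_bochner_integral lborel (\<lambda>t. f t * ?I t) (F 1 - F 0)"
    using cont by (intro has_bochner_integral_FTC_Icc_real der) (auto simp: continuous_on_eq_continuous_at)
  then have i1: "integrable lborel (\<lambda>t. f t * ?I t)" and e1: "(LINT t|lborel. f t * ?I t) = m"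
    by (auto simp: has_bochner_integral_iff m_def)
  have i2: "integrable lborel (\<lambda>t. (f t)\<^sup>2 * ?I t)"
    using borel_integrable_compact[of "{0..1}" "\<lambda>t. (f t)\<^sup>2"] cont
    by (simp add: mult.commute continuous_on_subset continuous_on_power)
  have i3: "integrable lborel ?I" by (intro integrable_real_indicator) auto
  have "0 \<le> (LINT t|lborel. (f t - m)\<^sup>2 * ?I t)" by (intro integral_nonneg_AE) simp
  also have "(\<lambda>t. (f t - m)\<^sup>2 * ?I t) = (\<lambda>t. (f t)\<^sup>2 * ?I t - 2 * m * (f t * ?I t) + m\<^sup>2 * ?I t)"
    by (simp add: fun_eq_iff power2_diff algebra_simps)
  also have "(LINT t|lborel. (f t)\<^sup>2 * ?I t - 2 * m * (f t * ?I t) + m\<^sup>2 * ?I t)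
      = (LINT t|lborel. (f t)\<^sup>2 * ?I t) - 2 * m * m + m\<^sup>2"
    using i1 i2 i3 e1 by simp
  finally have "m\<^sup>2 \<le> (LINT t|lborel. (f t)\<^sup>2 * ?I t)" by (simp add: power2_eq_square)
  then have "ennreal (m\<^sup>2) \<le> ennreal (LINT t|lborel. (f t)\<^sup>2 * ?I t)" by (rule ennreal_leI)
  also have "\<dots> = (\<integral>\<^sup>+t. ennreal ((f t)\<^sup>2 * ?I t) \<partial>lborel)"
    by (intro nn_integral_eq_integral[symmetric] i2) simp
  also have "\<dots> = (\<integral>\<^sup>+t. ennreal ((f t)\<^sup>2) * indicator {0..1} t \<partial>lborel)"
    by (intro nn_integral_cong) (simp split: split_indicator)
  finally show ?thesis by (simp add: m_def)
qed

text \<open>Along each segment the increment is the integral of the directional derivative; integrating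
  over the starting point and exchanging the integrals, translation invariance removes the
  dependence on the position in the segment.\<close>

lemma nn_integral_translate_diff:
  fixes u :: "'a::euclidean_space \<Rightarrow> real"
  assumes \<Omega>: "open \<Omega>" and u: "u \<in> test_functions \<Omega>"
  shows "(\<integral>\<^sup>+x. ennreal ((u (x + z) - u x)\<^sup>2) \<partial>lborel) \<le> ennreal ((norm z * sq_norm lborel (gradient u))\<^sup>2)"
proof -
  define g where "g y = (norm (gradient u y))\<^sup>2" for y
  have g0: "0 \<le> g y" for y by (simp add: g_def)
  have gc: "continuous_on UNIV (gradient u)" by (rule test_gradient_continuous[OF u])
  have gm[measurable]: "g \<in> borel_measurable borel"
    unfolding g_def using borel_measurable_continuous_onI[OF gc] by measurable
  have pw: "ennreal ((u (x + z) - u x)\<^sup>2)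
      \<le> (\<integral>\<^sup>+t. ennreal ((norm z)\<^sup>2 * g (x + t *\<^sub>R z)) * indicator {0..1} t \<partial>lborel)" for x
  proof -
    let ?f = "\<lambda>t. partial_deriv z u (x + t *\<^sub>R z)"
    have f: "?f t = gradient u (x + t *\<^sub>R z) \<bullet> z" for t
      by (rule gradient_inner[OF test_differentiable[OF u], symmetric])
    have "continuous_on UNIV (\<lambda>t. gradient u (x + t *\<^sub>R z))"
      by (rule continuous_on_compose2[OF gc]) (auto intro!: continuous_intros)
    then have fc: "continuous_on UNIV ?f" unfolding f by (intro continuous_intros)
    have "ennreal ((u (x + 1 *\<^sub>R z) - u (x + 0 *\<^sub>R z))\<^sup>2)
        \<le> (\<integral>\<^sup>+t. ennreal ((?f t)\<^sup>2) * indicator {0..1} t \<partial>lborel)"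
      by (rule square_increment_le[OF line_derivative[OF test_differentiable[OF u]] fc])
    also have "\<dots> \<le> (\<integral>\<^sup>+t. ennreal ((norm z)\<^sup>2 * g (x + t *\<^sub>R z)) * indicator {0..1} t \<partial>lborel)"
    proof (intro nn_integral_mono mult_right_mono ennreal_leI)
      fix t
      have "\<bar>?f t\<bar> \<le> norm z * norm (gradient u (x + t *\<^sub>R z))"
        unfolding f using Cauchy_Schwarz_ineq2[of "gradient u (x + t *\<^sub>R z)" z] by (simp add: mult.commute)
      then have "\<bar>?f t\<bar>\<^sup>2 \<le> (norm z * norm (gradient u (x + t *\<^sub>R z)))\<^sup>2"
        by (rule power_mono) simp
      then show "(?f t)\<^sup>2 \<le> (norm z)\<^sup>2 * g (x + t *\<^sub>R z)"
        by (simp add: g_def power_mult_distrib)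
    qed simp
    finally show ?thesis by simp
  qed
  have "(\<integral>\<^sup>+x. ennreal ((u (x + z) - u x)\<^sup>2) \<partial>lborel)
      \<le> (\<integral>\<^sup>+x. (\<integral>\<^sup>+t. ennreal ((norm z)\<^sup>2 * g (x + t *\<^sub>R z)) * indicator {0..1} t \<partial>lborel) \<partial>lborel)"
    by (intro nn_integral_mono pw)
  also have "\<dots> = (\<integral>\<^sup>+t. (\<integral>\<^sup>+x. ennreal ((norm z)\<^sup>2 * g (x + t *\<^sub>R z)) * indicator {0..1} t \<partial>lborel) \<partial>lborel)"
    by (rule lborel_pair.Fubini'[symmetric]) measurable
  also have "\<dots> = (\<integral>\<^sup>+t. ennreal ((norm z * sq_norm lborel (gradient u))\<^sup>2) * indicator {0..1::real} t \<partial>lborel)"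
  proof (intro nn_integral_cong)
    fix t :: real
    have "(\<integral>\<^sup>+x. ennreal ((norm z)\<^sup>2 * g (x + t *\<^sub>R z)) * indicator {0..1} t \<partial>lborel)
        = ennreal ((norm z)\<^sup>2) * (\<integral>\<^sup>+x. ennreal (g (t *\<^sub>R z + x)) \<partial>lborel) * indicator {0..1} t"
      by (subst nn_integral_multc, measurable)
         (subst nn_integral_cmult[symmetric], measurable, simp add: ennreal_mult g0 add.commute)
    also have "(\<integral>\<^sup>+x. ennreal (g (t *\<^sub>R z + x)) \<partial>lborel) = (\<integral>\<^sup>+x. ennreal (g x) \<partial>lborel)"
      by (rule lborel_nn_integral_shift) measurable
    also have "\<dots> = ennreal ((sq_norm lborel (gradient u))\<^sup>2)"
      unfolding g_def by (rule nn_integral_sq_norm[OF test_sq_integrable(5)[OF \<Omega> u]])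
    finally show "(\<integral>\<^sup>+x. ennreal ((norm z)\<^sup>2 * g (x + t *\<^sub>R z)) * indicator {0..1} t \<partial>lborel)
        = ennreal ((norm z * sq_norm lborel (gradient u))\<^sup>2) * indicator {0..1::real} t"
      by (simp add: power_mult_distrib ennreal_mult)
  qed
  also have "\<dots> = ennreal ((norm z * sq_norm lborel (gradient u))\<^sup>2)"
    by (subst nn_integral_cmult_indicator) auto
  finally show ?thesis .
qed

section \<open>Averages over the cells of a grid\<close>

definition cell :: "real \<Rightarrow> 'a::euclidean_space \<Rightarrow> 'a set"
  where "cell h x = {y. \<forall>b\<in>Basis. \<lfloor>y \<bullet> b / h\<rfloor> = \<lfloor>x \<bullet> b / h\<rfloor>}"

definition cell_avg :: "real \<Rightarrow> ('a::euclidean_space \<Rightarrow> real) \<Rightarrow> 'a \<Rightarrow> real"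
  where "cell_avg h u x = (LINT y|lborel. indicator (cell h x) y * u y) / h ^ DIM('a)"

lemma indicator_cell_sym: "indicator (cell h x) y = indicator (cell h y) x"
proof -
  have "y \<in> cell h x \<longleftrightarrow> x \<in> cell h y"
    unfolding cell_def mem_Collect_eq by (rule ball_cong[OF refl]) (rule eq_commute)
  then show ?thesis by (simp add: indicator_def)
qed

lemma cell_eq: "y \<in> cell h x \<Longrightarrow> cell h y = cell h x"
  by (auto simp: cell_def)

text \<open>The cells are half-open cubes; enclosing them between an open and a closed cube of the same
  side determines their measure and provides interior points.\<close>

lemma cell_sandwich:
  fixes x :: "'a::euclidean_space"
  assumes h: "0 < h"
  obtains c where "box c (c + h *\<^sub>R One) \<subseteq> cell h x" "cell h x \<subseteq> cbox c (c + h *\<^sub>R One)"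
proof -
  define c where "c = (\<Sum>b\<in>Basis. (h * real_of_int \<lfloor>x \<bullet> b / h\<rfloor>) *\<^sub>R b)"
  have c: "c \<bullet> b = h * real_of_int \<lfloor>x \<bullet> b / h\<rfloor>" if "b \<in> Basis" for b
    using that by (simp add: c_def)
  have "y \<in> cell h x" if y: "y \<in> box c (c + h *\<^sub>R One)" for y
    unfolding cell_def
  proof (intro CollectI ballI)
    fix b :: 'a assume b: "b \<in> Basis"
    have "h * real_of_int \<lfloor>x \<bullet> b / h\<rfloor> < y \<bullet> b" "y \<bullet> b < h * real_of_int \<lfloor>x \<bullet> b / h\<rfloor> + h"
      using y b by (auto simp: box_def c inner_add_left)
    then have "real_of_int \<lfloor>x \<bullet> b / h\<rfloor> < y \<bullet> b / h" "y \<bullet> b / h < real_of_int \<lfloor>x \<bullet> b / h\<rfloor> + 1"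
      using h by (auto simp: field_simps)
    then show "\<lfloor>y \<bullet> b / h\<rfloor> = \<lfloor>x \<bullet> b / h\<rfloor>"
      by (intro floor_unique) auto
  qed
  moreover have "y \<in> cbox c (c + h *\<^sub>R One)" if y: "y \<in> cell h x" for y
    unfolding mem_box
  proof (intro ballI)
    fix b :: 'a assume b: "b \<in> Basis"
    have "real_of_int \<lfloor>x \<bullet> b / h\<rfloor> \<le> y \<bullet> b / h" "y \<bullet> b / h \<le> real_of_int \<lfloor>x \<bullet> b / h\<rfloor> + 1"
      using y b unfolding cell_def by (smt (verit) mem_Collect_eq of_int_floor_le real_of_int_floor_add_one_ge)+
    then show "c \<bullet> b \<le> y \<bullet> b \<and> y \<bullet> b \<le> (c + h *\<^sub>R One) \<bullet> b"
      using h b by (auto simp: c inner_add_left field_simps)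
  qed
  ultimately show ?thesis by (intro that[of c]) auto
qed

lemma cell_measurable_pair:
  "{p \<in> space (lborel \<Otimes>\<^sub>M lborel). snd p \<in> cell h (fst p)}
    \<in> sets (lborel \<Otimes>\<^sub>M (lborel :: 'a::euclidean_space measure))"
proof -
  let ?P = "lborel \<Otimes>\<^sub>M (lborel :: 'a measure)"
  have "{p \<in> space ?P. \<forall>b\<in>Basis. real_of_int \<lfloor>snd p \<bullet> b / h\<rfloor> = real_of_int \<lfloor>fst p \<bullet> b / h\<rfloor>} \<in> sets ?P"
    by (intro sets.sets_Collect_finite_All measurable_equality_set
        measurable_compose[OF _ borel_measurable_real_floor]) auto
  then show ?thesis by (simp add: cell_def)
qed

lemma indicator_cell_measurable[measurable]:
  "(\<lambda>p. indicator (cell h (fst p)) (snd p) :: real)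
    \<in> borel_measurable (lborel \<Otimes>\<^sub>M (lborel :: 'a::euclidean_space measure))"
proof -
  have "(\<lambda>p. indicator (cell h (fst p)) (snd p) :: real)
      = indicator {p \<in> space (lborel \<Otimes>\<^sub>M lborel). snd p \<in> cell h (fst p)}"
    by (auto simp: fun_eq_iff indicator_def space_pair_measure)
  then show ?thesis
    by (subst (asm) eq_commute) (erule subst, rule borel_measurable_indicator[OF cell_measurable_pair])
qed

lemma cell_borel[measurable]: "cell h (x::'a::euclidean_space) \<in> sets borel"
proof -
  have "{y \<in> space borel. \<forall>b\<in>Basis. real_of_int \<lfloor>y \<bullet> b / h\<rfloor> = real_of_int \<lfloor>x \<bullet> b / h\<rfloor>} \<in> sets borel"
    by measurable
  then show ?thesis by (simp add: cell_def)
qed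

lemma emeasure_cell:
  fixes x :: "'a::euclidean_space"
  assumes h: "0 < h"
  shows "emeasure lborel (cell h x) = ennreal (h ^ DIM('a))"
proof -
  obtain c where c: "box c (c + h *\<^sub>R One) \<subseteq> cell h x" "cell h x \<subseteq> cbox c (c + h *\<^sub>R One)"
    using cell_sandwich[OF h] .
  have le: "\<And>b. b \<in> Basis \<Longrightarrow> c \<bullet> b \<le> (c + h *\<^sub>R One) \<bullet> b"
    using h by (simp add: inner_add_left)
  have p: "(\<Prod>b\<in>Basis. ((c + h *\<^sub>R One) - c) \<bullet> b) = h ^ DIM('a)"
    by simp
  have "emeasure lborel (box c (c + h *\<^sub>R One)) = ennreal (h ^ DIM('a))"
    "emeasure lborel (cbox c (c + h *\<^sub>R One)) = ennreal (h ^ DIM('a))"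
    using emeasure_lborel_box[OF le] emeasure_lborel_cbox[OF le] unfolding p by auto
  then show ?thesis
    using emeasure_mono[OF c(1), of lborel] emeasure_mono[OF c(2), of lborel] by simp
qed

lemma cell_integrable: "0 < h \<Longrightarrow> integrable lborel (indicator (cell h (x::'a::euclidean_space)) :: _ \<Rightarrow> real)"
  by (intro integrable_real_indicator) (auto simp: emeasure_cell)

lemma measure_cell: "0 < h \<Longrightarrow> measure lborel (cell h (x::'a::euclidean_space)) = h ^ DIM('a)"
  by (simp add: measure_def emeasure_cell)

lemma cell_diff:
  fixes x y :: "'a::euclidean_space"
  assumes h: "0 < h" and y: "y \<in> cell h x"
  shows "y - x \<in> cbox (- h *\<^sub>R One) (h *\<^sub>R One)"
proof -
  obtain c where c: "cell h x \<subseteq> cbox c (c + h *\<^sub>R One)"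
    using cell_sandwich[OF h] .
  have "x \<in> cell h x" by (simp add: cell_def)
  then have xy: "x \<in> cbox c (c + h *\<^sub>R One)" "y \<in> cbox c (c + h *\<^sub>R One)" using c y by auto
  show ?thesis
    unfolding mem_box
  proof (intro ballI)
    fix b :: 'a assume b: "b \<in> Basis"
    then have "c \<bullet> b \<le> x \<bullet> b" "x \<bullet> b \<le> c \<bullet> b + h" "c \<bullet> b \<le> y \<bullet> b" "y \<bullet> b \<le> c \<bullet> b + h"
      using xy by (auto simp: mem_box inner_add_left)
    then show "(- h *\<^sub>R One) \<bullet> b \<le> (y - x) \<bullet> b \<and> (y - x) \<bullet> b \<le> (h *\<^sub>R One) \<bullet> b"
      using b by (simp add: inner_diff_left)
  qed
qed

lemma norm_in_cube:
  fixes z :: "'a::euclidean_space" and h :: real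
  assumes "z \<in> cbox (- h *\<^sub>R One) (h *\<^sub>R One)"
  shows "norm z \<le> DIM('a) * h"
proof -
  have "norm z \<le> (\<Sum>b\<in>Basis. \<bar>z \<bullet> b\<bar>)" by (rule norm_le_l1)
  also have "\<dots> \<le> (\<Sum>b\<in>(Basis::'a set). h)"
  proof (rule sum_mono)
    fix b :: 'a assume "b \<in> Basis"
    then show "\<bar>z \<bullet> b\<bar> \<le> h" using assms by (force simp: mem_box abs_le_iff)
  qed
  finally show ?thesis by simp
qed

lemma emeasure_cube:
  assumes "0 < h"
  shows "emeasure lborel (cbox (- h *\<^sub>R One) (h *\<^sub>R One :: 'a::euclidean_space)) = ennreal ((2 * h) ^ DIM('a))"
proof -
  have le: "\<And>b::'a. b \<in> Basis \<Longrightarrow> (- h *\<^sub>R One) \<bullet> b \<le> (h *\<^sub>R One) \<bullet> b"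
    using assms by simp
  have "(\<Prod>b\<in>(Basis::'a set). (h *\<^sub>R One - (- h *\<^sub>R One)) \<bullet> b) = (\<Prod>b\<in>(Basis::'a set). 2 * h)"
    by (intro prod.cong) (auto simp: inner_diff_left inner_add_left)
  then show ?thesis using emeasure_lborel_cbox[OF le] by simp
qed

text \<open>The average \<open>a\<close> minimizes the mean square deviation over the cell, so
  \<open>\<integral> (c - u)\<^sup>2 = h\<^sup>N (c - a)\<^sup>2 + \<integral> (a - u)\<^sup>2\<close> over the cell. The constant \<open>c\<close> is taken to be \<open>0\<close> for
  the uniform bound and \<open>u x\<close> for the approximation error.\<close>

lemma cell_avg_square:
  fixes u :: "'a::euclidean_space \<Rightarrow> real"
  assumes h: "0 < h" and u: "integrable lborel u" "integrable lborel (\<lambda>y. (u y)\<^sup>2)"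
  shows "h ^ DIM('a) * (c - cell_avg h u x)\<^sup>2 \<le> (LINT y|lborel. indicator (cell h x) y * (c - u y)\<^sup>2)"
    and "integrable lborel (\<lambda>y. indicator (cell h x) y * (c - u y)\<^sup>2)"
proof -
  let ?I = "\<lambda>y. indicator (cell h x) y :: real"
  let ?n = "h ^ DIM('a)"
  define a where "a = cell_avg h u x"
  have n: "0 < ?n" using h by simp
  have i0: "integrable lborel ?I" by (rule cell_integrable[OF h])
  have i1: "integrable lborel (\<lambda>y. ?I y * u y)"
    using integrable_mult_indicator[OF _ u(1), of "cell h x"] by simp
  have i2: "integrable lborel (\<lambda>y. ?I y * (u y)\<^sup>2)"
    using integrable_mult_indicator[OF _ u(2), of "cell h x"] by simp
  have e0: "(LINT y|lborel. ?I y) = ?n" using measure_cell[OF h, of x] by simp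
  have e1: "(LINT y|lborel. ?I y * u y) = ?n * a" using h n by (simp add: a_def cell_avg_def)
  have eq: "?I y * (c - u y)\<^sup>2 = c\<^sup>2 * ?I y - 2 * c * (?I y * u y) + ?I y * (u y)\<^sup>2" for c y
    by (simp add: power2_diff algebra_simps)
  have int: "integrable lborel (\<lambda>y. ?I y * (c - u y)\<^sup>2)" for c
    unfolding eq using i0 i1 i2 by simp
  have val: "(LINT y|lborel. ?I y * (c - u y)\<^sup>2) = c\<^sup>2 * ?n - 2 * c * (?n * a) + (LINT y|lborel. ?I y * (u y)\<^sup>2)" for c
    unfolding eq using i0 i1 i2 e0 e1 by simp
  have "0 \<le> (LINT y|lborel. ?I y * (a - u y)\<^sup>2)" by (intro integral_nonneg_AE) simp
  then have "?n * a\<^sup>2 \<le> (LINT y|lborel. ?I y * (u y)\<^sup>2)"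
    unfolding val by (simp add: power2_eq_square algebra_simps)
  then show "?n * (c - cell_avg h u x)\<^sup>2 \<le> (LINT y|lborel. ?I y * (c - u y)\<^sup>2)"
    unfolding val a_def[symmetric] by (simp add: power2_diff algebra_simps)
  show "integrable lborel (\<lambda>y. ?I y * (c - u y)\<^sup>2)" by (rule int)
qed

lemma cell_avg_bound:
  fixes u :: "'a::euclidean_space \<Rightarrow> real"
  assumes h: "0 < h" and u: "integrable lborel u" "u \<in> sq_integrable lborel"
  shows "sqrt (h ^ DIM('a)) * \<bar>cell_avg h u x\<bar> \<le> sq_norm lborel u"
proof (rule power2_le_imp_le)
  have u2: "integrable lborel (\<lambda>y. (u y)\<^sup>2)" using sq_integrable_norm2[OF u(2)] by simp
  have "(sqrt (h ^ DIM('a)) * \<bar>cell_avg h u x\<bar>)\<^sup>2 = h ^ DIM('a) * (0 - cell_avg h u x)\<^sup>2"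
    using h by (simp add: power_mult_distrib)
  also have "\<dots> \<le> (LINT y|lborel. indicator (cell h x) y * (0 - u y)\<^sup>2)"
    by (rule cell_avg_square(1)[OF h u(1) u2])
  also have "\<dots> \<le> (LINT y|lborel. (u y)\<^sup>2)"
    using cell_avg_square(2)[OF h u(1) u2, of x 0] u2
    by (intro integral_mono) (auto simp: indicator_def)
  also have "\<dots> = (sq_norm lborel u)\<^sup>2" by (simp add: sq_norm_power2)
  finally show "(sqrt (h ^ DIM('a)) * \<bar>cell_avg h u x\<bar>)\<^sup>2 \<le> (sq_norm lborel u)\<^sup>2" .
qed (rule sq_norm_nonneg)

lemma cell_avg_measurable:
  fixes u :: "'a::euclidean_space \<Rightarrow> real"
  assumes u[measurable]: "u \<in> borel_measurable borel"
  shows "cell_avg h u \<in> borel_measurable borel"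
proof -
  have [measurable]: "u \<in> borel_measurable lborel" by simp
  have "(\<lambda>p. indicator (cell h (fst p)) (snd p) * u (snd p))
      \<in> borel_measurable (lborel \<Otimes>\<^sub>M (lborel :: 'a measure))"
    by measurable
  then have "(\<lambda>(x, y). indicator (cell h x) y * u y) \<in> borel_measurable (lborel \<Otimes>\<^sub>M (lborel :: 'a measure))"
    by (simp add: case_prod_unfold)
  then have "(\<lambda>x. LINT y|lborel. indicator (cell h x) y * u y) \<in> borel_measurable lborel"
    by (rule lborel.borel_measurable_lebesgue_integral)
  then show ?thesis unfolding cell_avg_def[abs_def] by simp
qed

text \<open>A Poincare inequality on all cells at once. Points of a common cell differ by a vector \<open>z\<close>
  in the cube of side \<open>2 h\<close>, so the deviation from the average is controlled by the integral of
  \<open>\<parallel>u(\<cdot> + z) - u\<parallel>\<^sup>2 \<le> \<bar>z\<bar>\<^sup>2 \<parallel>\<nabla>u\<parallel>\<^sup>2\<close> over this cube. The factor \<open>2\<^sup>N\<close> is the ratio of the volumes of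
  the cube and a cell.\<close>

lemma cell_avg_approx:
  fixes u :: "'a::euclidean_space \<Rightarrow> real"
  assumes \<Omega>: "open \<Omega>" and h: "0 < h" and u: "u \<in> test_functions \<Omega>"
  shows "cell_avg h u \<in> sq_integrable lborel"
    and "sq_norm lborel (\<lambda>x. u x - cell_avg h u x) \<le> sqrt (2 ^ DIM('a)) * DIM('a) * h * sq_norm lborel (gradient u)"
proof -
  let ?n = "h ^ DIM('a)"
  let ?G = "sq_norm lborel (gradient u)"
  let ?C = "cbox (- h *\<^sub>R One) (h *\<^sub>R One) :: 'a set"
  define q where "q = sqrt (2 ^ DIM('a)) * DIM('a) * h * ?G"
  have q: "0 \<le> q" using h by (simp add: q_def sq_norm_nonneg)
  have n: "0 < ?n" using h by simp
  have um[measurable]: "u \<in> borel_measurable borel"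
    using test_continuous[OF u] by (rule borel_measurable_continuous_onI)
  note am[measurable] = cell_avg_measurable[OF um, of h]
  have u2: "integrable lborel (\<lambda>y. (u y)\<^sup>2)" using sq_integrable_norm2[OF test_sq_integrable(2)[OF \<Omega> u]] by simp
  note sq = cell_avg_square[OF h test_integrable[OF u] u2]
  have "ennreal ?n * (\<integral>\<^sup>+x. ennreal ((u x - cell_avg h u x)\<^sup>2) \<partial>lborel)
      = (\<integral>\<^sup>+x. ennreal (?n * (u x - cell_avg h u x)\<^sup>2) \<partial>lborel)"
    using n by (subst nn_integral_cmult[symmetric]) (auto simp: ennreal_mult)
  also have "\<dots> \<le> (\<integral>\<^sup>+x. (\<integral>\<^sup>+y. indicator ?C (y - x) * ennreal ((u y - u x)\<^sup>2) \<partial>lborel) \<partial>lborel)"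
  proof (rule nn_integral_mono)
    fix x
    have "ennreal (?n * (u x - cell_avg h u x)\<^sup>2) \<le> ennreal (LINT y|lborel. indicator (cell h x) y * (u x - u y)\<^sup>2)"
      by (intro ennreal_leI sq)
    also have "\<dots> = (\<integral>\<^sup>+y. ennreal (indicator (cell h x) y * (u x - u y)\<^sup>2) \<partial>lborel)"
      by (intro nn_integral_eq_integral[symmetric] sq) simp
    also have "\<dots> \<le> (\<integral>\<^sup>+y. indicator ?C (y - x) * ennreal ((u y - u x)\<^sup>2) \<partial>lborel)"
    proof (rule nn_integral_mono)
      fix y
      show "ennreal (indicator (cell h x) y * (u x - u y)\<^sup>2) \<le> indicator ?C (y - x) * ennreal ((u y - u x)\<^sup>2)"
        using cell_diff[OF h, of y x] by (cases "y \<in> cell h x") (auto simp: power2_commute)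
    qed
    finally show "ennreal (?n * (u x - cell_avg h u x)\<^sup>2)
        \<le> (\<integral>\<^sup>+y. indicator ?C (y - x) * ennreal ((u y - u x)\<^sup>2) \<partial>lborel)" .
  qed
  also have "\<dots> = (\<integral>\<^sup>+x. (\<integral>\<^sup>+z. indicator ?C z * ennreal ((u (x + z) - u x)\<^sup>2) \<partial>lborel) \<partial>lborel)"
  proof (rule nn_integral_cong)
    fix x
    have "(\<integral>\<^sup>+z. indicator ?C ((x + z) - x) * ennreal ((u (x + z) - u x)\<^sup>2) \<partial>lborel)
        = (\<integral>\<^sup>+y. indicator ?C (y - x) * ennreal ((u y - u x)\<^sup>2) \<partial>lborel)"
      by (rule lborel_nn_integral_shift[where f="\<lambda>y. indicator ?C (y - x) * ennreal ((u y - u x)\<^sup>2)"]) measurable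
    then show "(\<integral>\<^sup>+y. indicator ?C (y - x) * ennreal ((u y - u x)\<^sup>2) \<partial>lborel)
        = (\<integral>\<^sup>+z. indicator ?C z * ennreal ((u (x + z) - u x)\<^sup>2) \<partial>lborel)" by simp
  qed
  also have "\<dots> = (\<integral>\<^sup>+z. (\<integral>\<^sup>+x. indicator ?C z * ennreal ((u (x + z) - u x)\<^sup>2) \<partial>lborel) \<partial>lborel)"
    by (rule lborel_pair.Fubini'[symmetric]) measurable
  also have "\<dots> = (\<integral>\<^sup>+z. indicator ?C z * (\<integral>\<^sup>+x. ennreal ((u (x + z) - u x)\<^sup>2) \<partial>lborel) \<partial>lborel)"
    by (intro nn_integral_cong nn_integral_cmult) measurable
  also have "\<dots> \<le> (\<integral>\<^sup>+z. ennreal ((DIM('a) * h * ?G)\<^sup>2) * indicator ?C z \<partial>lborel)"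
  proof (rule nn_integral_mono)
    fix z :: 'a
    have "(\<integral>\<^sup>+x. ennreal ((u (x + z) - u x)\<^sup>2) \<partial>lborel) \<le> ennreal ((DIM('a) * h * ?G)\<^sup>2)" if "z \<in> ?C"
    proof -
      have "(\<integral>\<^sup>+x. ennreal ((u (x + z) - u x)\<^sup>2) \<partial>lborel) \<le> ennreal ((norm z * ?G)\<^sup>2)"
        by (rule nn_integral_translate_diff[OF \<Omega> u])
      also have "\<dots> \<le> ennreal ((DIM('a) * h * ?G)\<^sup>2)"
        using norm_in_cube[OF that] by (intro ennreal_leI power_mono mult_right_mono) (auto simp: sq_norm_nonneg)
      finally show ?thesis .
    qed
    then show "indicator ?C z * (\<integral>\<^sup>+x. ennreal ((u (x + z) - u x)\<^sup>2) \<partial>lborel)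
        \<le> ennreal ((DIM('a) * h * ?G)\<^sup>2) * indicator ?C z"
      by (cases "z \<in> ?C") auto
  qed
  also have "\<dots> = ennreal ((DIM('a) * h * ?G)\<^sup>2) * ennreal ((2 * h) ^ DIM('a))"
  proof -
    have "?C \<in> sets lborel" by simp
    then show ?thesis by (simp only: nn_integral_cmult_indicator emeasure_cube[OF h])
  qed
  also have "\<dots> = ennreal (?n * q\<^sup>2)"
    by (subst ennreal_mult[symmetric]) (use h in \<open>auto simp: q_def power_mult_distrib mult_ac\<close>)
  also have "\<dots> = ennreal ?n * ennreal (q\<^sup>2)"
    using n by (intro ennreal_mult) auto
  finally have main: "(\<integral>\<^sup>+x. ennreal ((u x - cell_avg h u x)\<^sup>2) \<partial>lborel) \<le> ennreal (q\<^sup>2)"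
    using n h by (subst (asm) ennreal_mult_le_mult_iff) auto
  have d: "(\<lambda>x. u x - cell_avg h u x) \<in> sq_integrable lborel"
  proof (rule sq_integrableI)
    show "integrable lborel (\<lambda>x. (norm (u x - cell_avg h u x))\<^sup>2)"
      using main by (intro integrableI_bounded) (auto simp: less_top[symmetric] top_unique)
  qed simp
  show "cell_avg h u \<in> sq_integrable lborel"
    using sq_integrable_diff[OF test_sq_integrable(2)[OF \<Omega> u] d] by simp
  have "(sq_norm lborel (\<lambda>x. u x - cell_avg h u x))\<^sup>2 \<le> q\<^sup>2"
    using main nn_integral_sq_norm[OF d] by simp
  then have "sq_norm lborel (\<lambda>x. u x - cell_avg h u x) \<le> q"
    by (rule power2_le_imp_le) (rule q)
  then show "sq_norm lborel (\<lambda>x. u x - cell_avg h u x) \<le> sqrt (2 ^ DIM('a)) * DIM('a) * h * ?G"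
    unfolding q_def .
qed

text \<open>Averaging does not increase the \<open>L\<^sup>1\<close> norm and moves mass by at most the diameter of a cell,
  for which \<open>N h\<close> is an upper bound.\<close>

lemma cell_avg_outside:
  fixes u :: "'a::euclidean_space \<Rightarrow> real" and h :: real
  assumes h: "0 < h" and u: "integrable lborel u" and um[measurable]: "u \<in> borel_measurable borel"
  shows "(\<integral>\<^sup>+x. indicator (- cball 0 (R + DIM('a) * h)) x * ennreal \<bar>cell_avg h u x\<bar> \<partial>lborel)
    \<le> ennreal (LINT y|lborel. indicator (- cball 0 R) y * \<bar>u y\<bar>)"
proof -
  let ?n = "h ^ DIM('a)"
  let ?O = "- cball 0 R :: 'a set" and ?O' = "- cball 0 (R + DIM('a) * h) :: 'a set"
  have n: "0 < ?n" using h by simp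
  note am[measurable] = cell_avg_measurable[OF um, of h]
  have [measurable]: "(\<lambda>p. indicator (cell h (fst p)) (snd p) :: ennreal)
    \<in> borel_measurable (lborel \<Otimes>\<^sub>M (lborel :: 'a measure))"
    using measurable_compose[OF indicator_cell_measurable[of h] measurable_ennreal]
    by (simp add: ennreal_indicator)
  have [measurable]: "u \<in> borel_measurable lborel" by simp
  have pw: "indicator ?O' x * ennreal (?n * \<bar>cell_avg h u x\<bar>)
      \<le> (\<integral>\<^sup>+y. indicator (cell h x) y * (indicator ?O y * ennreal \<bar>u y\<bar>) \<partial>lborel)" for x
  proof (cases "x \<in> ?O'")
    case True
    have i: "integrable lborel (\<lambda>y. indicator (cell h x) y * u y)"
      using integrable_mult_indicator[OF _ u, of "cell h x"] by simp
    have "?n * \<bar>cell_avg h u x\<bar> = \<bar>LINT y|lborel. indicator (cell h x) y * u y\<bar>"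
      using n h by (simp add: cell_avg_def abs_divide)
    also have "ennreal \<dots> \<le> (\<integral>\<^sup>+y. ennreal (norm (indicator (cell h x) y * u y)) \<partial>lborel)"
      using integral_norm_bound_ennreal[OF i] by simp
    also have "\<dots> \<le> (\<integral>\<^sup>+y. indicator (cell h x) y * (indicator ?O y * ennreal \<bar>u y\<bar>) \<partial>lborel)"
    proof (rule nn_integral_mono)
      fix y
      have "y \<in> ?O" if y: "y \<in> cell h x"
      proof -
        have "norm (y - x) \<le> DIM('a) * h" by (rule norm_in_cube[OF cell_diff[OF h y]])
        moreover have "norm x \<le> norm y + norm (y - x)"
          using norm_triangle_ineq4[of y "y - x"] by simp
        ultimately show ?thesis using True by simp
      qed
      then show "ennreal (norm (indicator (cell h x) y * u y))
          \<le> indicator (cell h x) y * (indicator ?O y * ennreal \<bar>u y\<bar>)"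
        by (cases "y \<in> cell h x") auto
    qed
    finally show ?thesis using True by simp
  qed simp
  have "ennreal ?n * (\<integral>\<^sup>+x. indicator ?O' x * ennreal \<bar>cell_avg h u x\<bar> \<partial>lborel)
      = (\<integral>\<^sup>+x. indicator ?O' x * ennreal (?n * \<bar>cell_avg h u x\<bar>) \<partial>lborel)"
    using n by (subst nn_integral_cmult[symmetric]) (auto simp: ennreal_mult mult_ac)
  also have "\<dots> \<le> (\<integral>\<^sup>+x. (\<integral>\<^sup>+y. indicator (cell h x) y * (indicator ?O y * ennreal \<bar>u y\<bar>) \<partial>lborel) \<partial>lborel)"
    by (intro nn_integral_mono pw)
  also have "\<dots> = (\<integral>\<^sup>+y. (\<integral>\<^sup>+x. indicator (cell h x) y * (indicator ?O y * ennreal \<bar>u y\<bar>) \<partial>lborel) \<partial>lborel)"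
    by (rule lborel_pair.Fubini'[symmetric]) (simp add: case_prod_unfold)
  also have "\<dots> = (\<integral>\<^sup>+y. ennreal ?n * (indicator ?O y * ennreal \<bar>u y\<bar>) \<partial>lborel)"
  proof (rule nn_integral_cong)
    fix y
    have "(\<integral>\<^sup>+x. indicator (cell h x) y * (indicator ?O y * ennreal \<bar>u y\<bar>) \<partial>lborel)
        = (\<integral>\<^sup>+x. (indicator ?O y * ennreal \<bar>u y\<bar>) * indicator (cell h y) x \<partial>lborel)"
      unfolding indicator_cell_sym[of h _ y] by (simp add: mult.commute)
    also have "\<dots> = (indicator ?O y * ennreal \<bar>u y\<bar>) * ennreal ?n"
      by (subst nn_integral_cmult_indicator) (auto simp: emeasure_cell[OF h])
    finally show "(\<integral>\<^sup>+x. indicator (cell h x) y * (indicator ?O y * ennreal \<bar>u y\<bar>) \<partial>lborel)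
        = ennreal ?n * (indicator ?O y * ennreal \<bar>u y\<bar>)" by (simp add: mult.commute)
  qed
  also have "\<dots> = ennreal ?n * (\<integral>\<^sup>+y. indicator ?O y * ennreal \<bar>u y\<bar> \<partial>lborel)"
    by (rule nn_integral_cmult) simp
  also have "(\<integral>\<^sup>+y. indicator ?O y * ennreal \<bar>u y\<bar> \<partial>lborel) = (\<integral>\<^sup>+y. ennreal (indicator ?O y * \<bar>u y\<bar>) \<partial>lborel)"
    by (intro nn_integral_cong) (simp split: split_indicator)
  also have "\<dots> = ennreal (LINT y|lborel. indicator ?O y * \<bar>u y\<bar>)"
    using integrable_mult_indicator[OF _ integrable_abs[OF u], of ?O]
    by (intro nn_integral_eq_integral) auto
  finally show ?thesis
    using n h by (subst (asm) ennreal_mult_le_mult_iff) auto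
qed

section \<open>Compactness\<close>

lemma bounded_convergence_Cauchy:
  fixes f :: "nat \<Rightarrow> 'x \<Rightarrow> real"
  assumes B: "B \<in> sets M" "emeasure M B < \<infinity>"
    and m[measurable]: "\<And>n. f n \<in> borel_measurable M"
    and bd: "\<And>n x. \<bar>f n x\<bar> \<le> C" and conv: "\<And>x. convergent (\<lambda>n. f n x)" and "0 < e"
  shows "\<exists>N. \<forall>m\<ge>N. \<forall>n\<ge>N. (LINT x|M. indicator B x * (f m x - f n x)\<^sup>2) < e"
proof -
  note [measurable] = B(1)
  define a where "a x = lim (\<lambda>n. f n x)" for x
  have lim: "(\<lambda>n. f n x) \<longlonglongrightarrow> a x" for x
    using conv[of x] unfolding a_def by (simp add: convergent_LIMSEQ_iff)
  have am[measurable]: "a \<in> borel_measurable M" unfolding a_def by measurable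
  have abd: "\<bar>a x\<bar> \<le> C" for x
    by (rule LIMSEQ_le_const2[OF tendsto_rabs[OF lim]]) (auto intro: bd)
  have Bi: "integrable M (\<lambda>x. indicator B x :: real)"
    using B by (intro integrable_real_indicator) auto
  have sq: "(y - z)\<^sup>2 \<le> 4 * C\<^sup>2" if "\<bar>y\<bar> \<le> C" "\<bar>z\<bar> \<le> C" for y z :: real
  proof -
    have "\<bar>y - z\<bar> \<le> 2 * C" using that by linarith
    then have "\<bar>y - z\<bar>\<^sup>2 \<le> (2 * C)\<^sup>2" by (rule power_mono) simp
    then show ?thesis by (simp add: power_mult_distrib)
  qed
  have int: "integrable M (\<lambda>x. indicator B x * (g x - k x)\<^sup>2)"
    if [measurable]: "g \<in> borel_measurable M" "k \<in> borel_measurable M"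
      and "\<And>x. \<bar>g x\<bar> \<le> C" "\<And>x. \<bar>k x\<bar> \<le> C" for g k
  proof (rule Bochner_Integration.integrable_bound)
    show "integrable M (\<lambda>x. 4 * C\<^sup>2 * indicator B x)" using Bi by simp
    show "AE x in M. norm (indicator B x * (g x - k x)\<^sup>2) \<le> norm (4 * C\<^sup>2 * indicator B x)"
      using sq[OF that(3,4)] by (intro AE_I2) (simp add: indicator_def)
  qed simp
  have "(\<lambda>n. LINT x|M. indicator B x * (f n x - a x)\<^sup>2) \<longlonglongrightarrow> (LINT x|M. 0)"
  proof (rule integral_dominated_convergence[where w="\<lambda>x. 4 * C\<^sup>2 * indicator B x"])
    show "integrable M (\<lambda>x. 4 * C\<^sup>2 * indicator B x)" using Bi by simp
    show "AE x in M. norm (indicator B x * (f n x - a x)\<^sup>2) \<le> 4 * C\<^sup>2 * indicator B x" for n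
      using sq[OF bd abd] by (intro AE_I2) (simp add: indicator_def)
    have "(\<lambda>n. indicator B x * (f n x - a x)\<^sup>2) \<longlonglongrightarrow> indicator B x * (a x - a x)\<^sup>2" for x
      by (intro tendsto_intros lim)
    then show "AE x in M. (\<lambda>n. indicator B x * (f n x - a x)\<^sup>2) \<longlonglongrightarrow> 0" by simp
  qed auto
  then have "(\<lambda>n. LINT x|M. indicator B x * (f n x - a x)\<^sup>2) \<longlonglongrightarrow> 0" by simp
  then have "\<forall>\<^sub>F n in sequentially. (LINT x|M. indicator B x * (f n x - a x)\<^sup>2) < e / 4"
    using \<open>0 < e\<close> by (intro order_tendstoD(2)) auto
  then obtain N where N: "\<And>n. n \<ge> N \<Longrightarrow> (LINT x|M. indicator B x * (f n x - a x)\<^sup>2) < e / 4"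
    unfolding eventually_sequentially by blast
  have "(LINT x|M. indicator B x * (f m x - f n x)\<^sup>2) < e" if "m \<ge> N" "n \<ge> N" for m n
  proof -
    have "(LINT x|M. indicator B x * (f m x - f n x)\<^sup>2)
        \<le> (LINT x|M. 2 * (indicator B x * (f m x - a x)\<^sup>2) + 2 * (indicator B x * (f n x - a x)\<^sup>2))"
    proof (rule integral_mono)
      fix x
      have "0 \<le> ((f m x - a x) + (f n x - a x))\<^sup>2" by simp
      then have "(f m x - f n x)\<^sup>2 \<le> 2 * (f m x - a x)\<^sup>2 + 2 * (f n x - a x)\<^sup>2"
        by (simp add: power2_eq_square algebra_simps)
      then show "indicator B x * (f m x - f n x)\<^sup>2
          \<le> 2 * (indicator B x * (f m x - a x)\<^sup>2) + 2 * (indicator B x * (f n x - a x)\<^sup>2)"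
        by (simp add: indicator_def)
    qed (intro Bochner_Integration.integrable_add integrable_mult_right int m am bd abd)+
    also have "\<dots> = 2 * (LINT x|M. indicator B x * (f m x - a x)\<^sup>2) + 2 * (LINT x|M. indicator B x * (f n x - a x)\<^sup>2)"
      using int[OF m am bd abd] by simp
    also have "\<dots> < e" using N[OF that(1)] N[OF that(2)] by simp
    finally show ?thesis .
  qed
  then show ?thesis by blast
qed

text \<open>Outside the ball the square is bounded by the supremum times the absolute value; this is how
  smallness in \<open>L\<^sup>1\<close> becomes smallness in \<open>L\<^sup>2\<close>.\<close>

lemma sq_norm_split:
  fixes a :: "'a::euclidean_space \<Rightarrow> real"
  assumes a: "a \<in> sq_integrable lborel" and M: "\<And>x. \<bar>a x\<bar> \<le> M"
    and out: "(\<integral>\<^sup>+x. indicator (- cball 0 R) x * ennreal \<bar>a x\<bar> \<partial>lborel) \<le> ennreal \<delta>" and "0 \<le> \<delta>"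
  shows "(sq_norm lborel a)\<^sup>2 \<le> (LINT x|lborel. indicator (cball 0 R) x * (a x)\<^sup>2) + M * \<delta>"
proof -
  let ?B = "cball 0 R :: 'a set"
  have am[measurable]: "a \<in> borel_measurable borel" using sq_integrable_measurable[OF a] by simp
  have M0: "0 \<le> M" using M[of 0] by linarith
  have i: "integrable lborel (\<lambda>x. (a x)\<^sup>2)" using sq_integrable_norm2[OF a] by simp
  have iB: "integrable lborel (\<lambda>x. indicator ?B x * (a x)\<^sup>2)"
    using integrable_mult_indicator[OF _ i, of ?B] by simp
  have iO: "integrable lborel (\<lambda>x. indicator (- ?B) x * (a x)\<^sup>2)"
    using integrable_mult_indicator[OF _ i, of "- ?B"] by simp
  have "ennreal (LINT x|lborel. indicator (- ?B) x * (a x)\<^sup>2) = (\<integral>\<^sup>+x. ennreal (indicator (- ?B) x * (a x)\<^sup>2) \<partial>lborel)"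
    by (intro nn_integral_eq_integral[symmetric] iO) simp
  also have "\<dots> \<le> (\<integral>\<^sup>+x. ennreal M * (indicator (- ?B) x * ennreal \<bar>a x\<bar>) \<partial>lborel)"
  proof (rule nn_integral_mono)
    fix x
    have "(a x)\<^sup>2 \<le> M * \<bar>a x\<bar>"
      using mult_right_mono[OF M[of x], of "\<bar>a x\<bar>"] by (simp add: power2_eq_square)
    then have "ennreal ((a x)\<^sup>2) \<le> ennreal M * ennreal \<bar>a x\<bar>"
      using M0 by (subst ennreal_mult[symmetric]) (auto intro: ennreal_leI)
    then show "ennreal (indicator (- ?B) x * (a x)\<^sup>2) \<le> ennreal M * (indicator (- ?B) x * ennreal \<bar>a x\<bar>)"
      by (cases "x \<in> ?B") auto
  qed
  also have "\<dots> = ennreal M * (\<integral>\<^sup>+x. indicator (- ?B) x * ennreal \<bar>a x\<bar> \<partial>lborel)"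
    by (rule nn_integral_cmult) measurable
  also have "\<dots> \<le> ennreal M * ennreal \<delta>" by (intro mult_left_mono out) simp
  also have "\<dots> = ennreal (M * \<delta>)" by (rule ennreal_mult[symmetric, OF M0 \<open>0 \<le> \<delta>\<close>])
  finally have o: "(LINT x|lborel. indicator (- ?B) x * (a x)\<^sup>2) \<le> M * \<delta>"
    using M0 \<open>0 \<le> \<delta>\<close> by (subst (asm) ennreal_le_iff) auto
  have "(sq_norm lborel a)\<^sup>2 = (LINT x|lborel. indicator ?B x * (a x)\<^sup>2 + indicator (- ?B) x * (a x)\<^sup>2)"
    unfolding sq_norm_power2 by (intro Bochner_Integration.integral_cong) (auto simp: indicator_def)
  also have "\<dots> = (LINT x|lborel. indicator ?B x * (a x)\<^sup>2) + (LINT x|lborel. indicator (- ?B) x * (a x)\<^sup>2)"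
    by (rule Bochner_Integration.integral_add[OF iB iO])
  finally show ?thesis using o by simp
qed

lemma cell_avg_diff:
  fixes u v :: "'a::euclidean_space \<Rightarrow> real"
  assumes "integrable lborel u" "integrable lborel v"
  shows "cell_avg h (\<lambda>x. u x - v x) x = cell_avg h u x - cell_avg h v x"
proof -
  have "integrable lborel (\<lambda>y. indicator (cell h x) y * u y)" "integrable lborel (\<lambda>y. indicator (cell h x) y * v y)"
    using integrable_mult_indicator[OF _ assms(1), of "cell h x"]
      integrable_mult_indicator[OF _ assms(2), of "cell h x"] by simp_all
  then show ?thesis
    by (simp add: cell_avg_def right_diff_distrib diff_divide_distrib)
qed

text \<open>A countable dense set meets every cell of every grid, so a diagonal argument over its points
  suffices. The factor \<open>\<surd>(h\<^sup>N)\<close> makes the bound on the averages independent of the mesh, as the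
  diagonal argument demands a common bound.\<close>

lemma cell_avg_convergent_subsequence:
  fixes u :: "nat \<Rightarrow> 'a::euclidean_space \<Rightarrow> real"
  assumes u: "\<And>n. integrable lborel (u n)" "\<And>n. u n \<in> sq_integrable lborel" "\<And>n. sq_norm lborel (u n) \<le> C"
    and h: "\<And>k. 0 < h k"
  obtains r :: "nat \<Rightarrow> nat" where "strict_mono r"
    "\<And>k x. convergent (\<lambda>n. cell_avg (h (k::nat)) (u (r n)) x)"
proof -
  obtain D :: "'a set" where D: "countable D" "\<And>X. open X \<Longrightarrow> X \<noteq> {} \<Longrightarrow> \<exists>d\<in>D. d \<in> X"
    using countable_dense_setE by blast
  define f where "f n p = sqrt (h (fst p) ^ DIM('a)) * cell_avg (h (fst p)) (u n) (snd p)"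
    for n :: nat and p :: "nat \<times> 'a"
  have "countable ((UNIV :: nat set) \<times> D)" using D(1) by simp
  moreover have "norm (f n p) \<le> C" for n p
  proof -
    have "norm (f n p) = sqrt (h (fst p) ^ DIM('a)) * \<bar>cell_avg (h (fst p)) (u n) (snd p)\<bar>"
      using h[of "fst p"] by (simp add: f_def abs_mult)
    also have "\<dots> \<le> C"
      using cell_avg_bound[OF h u(1,2), of "fst p" n "snd p"] u(3)[of n] by linarith
    finally show ?thesis .
  qed
  ultimately obtain r where r: "strict_mono (r :: nat \<Rightarrow> nat)"
    and conv: "\<And>p. p \<in> UNIV \<times> D \<Longrightarrow> \<exists>l. (\<lambda>n. f (r n) p) \<longlonglongrightarrow> l"
    using function_convergent_subsequence[of "UNIV \<times> D" f C] by blast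
  have "convergent (\<lambda>n. cell_avg (h k) (u (r n)) x)" for k x
  proof -
    obtain c where c: "box c (c + h k *\<^sub>R One) \<subseteq> cell (h k) x"
      using cell_sandwich[OF h] by metis
    have "box c (c + h k *\<^sub>R One) \<noteq> {}"
      using h[of k] by (simp add: box_ne_empty inner_add_left)
    then obtain d where d: "d \<in> D" "d \<in> cell (h k) x"
      using D(2)[OF open_box] c by blast
    obtain l where "(\<lambda>n. f (r n) (k, d)) \<longlonglongrightarrow> l" using conv[of "(k, d)"] d(1) by auto
    then have "(\<lambda>n. sqrt (h k ^ DIM('a)) * cell_avg (h k) (u (r n)) x) \<longlonglongrightarrow> l"
      unfolding f_def cell_avg_def using cell_eq[OF d(2)] by simp
    from tendsto_mult[OF tendsto_const[of "1 / sqrt (h k ^ DIM('a))"] this]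
    have "(\<lambda>n. cell_avg (h k) (u (r n)) x) \<longlonglongrightarrow> 1 / sqrt (h k ^ DIM('a)) * l"
      using h[of k] by simp
    then show ?thesis by (rule convergentI)
  qed
  then show ?thesis using that r by blast
qed

text \<open>The subsequence is chosen so that all averages converge for the meshes \<open>1 / (k + 1)\<close>. For a
  difference \<open>d\<close> of two of its members, the distance to the averages is small because the mesh is;
  the averages are small on a ball by dominated convergence and outside of it by tightness.\<close>

lemma compactness_test_functions:
  fixes u :: "nat \<Rightarrow> 'a::euclidean_space \<Rightarrow> real"
  assumes \<Omega>: "open \<Omega>"
    and K: "\<And>\<phi>. \<phi> \<in> test_functions \<Omega> \<Longrightarrow> (LINT x|lborel. \<bar>\<phi> x\<bar>) \<le> K * sq_norm lborel (gradient \<phi>)"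
    and u: "\<And>n. u n \<in> test_functions \<Omega>"
    and C: "\<And>n. sq_norm lborel (u n) \<le> C" "\<And>n. sq_norm lborel (gradient (u n)) \<le> C"
  obtains r :: "nat \<Rightarrow> nat" where "strict_mono r" "sq_Cauchy lborel (\<lambda>n. u (r n))"
proof -
  define h where "h k = 1 / real (Suc k)" for k
  have h: "0 < h k" for k by (simp add: h_def)
  note uS = test_sq_integrable(2)[OF \<Omega> u] and uI = test_integrable[OF u]
  obtain r :: "nat \<Rightarrow> nat" where r: "strict_mono r"
    and conv: "\<And>k x. convergent (\<lambda>n. cell_avg (h k) (u (r n)) x)"
    by (rule cell_avg_convergent_subsequence[where u=u and C=C and h=h, OF uI uS C(1) h]) (rule that)
  have C0: "0 \<le> C" using C(1)[of 0] sq_norm_nonneg[of lborel "u 0"] by linarith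
  define A where "A = sqrt (2 ^ DIM('a)) * DIM('a)"
  have A: "0 \<le> A" by (simp add: A_def)
  have "\<exists>N. \<forall>m\<ge>N. \<forall>n\<ge>N. sq_norm lborel (\<lambda>x. u (r m) x - u (r n) x) < e" if e: "0 < e" for e
  proof -
    obtain k where k: "A * (2 * C) * 2 / e < real k" using reals_Archimedean2 by blast
    have hk: "A * h k * (2 * C) < e / 2"
    proof -
      have "A * (2 * C) * 2 < e * real (Suc k)" using k e by (simp add: field_simps)
      then show ?thesis by (simp add: h_def field_simps)
    qed
    define n where "n = h k ^ DIM('a)"
    have n: "0 < n" using h[of k] by (simp add: n_def)
    \<comment> \<open>The uniform bound on the averages for the mesh \<open>h k\<close>; it blows up as the mesh shrinks, so the
      mesh is fixed before the tolerance \<open>\<delta>\<close> of the tightness estimate is.\<close>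
    define M where "M = C / sqrt n"
    have M0: "0 \<le> M" using C0 n by (simp add: M_def)
    have bd: "\<bar>cell_avg (h k) (u i) x\<bar> \<le> M" for i x
    proof -
      have "sqrt n * \<bar>cell_avg (h k) (u i) x\<bar> \<le> C"
        using cell_avg_bound[OF h uI uS, of k i x] C(1)[of i] by (simp add: n_def)
      then show ?thesis using n by (simp add: M_def pos_le_divide_eq mult.commute)
    qed
    define q where "q = 2 * M + 1"
    have q: "0 < q" "2 * M \<le> q" using M0 by (auto simp: q_def)
    define \<delta> where "\<delta> = e\<^sup>2 / (8 * q)"
    have \<delta>: "0 < \<delta>" using e q by (simp add: \<delta>_def)
    have q\<delta>: "q * \<delta> = e\<^sup>2 / 8" using q(1) by (simp add: \<delta>_def)
    have M\<delta>: "2 * M * \<delta> \<le> e\<^sup>2 / 8"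
      unfolding q\<delta>[symmetric] using \<delta> by (intro mult_right_mono q) simp
    obtain R where R: "\<And>\<phi>. \<phi> \<in> test_functions \<Omega> \<Longrightarrow> sq_norm lborel (gradient \<phi>) \<le> 2 * C \<Longrightarrow>
        (LINT x|lborel. indicator (- cball 0 R) x * \<bar>\<phi> x\<bar>) \<le> \<delta>"
      by (rule tightness[OF \<Omega> _ \<delta>, of _ "2 * C"], rule K, assumption, blast)
    define R' where "R' = R + DIM('a) * h k"
    have "\<exists>N. \<forall>i\<ge>N. \<forall>j\<ge>N. (LINT x|lborel. indicator (cball 0 R' :: 'a set) x
        * (cell_avg (h k) (u (r i)) x - cell_avg (h k) (u (r j)) x)\<^sup>2) < e\<^sup>2 / 8"
    proof (rule bounded_convergence_Cauchy[where C=M])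
      show "emeasure lborel (cball 0 R' :: 'a set) < \<infinity>"
        by (rule emeasure_bounded_finite) simp
      show "cell_avg (h k) (u (r i)) \<in> borel_measurable lborel" for i
        using cell_avg_measurable[OF borel_measurable_continuous_onI[OF test_continuous[OF u]]] by simp
    qed (use bd conv e in auto)
    then obtain N where N: "\<And>i j. i \<ge> N \<Longrightarrow> j \<ge> N \<Longrightarrow> (LINT x|lborel. indicator (cball 0 R' :: 'a set) x
        * (cell_avg (h k) (u (r i)) x - cell_avg (h k) (u (r j)) x)\<^sup>2) < e\<^sup>2 / 8"
      by blast
    have "sq_norm lborel (\<lambda>x. u (r i) x - u (r j) x) < e" if ij: "i \<ge> N" "j \<ge> N" for i j
    proof -
      define d where "d = (\<lambda>x. u (r i) x + (-1) * u (r j) x)"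
      have dT: "d \<in> test_functions \<Omega>" unfolding d_def by (rule test_add_scale[OF u u])
      have d_alt: "d = (\<lambda>x. u (r i) x - u (r j) x)" by (simp add: d_def)
      have avg: "cell_avg (h k) d x = cell_avg (h k) (u (r i)) x - cell_avg (h k) (u (r j)) x" for x
        unfolding d_alt by (rule cell_avg_diff[OF uI uI])
      have Gd: "sq_norm lborel (gradient d) \<le> 2 * C"
      proof -
        have "gradient d = (\<lambda>x. gradient (u (r i)) x + (-1) *\<^sub>R gradient (u (r j)) x)"
          unfolding d_def by (rule ext) (intro gradient_add_scale test_differentiable[OF u])
        then have "sq_norm lborel (gradient d) \<le> sq_norm lborel (gradient (u (r i))) + sq_norm lborel (\<lambda>x. (-1) *\<^sub>R gradient (u (r j)) x)"
          by (simp only:) (intro sq_norm_triangle sq_integrable_scale test_sq_integrable(5)[OF \<Omega> u])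
        then show ?thesis using C(2)[of "r i"] C(2)[of "r j"] unfolding sq_norm_scale by simp
      qed
      note approx = cell_avg_approx[OF \<Omega> h dT, of k]
      have dm: "d \<in> borel_measurable borel"
        using test_continuous[OF dT] by (rule borel_measurable_continuous_onI)
      have out: "(\<integral>\<^sup>+x. indicator (- cball 0 R') x * ennreal \<bar>cell_avg (h k) d x\<bar> \<partial>lborel) \<le> ennreal \<delta>"
        unfolding R'_def
        by (rule order_trans[OF cell_avg_outside[OF h test_integrable[OF dT] dm] ennreal_leI[OF R[OF dT Gd]]])
      have dbd: "\<bar>cell_avg (h k) d x\<bar> \<le> 2 * M" for x
        unfolding avg using bd[of "r i" x] bd[of "r j" x] by linarith
      have "(sq_norm lborel (cell_avg (h k) d))\<^sup>2
          \<le> (LINT x|lborel. indicator (cball 0 R') x * (cell_avg (h k) d x)\<^sup>2) + 2 * M * \<delta>"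
        by (rule sq_norm_split[OF approx(1) dbd out]) (use \<delta> in simp)
      also have "\<dots> < e\<^sup>2 / 8 + e\<^sup>2 / 8"
        unfolding avg by (intro add_less_le_mono N ij M\<delta>)
      also have "\<dots> = (e / 2)\<^sup>2" by (simp add: power2_eq_square)
      finally have a: "sq_norm lborel (cell_avg (h k) d) < e / 2"
        by (rule power2_less_imp_less) (use e in simp)
      have "sq_norm lborel (\<lambda>x. d x - cell_avg (h k) d x) \<le> A * h k * sq_norm lborel (gradient d)"
        using approx(2) by (simp add: A_def)
      also have "\<dots> \<le> A * h k * (2 * C)"
        using A h[of k] Gd by (intro mult_left_mono) auto
      finally have b: "sq_norm lborel (\<lambda>x. d x - cell_avg (h k) d x) < e / 2" using hk by simp
      have "sq_norm lborel d \<le> sq_norm lborel (\<lambda>x. d x - cell_avg (h k) d x) + sq_norm lborel (cell_avg (h k) d)"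
        using sq_norm_triangle[OF sq_integrable_diff[OF test_sq_integrable(2)[OF \<Omega> dT] approx(1)] approx(1)] by simp
      then show ?thesis using a b unfolding d_alt[symmetric] by simp
    qed
    then show ?thesis by blast
  qed
  then have "sq_Cauchy lborel (\<lambda>n. u (r n))" unfolding sq_Cauchy_def by blast
  then show ?thesis using that r by blast
qed

text \<open>Each element of the closure is replaced by a test function at distance less than
  \<open>1 / (n + 1)\<close>, which changes neither the boundedness nor the limits.\<close>

lemma compact_resolvent_sequence:
  fixes \<Omega> :: "'a::euclidean_space set"
  assumes \<Omega>: "open \<Omega>"
    and K: "\<And>\<phi>. \<phi> \<in> test_functions \<Omega> \<Longrightarrow> (LINT x|lborel. \<bar>\<phi> x\<bar>) \<le> K * sq_norm lborel (gradient \<phi>)"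
    and U: "\<And>n. U n \<in> jet_closure \<Omega>" and C: "\<And>n. sq_norm (lebesgue_on \<Omega>) (U n) \<le> C"
  obtains g and r :: "nat \<Rightarrow> nat" where "g \<in> sq_integrable (lebesgue_on \<Omega>)" "strict_mono r"
    "(\<lambda>n. sq_norm (lebesgue_on \<Omega>) (\<lambda>x. fst (U (r n) x) - g x)) \<longlonglongrightarrow> 0"
proof -
  let ?M = "lebesgue_on \<Omega>"
  note UM = jet_closure_sq_integrable[OF \<Omega> U]
  have "\<exists>\<phi>. \<phi> \<in> test_functions \<Omega> \<and> sq_norm ?M (\<lambda>x. jet \<phi> x - U n x) < 1 / real (Suc n)" for n
  proof -
    obtain \<phi> where \<phi>: "\<And>i::nat. \<phi> i \<in> test_functions \<Omega>" "(\<lambda>i. sq_norm ?M (\<lambda>x. jet (\<phi> i) x - U n x)) \<longlonglongrightarrow> 0"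
      by (rule jet_closureE[OF \<Omega> U[of n]]) blast
    have "\<forall>\<^sub>F i in sequentially. sq_norm ?M (\<lambda>x. jet (\<phi> i) x - U n x) < 1 / real (Suc n)"
      by (rule order_tendstoD(2)[OF \<phi>(2)]) simp
    then obtain i where "sq_norm ?M (\<lambda>x. jet (\<phi> i) x - U n x) < 1 / real (Suc n)"
      using eventually_happens trivial_limit_sequentially by blast
    then show ?thesis using \<phi>(1) by blast
  qed
  then obtain \<phi> where \<phi>: "\<And>n. \<phi> n \<in> test_functions \<Omega>"
    and close: "\<And>n. sq_norm ?M (\<lambda>x. jet (\<phi> n) x - U n x) < 1 / real (Suc n)"
    by metis
  have jb: "sq_norm ?M (jet (\<phi> n)) \<le> C + 1" for n
  proof -
    have "sq_norm ?M (jet (\<phi> n)) \<le> sq_norm ?M (\<lambda>x. jet (\<phi> n) x - U n x) + sq_norm ?M (U n)"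
      using sq_norm_triangle[OF sq_integrable_diff[OF jet_sq_integrable[OF \<Omega> \<phi>] UM] UM, of n n n] by simp
    moreover have "1 / real (Suc n) \<le> 1" by simp
    ultimately show ?thesis using close[of n] C[of n] by linarith
  qed
  have b1: "sq_norm lborel (\<phi> n) \<le> C + 1" for n
    using sq_norm_fst_snd_le(1)[OF jet_sq_integrable[OF \<Omega> \<phi>], of n] jb[of n] test_sq_integrable(3)[OF \<Omega> \<phi>, of n]
    by (simp add: jet_def)
  have b2: "sq_norm lborel (gradient (\<phi> n)) \<le> C + 1" for n
    using sq_norm_fst_snd_le(2)[OF jet_sq_integrable[OF \<Omega> \<phi>], of n] jb[of n] test_sq_integrable(6)[OF \<Omega> \<phi>, of n]
    by (simp add: jet_def)
  obtain r :: "nat \<Rightarrow> nat" where r: "strict_mono r" and cau: "sq_Cauchy lborel (\<lambda>n. \<phi> (r n))"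
    by (rule compactness_test_functions[where u=\<phi>, OF \<Omega> _ \<phi> b1 b2], rule K, assumption, rule that)
  have "sq_norm ?M (\<lambda>x. \<phi> i x - \<phi> j x) = sq_norm lborel (\<lambda>x. \<phi> i x - \<phi> j x)" for i j
    using test_sq_integrable(3)[OF \<Omega> test_add_scale[OF \<phi> \<phi>, of i "-1" j]] by simp
  then have "sq_Cauchy ?M (\<lambda>n. \<phi> (r n))" using cau by (simp add: sq_Cauchy_def)
  then obtain g where g: "g \<in> sq_integrable ?M" "(\<lambda>n. sq_norm ?M (\<lambda>x. \<phi> (r n) x - g x)) \<longlonglongrightarrow> 0"
    by (rule sq_norm_complete[where f="\<lambda>n. \<phi> (r n)", OF test_sq_integrable(1)[OF \<Omega> \<phi>]])
  have le: "sq_norm ?M (\<lambda>x. fst (U (r n) x) - g x) \<le> 1 / real (Suc n) + sq_norm ?M (\<lambda>x. \<phi> (r n) x - g x)" for n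
  proof -
    have "sq_norm ?M (\<lambda>x. fst (U (r n) x) - g x)
        \<le> sq_norm ?M (\<lambda>x. fst (U (r n) x) - \<phi> (r n) x) + sq_norm ?M (\<lambda>x. \<phi> (r n) x - g x)"
      by (intro sq_norm_triangle_diff sq_integrable_fst_snd UM test_sq_integrable(1)[OF \<Omega> \<phi>] g)
    also have "sq_norm ?M (\<lambda>x. fst (U (r n) x) - \<phi> (r n) x) = sq_norm ?M (\<lambda>x. fst (jet (\<phi> (r n)) x - U (r n) x))"
      by (subst sq_norm_minus_commute) (simp add: jet_def)
    also have "\<dots> \<le> sq_norm ?M (\<lambda>x. jet (\<phi> (r n)) x - U (r n) x)"
      by (intro sq_norm_fst_snd_le(1) sq_integrable_diff jet_sq_integrable[OF \<Omega> \<phi>] UM)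
    also have "\<dots> \<le> 1 / real (Suc (r n))" using close[of "r n"] by simp
    also have "\<dots> \<le> 1 / real (Suc n)"
      using seq_suble[OF r, of n] by (intro divide_left_mono) auto
    finally show ?thesis by simp
  qed
  have "(\<lambda>n. 1 / real (Suc n) + sq_norm ?M (\<lambda>x. \<phi> (r n) x - g x)) \<longlonglongrightarrow> 0 + 0"
    by (intro tendsto_add LIMSEQ_Suc[OF lim_1_over_n] g)
  then have lim: "(\<lambda>n. 1 / real (Suc n) + sq_norm ?M (\<lambda>x. \<phi> (r n) x - g x)) \<longlonglongrightarrow> 0" by simp
  have "(\<lambda>n. sq_norm ?M (\<lambda>x. fst (U (r n) x) - g x)) \<longlonglongrightarrow> 0"
    by (rule Lim_null_comparison[OF always_eventually lim]) (use le in \<open>simp add: sq_norm_nonneg\<close>)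
  then show ?thesis using that g(1) r by blast
qed

theorem mainTheorem5:
  fixes \<Omega> :: "'a::euclidean_space set"
  assumes "open \<Omega>"
    and "torsional_rigidity \<Omega> < \<infinity>"
  shows "compact_operator_L2 \<Omega> (dirichlet_resolvent \<Omega>)"
proof -
  note \<Omega> = assms(1)
  let ?M = "lebesgue_on \<Omega>" and ?T = "dirichlet_resolvent \<Omega>"
  have "\<exists>w. torsion_function \<Omega> w"
  proof (rule ccontr)
    assume "\<nexists>w. torsion_function \<Omega> w"
    then have "torsional_rigidity \<Omega> = \<infinity>" unfolding torsional_rigidity_def by (rule if_not_P)
    then show False using assms(2) by simp
  qed
  then obtain w where w: "torsion_function \<Omega> w" ..
  obtain K where K: "0 \<le> K"
    "\<And>\<psi>. \<psi> \<in> test_functions \<Omega> \<Longrightarrow> \<bar>LINT x|lborel. \<psi> x\<bar> \<le> K * sq_norm lborel (gradient \<psi>)"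
    by (rule torsion_function_bound[OF \<Omega> w]) blast
  have L1: "(LINT x|lborel. \<bar>\<phi> x\<bar>) \<le> K * sq_norm lborel (gradient \<phi>)" if "\<phi> \<in> test_functions \<Omega>" for \<phi>
    by (rule L1_bound[OF \<Omega> K that])
  have res: "\<exists>U. weak_solution \<Omega> f U \<and> ?T f = (\<lambda>x. fst (U x))" if "f \<in> sq_integrable ?M" for f
    by (rule dirichlet_resolvent_weak_solution[OF \<Omega> that]) blast
  have jc: "U \<in> jet_closure \<Omega>" if "weak_solution \<Omega> f U" for f U
    using that by (simp add: weak_solution_def[OF \<Omega>])
  show ?thesis
    unfolding compact_operator_L2_def L2_eq_sq_integrable L2_norm_eq_sq_norm
  proof (intro conjI ballI allI impI)
    fix f :: "'a \<Rightarrow> real" assume "f \<in> sq_integrable ?M"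
    then obtain U where "weak_solution \<Omega> f U" "?T f = (\<lambda>x. fst (U x))" using res by blast
    then show "?T f \<in> sq_integrable ?M" using sq_integrable_fst_snd(1)[OF jet_closure_sq_integrable[OF \<Omega> jc]] by simp
  next
    fix f g :: "'a \<Rightarrow> real" assume f: "f \<in> sq_integrable ?M" and g: "g \<in> sq_integrable ?M" and eq: "AE x in ?M. f x = g x"
    obtain U where U: "weak_solution \<Omega> f U" "?T f = (\<lambda>x. fst (U x))" using res[OF f] by blast
    obtain V where V: "weak_solution \<Omega> g V" "?T g = (\<lambda>x. fst (V x))" using res[OF g] by blast
    have "AE x in ?M. U x = V x" by (rule weak_solution_unique[OF \<Omega> f g U(1) V(1) eq])
    then show "AE x in ?M. ?T f x = ?T g x" unfolding U(2) V(2) by auto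
  next
    fix f g :: "'a \<Rightarrow> real" and a b :: real assume f: "f \<in> sq_integrable ?M" and g: "g \<in> sq_integrable ?M"
    obtain U where U: "weak_solution \<Omega> f U" "?T f = (\<lambda>x. fst (U x))" using res[OF f] by blast
    obtain V where V: "weak_solution \<Omega> g V" "?T g = (\<lambda>x. fst (V x))" using res[OF g] by blast
    define q where "q = (\<lambda>y. a * f y + b * g y)"
    \<comment> \<open>The linearity of weak solutions only scales the second summand, so \<open>a f\<close> is written as
      \<open>f + (a - 1) f\<close>.\<close>
    have fz: "f \<in> sq_integrable ?M" "(\<lambda>x. f x + (a - 1) * f x) \<in> sq_integrable ?M" "q \<in> sq_integrable ?M"
      using sq_integrable_add[OF f sq_integrable_scale[OF f, of "a - 1"]]
        sq_integrable_add[OF sq_integrable_scale[OF f, of a] sq_integrable_scale[OF g, of b]] f by (simp_all add: q_def)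
    have "weak_solution \<Omega> (\<lambda>x. (f x + (a - 1) * f x) + b * g x) (\<lambda>x. (U x + (a - 1) *\<^sub>R U x) + b *\<^sub>R V x)"
      by (intro weak_solution_add_scale[OF \<Omega>] fz g U V)
    then have lin: "weak_solution \<Omega> q (\<lambda>x. (U x + (a - 1) *\<^sub>R U x) + b *\<^sub>R V x)"
      by (simp add: q_def algebra_simps)
    obtain W where W: "weak_solution \<Omega> q W" "?T q = (\<lambda>x. fst (W x))" using res[OF fz(3)] by blast
    have "AE x in ?M. W x = (U x + (a - 1) *\<^sub>R U x) + b *\<^sub>R V x"
      by (rule weak_solution_unique[OF \<Omega> fz(3) fz(3) W(1) lin]) simp
    then show "AE x in ?M. ?T (\<lambda>y. a * f y + b * g y) x = a * ?T f x + b * ?T g x"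
      unfolding q_def[symmetric] U(2) V(2) W(2) by eventually_elim (simp add: algebra_simps)
  next
    fix F :: "nat \<Rightarrow> 'a \<Rightarrow> real"
    assume F: "(\<forall>n. F n \<in> sq_integrable ?M) \<and> (\<exists>C. \<forall>n. sq_norm ?M (F n) \<le> C)"
    then obtain C where FM: "\<And>n. F n \<in> sq_integrable ?M" and C: "\<And>n. sq_norm ?M (F n) \<le> C" by blast
    obtain U where U: "\<And>n. weak_solution \<Omega> (F n) (U n)" "\<And>n. ?T (F n) = (\<lambda>x. fst (U n x))"
      using res[OF FM] by metis
    have Ub: "sq_norm ?M (U n) \<le> C" for n
      using weak_solution_bound[OF \<Omega> FM U(1), of n] C[of n] by linarith
    obtain g and r :: "nat \<Rightarrow> nat" where "g \<in> sq_integrable ?M" "strict_mono r"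
      "(\<lambda>n. sq_norm ?M (\<lambda>x. fst (U (r n) x) - g x)) \<longlonglongrightarrow> 0"
      by (rule compact_resolvent_sequence[where U=U and C=C, OF \<Omega> _ jc[OF U(1)] Ub], rule L1, assumption, rule that)
    then show "\<exists>g\<in>sq_integrable ?M. \<exists>r. strict_mono r \<and> (\<lambda>n. sq_norm ?M (\<lambda>x. ?T (F (r n)) x - g x)) \<longlonglongrightarrow> 0"
      unfolding U(2) by blast
  qed
qed

end
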